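(* Let $\Omega_1\subset\mathbb{R}^{N_1}$ and $\Omega_2\subset\mathbb{R}^{N_2}$ be regions satisfying (B1) and (B2), let $b_2$ satisfy (B3) on $\partial\Omega_2$, and let $\Omega_p:=\Omega_1\times\Omega_2$. Let $\{\lambda_{1j}\}_{j\in\mathbb{N}}$, $\{f_{1j}\}_{j\in\mathbb{N}}$ be the Neumann Laplacian eigenvalues and eigenfunctions on $\Omega_1$, let $\{\delta_{2k}\}_{k\in\mathbb{N}_0}$, $\{s_{2k}\}_{k\in\mathbb{N}_0}$ be the harmonic Steklov eigenvalues and eigenfunctions on $\Omega_2$ with weight $b_2$, and put $u_{jk}:=f_{1j}\otimes s_{2k}$ for $j\in\mathbb{N}$, $k\in\mathbb{N}_0$. Then each $u_{jk}$ is a Neumann–Steklov Laplacian (NSL) eigenfunction on $\Omega_p$ corresponding to the eigenpair $(\lambda_{1j},\delta_{2k})$.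
   Context: A region is a nonempty, connected, open subset of $\mathbb{R}^N$; $\mathbb{N}_0:=\mathbb{N}\cup\{0\}$. All function spaces are real; $\sigma$ denotes $(N-1)$-dimensional Hausdorff measure on a boundary ($\sigma_2$ the one on $\partial\Omega_2$), and in boundary integrals functions are replaced by their traces. Condition (B1) on a region $\Omega\subset\mathbb{R}^N$: $\Omega$ is bounded and its boundary $\partial\Omega:=\overline{\Omega}\setminus\Omega$ is the union of a finite number of disjoint closed Lipschitz surfaces, each having finite surface area. Condition (B2): $\Omega$ satisfies (B1); the imbedding of $H^1(\Omega)$ into $L^p(\Omega)$ is compact for $1\le p<p_s$, where $p_s=2N/(N-2)$ if $N\ge3$ and $p_s=\infty$ if $N=2$ (Rellich theorem); and the trace map $\gamma:H^1(\Omega)\to L^2(\partial\Omega,d\sigma)$ is compact ($L^2$-compact trace theorem). Condition (B3) on $b:\partial\Omega\to(0,\infty)$: $b$ is Borel measurable, $b\in L^\infty(\partial\Omega,d\sigma)$ and $b\ge b_0>0$ $\sigma$-a.e. for some constant $b_0$. For functions $f$ on $\Omega_1$ and $g$ on $\Omega_2$, $(f\otimes g)(x,y):=f(x)g(y)$. Neumann eigendata on $\Omega_1$: pairs $(\lambda_{1j},f_{1j})$ with $f_{1j}\in H^1(\Omega_1)$, $\int_{\Omega_1}\nabla f_{1j}\cdot\nabla h\,dx=\lambda_{1j}\int_{\Omega_1}f_{1j}h\,dx$ for all $h\in H^1(\Omega_1)$; the $\lambda_{1j}\ge0$ are all the eigenvalues repeated according to multiplicity, increasing to $\infty$, and $\{f_{1j}\}$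 is a maximal orthonormal set in $H^1(\Omega_1)$ for the standard inner product. Harmonic Steklov eigendata on $\Omega_2$ with weight $b_2$: pairs $(\delta_{2k},s_{2k})$ with $0\ne s_{2k}\in H^1(\Omega_2)$ and $\int_{\Omega_2}\nabla s_{2k}\cdot\nabla h\,dy=\delta_{2k}\int_{\partial\Omega_2}b_2\,s_{2k}\,h\,d\sigma_2$ for all $h\in H^1(\Omega_2)$, where $\delta_{20}=0$, $s_{20}\equiv1$, and $\{\delta_{2k}\}_{k\ge1}$ is the increasing sequence of strictly positive Steklov eigenvalues with eigenfunctions $s_{2k}$, $k\ge1$, orthonormal for $[u,v]_{b_2}:=\int_{\Omega_2}\nabla u\cdot\nabla v\,dy+\int_{\partial\Omega_2}b_2uv\,d\sigma_2$; $\{s_{2k}\}_{k\ge0}$ is a maximal orthogonal set in the $[\cdot,\cdot]_{b_2}$-orthogonal complement of $H_0^1(\Omega_2)$ in $H^1(\Omega_2)$. NSL eigenproblem on $\Omega_p$: find $(\lambda,\delta,u)\in\mathbb{R}^2\times H^1(\Omega_p)$, $u\ne0$, with $$\int_{\Omega_p}\nabla u\cdot\nabla h\,dx\,dy=\lambda\int_{\Omega_p}u\,h\,dx\,dy+\delta\int_{\Omega_1}\int_{\partial\Omega_2}b_2\,u\,h\,d\sigma_2\,dx\quad\text{for all }h\in H^1(\Omega_p);$$ $u$ is then called an NSL eigenfunction corresponding to the eigenpair $(\lambda,\delta)$. *)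

theory Defs
  imports "HOL-Analysis.Analysis"
begin

section \<open>Hausdorff measure and surface measure\<close>

text \<open>
  The Euclidean spaces of the mathematical text are types of class \<open>euclidean_space\<close>; the norm
  and the Lebesgue measure of the product type \<open>'a \<times> 'b\<close> are the ones of the product space.

  \<open>hausdorff_pre k d A\<close> is the size-\<open>d\<close> pre-measure, normalised by the volume of the
  \<open>k\<close>-dimensional unit ball. The empty set is weighted 0 separately because of
  \<open>0 ^ 0 = 1\<close>, and boundedness is required because \<open>diameter\<close> is not meaningful on
  unbounded sets.
\<close>

definition hausdorff_pre :: "nat \<Rightarrow> real \<Rightarrow> 'a::metric_space set \<Rightarrow> ennreal" where
  "hausdorff_pre k d A =
     (INF C\<in>{C :: nat \<Rightarrow> 'a set. A \<subseteq> (\<Union>n. C n) \<and> (\<forall>n. bounded (C n) \<and> diameter (C n) \<le> d)}.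
        \<Sum>n. ennreal (if C n = {} then 0 else unit_ball_vol (real k) * (diameter (C n) / 2) ^ k))"

definition hausdorff_outer :: "nat \<Rightarrow> 'a::metric_space set \<Rightarrow> ennreal" where
  "hausdorff_outer k A = (SUP d\<in>{0<..}. hausdorff_pre k d A)"

text \<open>
  \<open>hausdorff_outer k\<close> is a metric outer measure, hence countably additive on Borel sets, so
  \<open>measure_of\<close> yields its restriction to the Borel sets.
\<close>

definition hausdorff_measure :: "nat \<Rightarrow> 'a::metric_space measure" where
  "hausdorff_measure k = measure_of UNIV (sets borel) (hausdorff_outer k)"

definition surface_measure :: "'a::euclidean_space set \<Rightarrow> 'a measure" where
  "surface_measure S = restrict_space (hausdorff_measure (DIM('a) - 1)) S"

abbreviation bdry :: "'a::euclidean_space set \<Rightarrow> 'a set" where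
  "bdry \<Omega> \<equiv> closure \<Omega> - \<Omega>"


section \<open>Lebesgue spaces\<close>

text \<open>
  Elements of \<open>L\<^sup>p\<close> are represented by functions; equality in \<open>L\<^sup>p\<close> is equality almost everywhere.
\<close>

definition Lp :: "real \<Rightarrow> 'a measure \<Rightarrow> ('a \<Rightarrow> 'c::real_normed_vector) set" where
  "Lp p M = {f. f \<in> borel_measurable M \<and> integrable M (\<lambda>x. norm (f x) powr p)}"

definition Lp_norm :: "real \<Rightarrow> 'a measure \<Rightarrow> ('a \<Rightarrow> 'c::real_normed_vector) \<Rightarrow> real" where
  "Lp_norm p M f = (LINT x|M. norm (f x) powr p) powr (1 / p)"


section \<open>The Sobolev spaces \<open>H\<^sup>1\<close> and \<open>H\<^sub>0\<^sup>1\<close>\<close>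

primrec Ck :: "nat \<Rightarrow> ('a::euclidean_space \<Rightarrow> real) \<Rightarrow> bool" where
  "Ck 0 f \<longleftrightarrow> continuous_on UNIV f"
| "Ck (Suc k) f \<longleftrightarrow> (\<forall>x. f differentiable (at x)) \<and>
     (\<forall>i\<in>Basis. Ck k (\<lambda>x. frechet_derivative f (at x) i))"

definition test_functions :: "'a::euclidean_space set \<Rightarrow> ('a \<Rightarrow> real) set" where
  "test_functions \<Omega> =
     {\<phi>. (\<forall>k. Ck k \<phi>) \<and> (\<exists>K. compact K \<and> K \<subseteq> \<Omega> \<and> (\<forall>x. x \<notin> K \<longrightarrow> \<phi> x = 0))}"

definition has_weak_gradient ::
    "'a::euclidean_space set \<Rightarrow> ('a \<Rightarrow> real) \<Rightarrow> ('a \<Rightarrow> 'a) \<Rightarrow> bool" where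
  "has_weak_gradient \<Omega> u G \<longleftrightarrow> G \<in> Lp 2 (lebesgue_on \<Omega>) \<and>
     (\<forall>\<phi>\<in>test_functions \<Omega>. \<forall>i\<in>Basis.
        (LINT x|lebesgue_on \<Omega>. u x * frechet_derivative \<phi> (at x) i) =
        - (LINT x|lebesgue_on \<Omega>. (G x \<bullet> i) * \<phi> x))"

definition H1 :: "'a::euclidean_space set \<Rightarrow> ('a \<Rightarrow> real) set" where
  "H1 \<Omega> = {u. u \<in> Lp 2 (lebesgue_on \<Omega>) \<and> (\<exists>G. has_weak_gradient \<Omega> u G)}"

text \<open>The weak gradient is unique up to null sets; \<open>wgrad\<close> picks a representative.\<close>

definition wgrad :: "'a::euclidean_space set \<Rightarrow> ('a \<Rightarrow> real) \<Rightarrow> 'a \<Rightarrow> 'a" where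
  "wgrad \<Omega> u = (SOME G. has_weak_gradient \<Omega> u G)"

definition L2_inner :: "'a::euclidean_space set \<Rightarrow> ('a \<Rightarrow> real) \<Rightarrow> ('a \<Rightarrow> real) \<Rightarrow> real" where
  "L2_inner \<Omega> u v = (LINT x|lebesgue_on \<Omega>. u x * v x)"

definition dirichlet_form :: "'a::euclidean_space set \<Rightarrow> ('a \<Rightarrow> real) \<Rightarrow> ('a \<Rightarrow> real) \<Rightarrow> real" where
  "dirichlet_form \<Omega> u v = (LINT x|lebesgue_on \<Omega>. wgrad \<Omega> u x \<bullet> wgrad \<Omega> v x)"

definition H1_inner :: "'a::euclidean_space set \<Rightarrow> ('a \<Rightarrow> real) \<Rightarrow> ('a \<Rightarrow> real) \<Rightarrow> real" where
  "H1_inner \<Omega> u v = L2_inner \<Omega> u v + dirichlet_form \<Omega> u v"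

definition H1_norm :: "'a::euclidean_space set \<Rightarrow> ('a \<Rightarrow> real) \<Rightarrow> real" where
  "H1_norm \<Omega> u = sqrt (H1_inner \<Omega> u u)"

definition H10 :: "'a::euclidean_space set \<Rightarrow> ('a \<Rightarrow> real) set" where
  "H10 \<Omega> = {u \<in> H1 \<Omega>. \<exists>\<phi>. (\<forall>n::nat. \<phi> n \<in> test_functions \<Omega>) \<and>
     (\<lambda>n. H1_norm \<Omega> (\<lambda>x. \<phi> n x - u x)) \<longlonglongrightarrow> 0}"

definition ae_zero :: "'a::euclidean_space set \<Rightarrow> ('a \<Rightarrow> real) \<Rightarrow> bool" where
  "ae_zero \<Omega> u \<longleftrightarrow> (AE x in lebesgue_on \<Omega>. u x = 0)"


section \<open>Traces\<close>

text \<open>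
  The trace map is the continuous extension to \<open>H\<^sup>1(\<Omega>)\<close> of the restriction of Lipschitz functions on
  the closure of \<open>\<Omega>\<close> to (a part of) the boundary. The measure \<open>M\<close> carries both the part of the
  boundary (as its space) and the measure on it: the surface measure on the whole boundary, or, for a
  product region, the product measure on \<open>\<Omega>\<^sub>1 \<times> \<partial>\<Omega>\<^sub>2\<close>.
\<close>

definition has_trace ::
    "'a::euclidean_space set \<Rightarrow> 'a measure \<Rightarrow> ('a \<Rightarrow> real) \<Rightarrow> ('a \<Rightarrow> real) \<Rightarrow> bool" where
  "has_trace \<Omega> M u g \<longleftrightarrow> u \<in> H1 \<Omega> \<and> g \<in> Lp 2 M \<and>
     (\<exists>\<phi>. (\<forall>n::nat. \<exists>L. L-lipschitz_on (closure \<Omega>) (\<phi> n)) \<and>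
          (\<forall>n. \<phi> n \<in> H1 \<Omega> \<and> \<phi> n \<in> Lp 2 M) \<and>
          (\<lambda>n. H1_norm \<Omega> (\<lambda>x. \<phi> n x - u x)) \<longlonglongrightarrow> 0 \<and>
          (\<lambda>n. Lp_norm 2 M (\<lambda>x. \<phi> n x - g x)) \<longlonglongrightarrow> 0)"

definition trace_on :: "'a::euclidean_space set \<Rightarrow> 'a measure \<Rightarrow> ('a \<Rightarrow> real) \<Rightarrow> 'a \<Rightarrow> real" where
  "trace_on \<Omega> M u = (SOME g. has_trace \<Omega> M u g)"

abbreviation bd_trace :: "'a::euclidean_space set \<Rightarrow> ('a \<Rightarrow> real) \<Rightarrow> 'a \<Rightarrow> real" where
  "bd_trace \<Omega> \<equiv> trace_on \<Omega> (surface_measure (bdry \<Omega>))"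

definition lateral_measure ::
    "'a::euclidean_space set \<Rightarrow> 'b::euclidean_space set \<Rightarrow> ('a \<times> 'b) measure" where
  "lateral_measure \<Omega>\<^sub>1 \<Omega>\<^sub>2 = lebesgue_on \<Omega>\<^sub>1 \<Otimes>\<^sub>M surface_measure (bdry \<Omega>\<^sub>2)"

abbreviation lateral_trace ::
    "'a::euclidean_space set \<Rightarrow> 'b::euclidean_space set \<Rightarrow> ('a \<times> 'b \<Rightarrow> real) \<Rightarrow> 'a \<times> 'b \<Rightarrow> real" where
  "lateral_trace \<Omega>\<^sub>1 \<Omega>\<^sub>2 \<equiv> trace_on (\<Omega>\<^sub>1 \<times> \<Omega>\<^sub>2) (lateral_measure \<Omega>\<^sub>1 \<Omega>\<^sub>2)"


section \<open>Conditions on the regions and on the weight\<close>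

definition region :: "'a::euclidean_space set \<Rightarrow> bool" where
  "region \<Omega> \<longleftrightarrow> \<Omega> \<noteq> {} \<and> connected \<Omega> \<and> open \<Omega>"

text \<open>
  A Lipschitz surface is locally the graph of a Lipschitz function over the hyperplane orthogonal to
  some unit vector \<open>e\<close>. The function is taken on the whole space (a Lipschitz function on the
  hyperplane extends), but only its values on the hyperplane matter.
\<close>

definition lipschitz_surface :: "'a::euclidean_space set \<Rightarrow> bool" where
  "lipschitz_surface S \<longleftrightarrow>
     (\<forall>p\<in>S. \<exists>e U L \<psi>. norm e = 1 \<and> open U \<and> p \<in> U \<and> L-lipschitz_on UNIV \<psi> \<and>
        S \<inter> U = {x \<in> U. x \<bullet> e = (\<psi> (x - (x \<bullet> e) *\<^sub>R e) :: real)})"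

definition cond_B1 :: "'a::euclidean_space set \<Rightarrow> bool" where
  "cond_B1 \<Omega> \<longleftrightarrow> bounded \<Omega> \<and>
     (\<exists>\<S>. finite \<S> \<and> disjoint \<S> \<and> bdry \<Omega> = \<Union>\<S> \<and>
        (\<forall>S\<in>\<S>. closed S \<and> lipschitz_surface S \<and>
           emeasure (surface_measure S) S < \<infinity>))"

definition compact_embedding :: "'a::euclidean_space set \<Rightarrow> real \<Rightarrow> bool" where
  "compact_embedding \<Omega> p \<longleftrightarrow> H1 \<Omega> \<subseteq> Lp p (lebesgue_on \<Omega>) \<and>
     (\<forall>u C. (\<forall>n::nat. u n \<in> H1 \<Omega> \<and> H1_norm \<Omega> (u n) \<le> C) \<longrightarrow>
        (\<exists>r g. strict_mono r \<and> g \<in> Lp p (lebesgue_on \<Omega>) \<and>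
           (\<lambda>n. Lp_norm p (lebesgue_on \<Omega>) (\<lambda>x. u (r n) x - g x)) \<longlonglongrightarrow> 0))"

text \<open>
  The trace map is everywhere defined on \<open>H\<^sup>1(\<Omega>)\<close> and compact. The compactness is stated for all
  traces of the functions of a bounded sequence; this includes that traces are unique up to null
  sets (apply it to the traces \<open>n * g\<close> of \<open>0\<close>, for a trace \<open>g\<close> of \<open>0\<close>).
\<close>

definition compact_trace :: "'a::euclidean_space set \<Rightarrow> bool" where
  "compact_trace \<Omega> \<longleftrightarrow>
     (let \<sigma> = surface_measure (bdry \<Omega>) in
      (\<forall>u\<in>H1 \<Omega>. \<exists>g. has_trace \<Omega> \<sigma> u g) \<and>
      (\<forall>u g C. (\<forall>n::nat. H1_norm \<Omega> (u n) \<le> C \<and> has_trace \<Omega> \<sigma> (u n) (g n)) \<longrightarrow>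
         (\<exists>r g0. strict_mono r \<and> g0 \<in> Lp 2 \<sigma> \<and>
            (\<lambda>n. Lp_norm 2 \<sigma> (\<lambda>x. g (r n) x - g0 x)) \<longlonglongrightarrow> 0)))"

definition cond_B2 :: "'a::euclidean_space set \<Rightarrow> bool" where
  "cond_B2 \<Omega> \<longleftrightarrow> cond_B1 \<Omega> \<and>
     (\<forall>p. 1 \<le> p \<and> (DIM('a) \<ge> 3 \<longrightarrow> p < 2 * real DIM('a) / (real DIM('a) - 2)) \<longrightarrow>
        compact_embedding \<Omega> p) \<and>
     compact_trace \<Omega>"

definition cond_B3 :: "'a::euclidean_space set \<Rightarrow> ('a \<Rightarrow> real) \<Rightarrow> bool" where
  "cond_B3 \<Omega> b \<longleftrightarrow>
     (let \<sigma> = surface_measure (bdry \<Omega>) in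
      (\<forall>x\<in>bdry \<Omega>. 0 < b x) \<and>
      b \<in> borel_measurable \<sigma> \<and>
      (\<exists>C. AE x in \<sigma>. \<bar>b x\<bar> \<le> C) \<and>
      (\<exists>b0>0. AE x in \<sigma>. b0 \<le> b x))"


section \<open>Neumann eigendata\<close>

definition neumann_solution :: "'a::euclidean_space set \<Rightarrow> real \<Rightarrow> ('a \<Rightarrow> real) \<Rightarrow> bool" where
  "neumann_solution \<Omega> \<mu> u \<longleftrightarrow> u \<in> H1 \<Omega> \<and>
     (\<forall>h\<in>H1 \<Omega>. dirichlet_form \<Omega> u h = \<mu> * L2_inner \<Omega> u h)"

text \<open>
  The sequences are indexed by \<open>j \<ge> 1\<close>. That all eigenvalues occur, repeated according to
  multiplicity, is the condition that the (orthonormal, hence independent) \<open>f j\<close> with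
  \<open>lam j = \<mu>\<close> span the space of solutions for \<open>\<mu>\<close>, for each real \<open>\<mu>\<close>.
\<close>

definition neumann_eigendata ::
    "'a::euclidean_space set \<Rightarrow> (nat \<Rightarrow> real) \<Rightarrow> (nat \<Rightarrow> 'a \<Rightarrow> real) \<Rightarrow> bool" where
  "neumann_eigendata \<Omega> lam f \<longleftrightarrow>
     (\<forall>j\<ge>1. neumann_solution \<Omega> (lam j) (f j) \<and> 0 \<le> lam j) \<and>
     mono_on {1..} lam \<and> filterlim lam at_top sequentially \<and>
     (\<forall>\<mu> u. neumann_solution \<Omega> \<mu> u \<longrightarrow>
        (\<exists>F c. finite F \<and> F \<subseteq> {j. 1 \<le> j \<and> lam j = \<mu>} \<and>
           (AE x in lebesgue_on \<Omega>. u x = (\<Sum>j\<in>F. c j * f j x)))) \<and>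
     (\<forall>i\<ge>1. \<forall>j\<ge>1. H1_inner \<Omega> (f i) (f j) = (if i = j then 1 else 0)) \<and>
     (\<forall>v\<in>H1 \<Omega>. (\<forall>j\<ge>1. H1_inner \<Omega> v (f j) = 0) \<longrightarrow> ae_zero \<Omega> v)"


section \<open>Harmonic Steklov eigendata\<close>

definition bd_form ::
    "'a::euclidean_space set \<Rightarrow> ('a \<Rightarrow> real) \<Rightarrow> ('a \<Rightarrow> real) \<Rightarrow> ('a \<Rightarrow> real) \<Rightarrow> real" where
  "bd_form \<Omega> b u v =
     (LINT y|surface_measure (bdry \<Omega>). b y * bd_trace \<Omega> u y * bd_trace \<Omega> v y)"

definition b_inner ::
    "'a::euclidean_space set \<Rightarrow> ('a \<Rightarrow> real) \<Rightarrow> ('a \<Rightarrow> real) \<Rightarrow> ('a \<Rightarrow> real) \<Rightarrow> real" where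
  "b_inner \<Omega> b u v = dirichlet_form \<Omega> u v + bd_form \<Omega> b u v"

definition steklov_eigenpair ::
    "'a::euclidean_space set \<Rightarrow> ('a \<Rightarrow> real) \<Rightarrow> real \<Rightarrow> ('a \<Rightarrow> real) \<Rightarrow> bool" where
  "steklov_eigenpair \<Omega> b \<delta> s \<longleftrightarrow> s \<in> H1 \<Omega> \<and> \<not> ae_zero \<Omega> s \<and>
     (\<forall>h\<in>H1 \<Omega>. dirichlet_form \<Omega> s h = \<delta> * bd_form \<Omega> b s h)"

definition H10_complement :: "'a::euclidean_space set \<Rightarrow> ('a \<Rightarrow> real) \<Rightarrow> ('a \<Rightarrow> real) set" where
  "H10_complement \<Omega> b = {u \<in> H1 \<Omega>. \<forall>v\<in>H10 \<Omega>. b_inner \<Omega> b u v = 0}"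

definition steklov_eigendata ::
    "'a::euclidean_space set \<Rightarrow> ('a \<Rightarrow> real) \<Rightarrow> (nat \<Rightarrow> real) \<Rightarrow> (nat \<Rightarrow> 'a \<Rightarrow> real) \<Rightarrow> bool" where
  "steklov_eigendata \<Omega> b \<delta> s \<longleftrightarrow>
     (\<forall>k. steklov_eigenpair \<Omega> b (\<delta> k) (s k)) \<and>
     \<delta> 0 = 0 \<and> (AE x in lebesgue_on \<Omega>. s 0 x = 1) \<and>
     (\<forall>k\<ge>1. 0 < \<delta> k) \<and> mono_on {1..} \<delta> \<and>
     (\<forall>\<mu> u. 0 < \<mu> \<and> steklov_eigenpair \<Omega> b \<mu> u \<longrightarrow> (\<exists>k\<ge>1. \<delta> k = \<mu>)) \<and>
     (\<forall>i\<ge>1. \<forall>k\<ge>1. b_inner \<Omega> b (s i) (s k) = (if i = k then 1 else 0)) \<and>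
     (\<forall>k. s k \<in> H10_complement \<Omega> b) \<and>
     (\<forall>i k. i \<noteq> k \<longrightarrow> b_inner \<Omega> b (s i) (s k) = 0) \<and>
     (\<forall>v\<in>H10_complement \<Omega> b. (\<forall>k. b_inner \<Omega> b v (s k) = 0) \<longrightarrow> ae_zero \<Omega> v)"


section \<open>The Neumann--Steklov problem on a product region\<close>

definition tensor :: "('a \<Rightarrow> real) \<Rightarrow> ('b \<Rightarrow> real) \<Rightarrow> 'a \<times> 'b \<Rightarrow> real" (infixr \<open>\<otimes>\<^sub>f\<close> 70) where
  "f \<otimes>\<^sub>f g = (\<lambda>(x, y). f x * g y)"

definition NSL_eigenfunction ::
    "'a::euclidean_space set \<Rightarrow> 'b::euclidean_space set \<Rightarrow> ('b \<Rightarrow> real) \<Rightarrow> real \<times> real \<Rightarrow>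
     ('a \<times> 'b \<Rightarrow> real) \<Rightarrow> bool" where
  "NSL_eigenfunction \<Omega>\<^sub>1 \<Omega>\<^sub>2 b\<^sub>2 = (\<lambda>(lam, \<delta>) u.
     u \<in> H1 (\<Omega>\<^sub>1 \<times> \<Omega>\<^sub>2) \<and> \<not> ae_zero (\<Omega>\<^sub>1 \<times> \<Omega>\<^sub>2) u \<and>
     (\<forall>h\<in>H1 (\<Omega>\<^sub>1 \<times> \<Omega>\<^sub>2).
        dirichlet_form (\<Omega>\<^sub>1 \<times> \<Omega>\<^sub>2) u h =
        lam * L2_inner (\<Omega>\<^sub>1 \<times> \<Omega>\<^sub>2) u h +
        \<delta> * (LINT x|lebesgue_on \<Omega>\<^sub>1. LINT y|surface_measure (bdry \<Omega>\<^sub>2).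
               b\<^sub>2 y * lateral_trace \<Omega>\<^sub>1 \<Omega>\<^sub>2 u (x, y) * lateral_trace \<Omega>\<^sub>1 \<Omega>\<^sub>2 h (x, y))))"

end

theory Submission
  imports Defs
begin

text \<open>
  Let \<open>u = f \<otimes> s\<close> with a Neumann eigenfunction \<open>f\<close> on \<open>\<Omega>\<^sub>1\<close> and a Steklov eigenfunction \<open>s\<close> on \<open>\<Omega>\<^sub>2\<close>. Its gradient is
  \<open>(s \<nabla>f, f \<nabla>s)\<close>. For \<open>h\<close> in \<open>H\<^sup>1(\<Omega>\<^sub>1 \<times> \<Omega>\<^sub>2)\<close>, Fubini's theorem moves the factor that is not differentiated onto \<open>h\<close>:
  the Dirichlet form of \<open>u\<close> and \<open>h\<close> is the sum of the Dirichlet form of \<open>f\<close> with the average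
  \<open>h\<^sub>s(x) = \<integral> h(x, y) s(y) dy\<close> on \<open>\<Omega>\<^sub>1\<close> and of the Dirichlet form of \<open>s\<close> with the average
  \<open>h\<^sub>f(y) = \<integral> f(x) h(x, y) dx\<close> on \<open>\<Omega>\<^sub>2\<close> (\<open>tensor_dirichlet_form\<close>). The averages belong to \<open>H\<^sup>1\<close> of the factors
  (\<open>avg_sobolev_pair\<close>), so they are admissible in the two eigenvalue equations. The Neumann equation gives
  \<open>\<lambda> \<integral> f h\<^sub>s = \<lambda> \<integral> u h\<close>, the Steklov equation gives \<open>\<delta> \<integral> b s h\<^sub>f\<close> over the boundary of \<open>\<Omega>\<^sub>2\<close>.

  The last integral is the required one if the trace of \<open>h\<^sub>f\<close> is the average of the lateral trace of \<open>h\<close>, and the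
  lateral trace of \<open>u\<close> is \<open>f\<close> times the trace of \<open>s\<close>. The lateral trace is defined as some limit of restrictions of Lipschitz
  functions, so one has to know that such limits exist and are unique, although traces are only assumed to be
  well behaved on the factors.

  Averaging maps Lipschitz functions to Lipschitz functions and is continuous, hence takes every lateral trace of \<open>h\<close> to
  a trace of the average (\<open>has_trace_avg\<close>). Traces on \<open>\<Omega>\<^sub>2\<close> are unique because the trace map is compact, hence bounded
  (\<open>compact_trace_bounded\<close>); as the Neumann eigenfunctions are complete in \<open>L\<^sup>2(\<Omega>\<^sub>1)\<close> (\<open>complete_L2\<close>), lateral traces are
  unique too (\<open>lateral_trace_unique\<close>).

  For existence, \<open>h\<close> is expanded along the Neumann eigenfunctions \<open>f\<^sub>j\<close> of \<open>\<Omega>\<^sub>1\<close>, with the averages against \<open>f\<^sub>j\<close> as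
  coefficients. The terms of the expansion are orthogonal in \<open>H\<^sup>1(\<Omega>\<^sub>1 \<times> \<Omega>\<^sub>2)\<close>, the series converges there to \<open>h\<close>, and
  \<open>\<Sum>\<^sub>j (1 + \<lambda>\<^sub>j) \<parallel>coefficient j\<parallel>\<^sup>2\<close> is finite for the norm of \<open>H\<^sup>1(\<Omega>\<^sub>2)\<close> (\<open>neumann_expansion\<close>). Each term has a lateral
  trace, namely a tensor product (\<open>has_trace_tensor\<close>), and the bound for the trace map of \<open>\<Omega>\<^sub>2\<close> makes the orthogonal series
  of these traces converge (\<open>lateral_trace_exists_rep\<close>).

  The analytic foundation consists of the completeness of \<open>L\<^sup>2\<close> (\<open>L2_complete\<close>), of smooth bump functions for boxes, and of the
  fundamental lemma of the calculus of variations (\<open>fundamental_lemma\<close>), from which uniqueness of weak gradients follows.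
\<close>

section \<open>Square-integrable functions\<close>

definition L2_ip :: "'m measure \<Rightarrow> ('m \<Rightarrow> 'c::euclidean_space) \<Rightarrow> ('m \<Rightarrow> 'c) \<Rightarrow> real" where
  "L2_ip M f g = (LINT x|M. f x \<bullet> g x)"

definition L2_norm :: "'m measure \<Rightarrow> ('m \<Rightarrow> 'c::euclidean_space) \<Rightarrow> real" where
  "L2_norm M f = sqrt (L2_ip M f f)"

lemma powr_2_norm: "norm (x::'c::real_normed_vector) powr 2 = (norm x)\<^sup>2"
  by (simp add: powr_numeral)

lemma Lp2_iff:
  "f \<in> Lp 2 M \<longleftrightarrow> f \<in> borel_measurable M \<and> integrable M (\<lambda>x. (norm (f x))\<^sup>2)"
  by (simp add: Lp_def powr_2_norm)

lemma Lp2_measurable: "f \<in> Lp 2 M \<Longrightarrow> f \<in> borel_measurable M"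
  by (simp add: Lp2_iff)

lemma Lp_norm_2: "Lp_norm 2 M f = L2_norm M f"
proof -
  have "0 \<le> (LINT x|M. (norm (f x))\<^sup>2)" by simp
  then show ?thesis
    by (simp add: Lp_norm_def L2_norm_def L2_ip_def powr_2_norm powr_half_sqrt
      power2_norm_eq_inner del: Bochner_Integration.integral_nonneg_AE)
qed

lemma L2_norm_nonneg: "0 \<le> L2_norm M f"
  by (simp add: L2_norm_def L2_ip_def)

lemma L2_norm_sq: "(L2_norm M f)\<^sup>2 = L2_ip M f f"
  by (simp add: L2_norm_def L2_ip_def)

lemma L2_norm_sq_integral: "(L2_norm M f)\<^sup>2 = (LINT x|M. (norm (f x))\<^sup>2)"
  by (simp add: L2_norm_sq L2_ip_def power2_norm_eq_inner)

lemma Lp2_mult_integrable: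
  fixes f :: "'m \<Rightarrow> 'c::euclidean_space" and g :: "'m \<Rightarrow> 'd::euclidean_space"
  assumes "f \<in> Lp 2 M" "g \<in> Lp 2 M"
  shows "integrable M (\<lambda>x. norm (f x) * norm (g x))"
proof (rule Bochner_Integration.integrable_bound)
  show "integrable M (\<lambda>x. (norm (f x))\<^sup>2 + (norm (g x))\<^sup>2)"
    using assms by (auto simp: Lp2_iff)
  show "(\<lambda>x. norm (f x) * norm (g x)) \<in> borel_measurable M"
    using assms by (auto simp: Lp2_iff)
  have "norm (f x) * norm (g x) \<le> (norm (f x))\<^sup>2 + (norm (g x))\<^sup>2" for x
    using sum_squares_bound[of "norm (f x)" "norm (g x)"]
     mult_nonneg_nonneg[of "norm (f x)" "norm (g x)"] norm_ge_zero[of "f x"] norm_ge_zero[of "g x"]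
    by linarith
  then show "AE x in M. norm (norm (f x) * norm (g x)) \<le> norm ((norm (f x))\<^sup>2 + (norm (g x))\<^sup>2)"
    by (auto simp: abs_mult)
qed

lemma Lp2_inner_integrable:
  fixes f g :: "'m \<Rightarrow> 'c::euclidean_space"
  assumes "f \<in> Lp 2 M" "g \<in> Lp 2 M"
  shows "integrable M (\<lambda>x. f x \<bullet> g x)"
  by (rule Bochner_Integration.integrable_bound[OF Lp2_mult_integrable[OF assms]])
    (use assms in \<open>auto simp: Lp2_iff Cauchy_Schwarz_ineq2\<close>)

lemma Lp2_times_integrable:
  fixes f g :: "'m \<Rightarrow> real"
  assumes "f \<in> Lp 2 M" "g \<in> Lp 2 M"
  shows "integrable M (\<lambda>x. f x * g x)"
  using Lp2_inner_integrable[OF assms] by simp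

lemma Lp2_scaleR_integrable:
  fixes f :: "'m \<Rightarrow> real" and g :: "'m \<Rightarrow> 'c::euclidean_space"
  assumes "f \<in> Lp 2 M" "g \<in> Lp 2 M"
  shows "integrable M (\<lambda>x. f x *\<^sub>R g x)"
  by (rule Bochner_Integration.integrable_bound[OF Lp2_mult_integrable[OF assms]])
    (use assms in \<open>auto simp: Lp2_iff\<close>)

lemma Lp2_bound:
  fixes f :: "'m \<Rightarrow> 'c::euclidean_space" and g :: "'m \<Rightarrow> 'd::euclidean_space"
  assumes "f \<in> Lp 2 M" "g \<in> borel_measurable M" "AE x in M. norm (g x) \<le> C * norm (f x)"
  shows "g \<in> Lp 2 M"
  unfolding Lp2_iff
proof
  show "integrable M (\<lambda>x. (norm (g x))\<^sup>2)"
  proof (rule Bochner_Integration.integrable_bound)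
    show "integrable M (\<lambda>x. C\<^sup>2 * (norm (f x))\<^sup>2)" using assms(1) by (auto simp: Lp2_iff)
    show "AE x in M. norm ((norm (g x))\<^sup>2) \<le> norm (C\<^sup>2 * (norm (f x))\<^sup>2)"
      using assms(3)
    proof eventually_elim
      case (elim x)
      then have "(norm (g x))\<^sup>2 \<le> (C * norm (f x))\<^sup>2" by (intro power_mono) auto
      then show ?case by (simp add: power_mult_distrib)
    qed
  qed (use assms in auto)
qed (fact assms)

lemma Lp2_scaleR: "f \<in> Lp 2 M \<Longrightarrow> (\<lambda>x. c *\<^sub>R f x) \<in> Lp 2 M"
  for f :: "'m \<Rightarrow> 'c::euclidean_space"
  by (rule Lp2_bound[where C="\<bar>c\<bar>"]) (auto simp: Lp2_iff)

lemma Lp2_cmult: "f \<in> Lp 2 M \<Longrightarrow> (\<lambda>x. c * f x) \<in> Lp 2 M"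
  for f :: "'m \<Rightarrow> real"
  using Lp2_scaleR[of f M c] by simp

lemma Lp2_add:
  fixes f g :: "'m \<Rightarrow> 'c::euclidean_space"
  assumes "f \<in> Lp 2 M" "g \<in> Lp 2 M"
  shows "(\<lambda>x. f x + g x) \<in> Lp 2 M"
  unfolding Lp2_iff
proof
  show "(\<lambda>x. f x + g x) \<in> borel_measurable M" using assms by (auto simp: Lp2_iff)
  have "integrable M (\<lambda>x. f x \<bullet> f x + 2 * (f x \<bullet> g x) + g x \<bullet> g x)"
    using Lp2_inner_integrable[OF assms] Lp2_inner_integrable[OF assms(1,1)] Lp2_inner_integrable[OF assms(2,2)]
    by (intro Bochner_Integration.integrable_add integrable_mult_right)
  then show "integrable M (\<lambda>x. (norm (f x + g x))\<^sup>2)"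
    by (simp add: power2_norm_eq_inner inner_simps inner_commute algebra_simps)
qed

lemma Lp2_diff:
  fixes f g :: "'m \<Rightarrow> 'c::euclidean_space"
  assumes "f \<in> Lp 2 M" "g \<in> Lp 2 M"
  shows "(\<lambda>x. f x - g x) \<in> Lp 2 M"
  using Lp2_add[OF assms(1) Lp2_scaleR[OF assms(2), of "-1"]] by simp

lemma Lp2_zero: "(\<lambda>x. 0) \<in> Lp 2 M"
  by (simp add: Lp2_iff)

lemma Lp2_sum:
  fixes f :: "'i \<Rightarrow> 'm \<Rightarrow> 'c::euclidean_space"
  assumes "\<And>i. i \<in> I \<Longrightarrow> f i \<in> Lp 2 M"
  shows "(\<lambda>x. \<Sum>i\<in>I. f i x) \<in> Lp 2 M"
  using assms by (induction I rule: infinite_finite_induct) (auto intro: Lp2_add simp: Lp2_zero)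

lemma Lp2_AE_cong:
  fixes f g :: "'m \<Rightarrow> 'c::euclidean_space"
  assumes "f \<in> Lp 2 M" "AE x in M. f x = g x" "g \<in> borel_measurable M"
  shows "g \<in> Lp 2 M"
  by (rule Lp2_bound[OF assms(1,3), where C=1]) (use assms(2) in auto)

lemma Lp2_integrable:
  fixes f :: "'m \<Rightarrow> 'c::euclidean_space"
  assumes "finite_measure M" "f \<in> Lp 2 M"
  shows "integrable M f"
proof -
  interpret finite_measure M by fact
  have "(\<lambda>_. 1::real) \<in> Lp 2 M" by (simp add: Lp2_iff)
  from Lp2_scaleR_integrable[OF this assms(2)] show ?thesis by simp
qed

lemma Lp2_bounded:
  fixes f :: "'m \<Rightarrow> 'c::euclidean_space"
  assumes "finite_measure M" "f \<in> borel_measurable M" "\<And>x. x \<in> space M \<Longrightarrow> norm (f x) \<le> B"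
  shows "f \<in> Lp 2 M"
proof -
  interpret finite_measure M by fact
  have "(\<lambda>_. 1::real) \<in> Lp 2 M" by (simp add: Lp2_iff)
  then show ?thesis by (rule Lp2_bound[where C=B]) (use assms in auto)
qed

lemma Lp2_mult_bounded:
  fixes f b :: "'m \<Rightarrow> real"
  assumes "f \<in> Lp 2 M" "b \<in> borel_measurable M" "\<And>x. \<bar>b x\<bar> \<le> C"
  shows "(\<lambda>x. f x * b x) \<in> Lp 2 M"
proof (rule Lp2_bound[OF assms(1), where C=C])
  have "norm (f x * b x) \<le> C * norm (f x)" for x
    using mult_right_mono[OF assms(3), of "norm (f x)" x] by (simp add: abs_mult mult.commute)
  then show "AE x in M. norm (f x * b x) \<le> C * norm (f x)" by blast
qed (use assms in \<open>auto simp: Lp2_iff\<close>)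

lemma Lp2_inner_const: "G \<in> Lp 2 M \<Longrightarrow> (\<lambda>x. G x \<bullet> i) \<in> Lp 2 M"
  for G :: "'m \<Rightarrow> 'c::euclidean_space"
  by (rule Lp2_bound[where C="norm i"])
    (auto simp: Lp2_iff Cauchy_Schwarz_ineq2 mult.commute[of "norm i"])

lemma Lp2_Pair:
  fixes u :: "'m \<Rightarrow> 'c::euclidean_space" and G :: "'m \<Rightarrow> 'd::euclidean_space"
  assumes "u \<in> Lp 2 M" "G \<in> Lp 2 M"
  shows "(\<lambda>x. (u x, G x)) \<in> Lp 2 M"
  using assms unfolding Lp2_iff by (auto simp: norm_Pair intro: borel_measurable_Pair)

lemma Lp2_fst_comp: "G \<in> Lp 2 M \<Longrightarrow> (\<lambda>z. fst (G z)) \<in> Lp 2 M"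
  for G :: "'m \<Rightarrow> 'c::euclidean_space \<times> 'd::euclidean_space"
proof -
  assume G: "G \<in> Lp 2 M"
  have "(fst :: 'c \<times> 'd \<Rightarrow> _) \<in> borel_measurable borel"
    by (intro borel_measurable_continuous_onI continuous_intros)
  from measurable_compose[OF Lp2_measurable[OF G] this]
  have m: "(\<lambda>z. fst (G z)) \<in> borel_measurable M" .
  have "norm (fst (G x)) \<le> 1 * norm (G x)" for x
    using norm_fst_le[of "fst (G x)" "snd (G x)"] by simp
  then show ?thesis by (intro Lp2_bound[OF G m, where C=1]) blast
qed

lemma Lp2_snd_comp: "G \<in> Lp 2 M \<Longrightarrow> (\<lambda>z. snd (G z)) \<in> Lp 2 M"
  for G :: "'m \<Rightarrow> 'c::euclidean_space \<times> 'd::euclidean_space"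
proof -
  assume G: "G \<in> Lp 2 M"
  have "(snd :: 'c \<times> 'd \<Rightarrow> _) \<in> borel_measurable borel"
    by (intro borel_measurable_continuous_onI continuous_intros)
  from measurable_compose[OF Lp2_measurable[OF G] this]
  have m: "(\<lambda>z. snd (G z)) \<in> borel_measurable M" .
  have "norm (snd (G x)) \<le> 1 * norm (G x)" for x
    using norm_snd_le[of "snd (G x)" "fst (G x)"] by simp
  then show ?thesis by (intro Lp2_bound[OF G m, where C=1]) blast
qed

lemma L2_ip_commute: "L2_ip M f g = L2_ip M g f"
  by (simp add: L2_ip_def inner_commute)

lemma L2_ip_add_left:
  assumes "f \<in> Lp 2 M" "g \<in> Lp 2 M" "h \<in> Lp 2 M"
  shows "L2_ip M (\<lambda>x. f x + g x) h = L2_ip M f h + L2_ip M g h"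
  using Lp2_inner_integrable[OF assms(1,3)] Lp2_inner_integrable[OF assms(2,3)]
  by (simp add: L2_ip_def inner_simps)

lemma L2_ip_diff_left:
  assumes "f \<in> Lp 2 M" "g \<in> Lp 2 M" "h \<in> Lp 2 M"
  shows "L2_ip M (\<lambda>x. f x - g x) h = L2_ip M f h - L2_ip M g h"
  using Lp2_inner_integrable[OF assms(1,3)] Lp2_inner_integrable[OF assms(2,3)]
  by (simp add: L2_ip_def inner_simps)

lemma L2_ip_scaleR_left: "L2_ip M (\<lambda>x. c *\<^sub>R f x) h = c * L2_ip M f h"
  by (simp add: L2_ip_def)

lemma L2_ip_sum_left:
  assumes "\<And>i. i \<in> I \<Longrightarrow> f i \<in> Lp 2 M" "h \<in> Lp 2 M"
  shows "L2_ip M (\<lambda>x. \<Sum>i\<in>I. f i x) h = (\<Sum>i\<in>I. L2_ip M (f i) h)"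
  using Lp2_inner_integrable[OF assms(1) assms(2)]
  by (simp add: L2_ip_def inner_sum_left)

lemma L2_ip_cong_AE:
  assumes "AE x in M. f x = f' x" "AE x in M. g x = g' x"
    and "f \<in> borel_measurable M" "f' \<in> borel_measurable M"
     "g \<in> borel_measurable M" "g' \<in> borel_measurable M"
  shows "L2_ip M f g = L2_ip M f' g'"
  unfolding L2_ip_def by (rule integral_cong_AE) (use assms in auto)

lemma L2_norm_scaleR: "L2_norm M (\<lambda>x. c *\<^sub>R f x) = \<bar>c\<bar> * L2_norm M f"
  by (simp add: L2_norm_def L2_ip_def real_sqrt_mult)

text \<open>
  The usual discriminant argument: the quadratic \<open>t \<mapsto> \<parallel>f - t g\<parallel>\<^sup>2\<close> is nonnegative.
\<close>

lemma L2_cauchy_schwarz: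
  assumes f: "f \<in> Lp 2 M" and g: "g \<in> Lp 2 M"
  shows "\<bar>L2_ip M f g\<bar> \<le> L2_norm M f * L2_norm M g"
proof -
  let ?A = "L2_ip M f f" and ?B = "L2_ip M f g" and ?C = "L2_ip M g g"
  have q: "0 \<le> ?A - 2 * t * ?B + t\<^sup>2 * ?C" for t
  proof -
    have "0 \<le> L2_ip M (\<lambda>x. f x - t *\<^sub>R g x) (\<lambda>x. f x - t *\<^sub>R g x)"
      by (simp add: L2_ip_def)
    also have "\<dots> = (LINT x|M. f x \<bullet> f x - 2 * t * (f x \<bullet> g x) + t\<^sup>2 * (g x \<bullet> g x))"
      unfolding L2_ip_def
      by (intro Bochner_Integration.integral_cong refl)
        (simp add: inner_simps inner_commute power2_eq_square algebra_simps)
    also have "\<dots> = ?A - 2 * t * ?B + t\<^sup>2 * ?C"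
      using Lp2_inner_integrable[OF f f] Lp2_inner_integrable[OF f g] Lp2_inner_integrable[OF g g]
      by (simp add: L2_ip_def)
    finally show ?thesis .
  qed
  have A: "0 \<le> ?A" and C: "0 \<le> ?C" by (simp_all add: L2_ip_def)
  have "?B\<^sup>2 \<le> ?A * ?C"
  proof (cases "?C = 0")
    case True
    have "?B = 0"
    proof (rule ccontr)
      assume "?B \<noteq> 0"
      then show False using q[of "(?A + 1) / (2 * ?B)"] True by simp
    qed
    then show ?thesis using True by simp
  next
    case False
    then have "0 < ?C" using C by simp
    \<comment> \<open>The minimum of the quadratic.\<close>
    then show ?thesis using q[of "?B / ?C"]
      by (simp add: field_simps power2_eq_square)
  qed
  then have "sqrt (?B\<^sup>2) \<le> sqrt (?A * ?C)" by (rule real_sqrt_le_mono)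
  then show ?thesis by (simp add: L2_norm_def real_sqrt_mult)
qed

lemma L2_norm_triangle:
  assumes f: "f \<in> Lp 2 M" and g: "g \<in> Lp 2 M"
  shows "L2_norm M (\<lambda>x. f x + g x) \<le> L2_norm M f + L2_norm M g"
proof (rule power2_le_imp_le)
  note s = Lp2_add[OF f g]
  have "(L2_norm M (\<lambda>x. f x + g x))\<^sup>2 = L2_ip M f f + 2 * L2_ip M f g + L2_ip M g g"
    by (simp add: L2_norm_sq L2_ip_add_left[OF f g s] L2_ip_commute[of M _ "\<lambda>x. f x + g x"]
        L2_ip_add_left[OF f g f] L2_ip_add_left[OF f g g] L2_ip_commute[of M g f])
  also have "\<dots> \<le> (L2_norm M f + L2_norm M g)\<^sup>2"
    using L2_cauchy_schwarz[OF f g] by (simp add: power2_sum L2_norm_sq)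
  finally show "(L2_norm M (\<lambda>x. f x + g x))\<^sup>2 \<le> (L2_norm M f + L2_norm M g)\<^sup>2" .
qed (simp add: L2_norm_nonneg)

lemma L2_norm_minus_commute: "L2_norm M (\<lambda>x. f x - g x) = L2_norm M (\<lambda>x. g x - f x)"
  using L2_norm_scaleR[of M "-1" "\<lambda>x. f x - g x"] by simp

lemma L2_norm_triangle_diff:
  assumes f: "f \<in> Lp 2 M" and g: "g \<in> Lp 2 M" and h: "h \<in> Lp 2 M"
  shows "L2_norm M (\<lambda>x. f x - h x) \<le> L2_norm M (\<lambda>x. f x - g x) + L2_norm M (\<lambda>x. g x - h x)"
  using L2_norm_triangle[OF Lp2_diff[OF f g] Lp2_diff[OF g h]] by simp

lemma L2_norm_cong_AE:
  assumes "AE x in M. f x = f' x"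
    and "f \<in> borel_measurable M" "f' \<in> borel_measurable M"
  shows "L2_norm M f = L2_norm M f'"
  unfolding L2_norm_def using L2_ip_cong_AE[OF assms(1,1)] assms by simp

lemma L2_norm_eq_0_iff:
  assumes "f \<in> Lp 2 M"
  shows "L2_norm M f = 0 \<longleftrightarrow> (AE x in M. f x = 0)"
proof -
  have "L2_norm M f = 0 \<longleftrightarrow> (LINT x|M. (norm (f x))\<^sup>2) = 0"
    using L2_norm_sq_integral[of M f] by auto
  also have "\<dots> \<longleftrightarrow> (AE x in M. (norm (f x))\<^sup>2 = 0)"
    by (rule integral_nonneg_eq_0_iff_AE) (use assms in \<open>auto simp: Lp2_iff\<close>)
  finally show ?thesis by simp
qed

lemma L2_norm_component:
  assumes "f \<in> Lp 2 M" "g \<in> borel_measurable M" "\<And>x. norm (g x) \<le> norm (f x)"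
  shows "L2_norm M g \<le> L2_norm M f"
proof (rule power2_le_imp_le)
  have g: "g \<in> Lp 2 M" by (rule Lp2_bound[OF assms(1,2), where C=1]) (use assms(3) in auto)
  show "(L2_norm M g)\<^sup>2 \<le> (L2_norm M f)\<^sup>2"
    unfolding L2_norm_sq_integral
    by (rule integral_mono) (use assms g in \<open>auto simp: Lp2_iff intro: power_mono\<close>)
qed (rule L2_norm_nonneg)

lemma L2_norm_fst_le:
  fixes F :: "'m \<Rightarrow> 'c::euclidean_space \<times> 'd::euclidean_space"
  assumes "F \<in> Lp 2 M"
  shows "L2_norm M (\<lambda>x. fst (F x)) \<le> L2_norm M F"
proof (rule L2_norm_component[OF assms Lp2_measurable[OF Lp2_fst_comp[OF assms]]])
  show "norm (fst (F x)) \<le> norm (F x)" for x using norm_fst_le[of "fst (F x)" "snd (F x)"] by simp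
qed

lemma L2_norm_snd_le:
  fixes F :: "'m \<Rightarrow> 'c::euclidean_space \<times> 'd::euclidean_space"
  assumes "F \<in> Lp 2 M"
  shows "L2_norm M (\<lambda>x. snd (F x)) \<le> L2_norm M F"
proof (rule L2_norm_component[OF assms Lp2_measurable[OF Lp2_snd_comp[OF assms]]])
  show "norm (snd (F x)) \<le> norm (F x)" for x using norm_snd_le[of "snd (F x)" "fst (F x)"] by simp
qed

lemma L2_ip_tendsto:
  assumes f: "\<And>n. f n \<in> Lp 2 M" and g: "g \<in> Lp 2 M" and h: "h \<in> Lp 2 M"
    and lim: "(\<lambda>n. L2_norm M (\<lambda>x. f n x - g x)) \<longlonglongrightarrow> 0"
  shows "(\<lambda>n. L2_ip M (f n) h) \<longlonglongrightarrow> L2_ip M g h"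
proof -
  have "(\<lambda>n. L2_ip M (f n) h - L2_ip M g h) \<longlonglongrightarrow> 0"
  proof (rule Lim_null_comparison)
    show "\<forall>\<^sub>F n in sequentially. norm (L2_ip M (f n) h - L2_ip M g h)
        \<le> L2_norm M (\<lambda>x. f n x - g x) * L2_norm M h"
      using L2_cauchy_schwarz[OF Lp2_diff[OF f g] h] L2_ip_diff_left[OF f g h] by simp
    show "(\<lambda>n. L2_norm M (\<lambda>x. f n x - g x) * L2_norm M h) \<longlonglongrightarrow> 0"
      using tendsto_mult_right[OF lim, of "L2_norm M h"] by simp
  qed
  then show ?thesis by (simp add: LIM_zero_iff)
qed

lemma tendsto_zero_bound:
  fixes a b :: "nat \<Rightarrow> real"
  assumes "b \<longlonglongrightarrow> 0" "\<And>n. 0 \<le> a n" "\<And>n. a n \<le> b n"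
  shows "a \<longlonglongrightarrow> 0"
  by (rule tendsto_sandwich[OF _ _ tendsto_const assms(1)]) (simp_all add: assms)

section \<open>Completeness and orthogonal series\<close>

text \<open>
  The weights \<open>2\<^sup>k\<close> are the point: \<open>\<Sum>\<^sub>k 2\<^sup>k \<integral> \<bar>s\<^sub>k\<^sub>+\<^sub>1 - s\<^sub>k\<bar>\<^sup>2\<close> is still finite, so almost everywhere
  \<open>\<bar>s\<^sub>k\<^sub>+\<^sub>1 - s\<^sub>k\<bar> = O(2\<^sup>-\<^sup>k\<^sup>/\<^sup>2)\<close>, which is summable.
\<close>

lemma L2_fast_AE_convergent:
  fixes s :: "nat \<Rightarrow> 'm \<Rightarrow> 'c::euclidean_space"
  assumes s: "\<And>k. s k \<in> Lp 2 M"
    and fast: "\<And>k. L2_norm M (\<lambda>x. s (Suc k) x - s k x) \<le> (1/2)^k"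
  shows "AE x in M. convergent (\<lambda>k. s k x)"
proof -
  let ?d = "\<lambda>k x. 2^k * (norm (s (Suc k) x - s k x))\<^sup>2"
  have d: "integrable M (?d k)" for k
    using Lp2_diff[OF s s, of "Suc k" k] by (auto simp: Lp2_iff)
  have int: "(LINT x|M. ?d k x) \<le> (1/2)^k" for k
  proof -
    have "(L2_norm M (\<lambda>x. s (Suc k) x - s k x))\<^sup>2 \<le> ((1/2)^k)\<^sup>2"
      by (intro power_mono fast L2_norm_nonneg)
    then have "2^k * (L2_norm M (\<lambda>x. s (Suc k) x - s k x))\<^sup>2 \<le> 2^k * ((1/2)^k)\<^sup>2"
      by simp
    also have "\<dots> = (1/2)^k"
      by (simp add: power2_eq_square flip: power_mult_distrib)
    finally show ?thesis by (simp add: L2_norm_sq_integral)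
  qed
  have "(\<integral>\<^sup>+x. (\<Sum>k. ennreal (?d k x)) \<partial>M) = (\<Sum>k. \<integral>\<^sup>+x. ennreal (?d k x) \<partial>M)"
    by (rule nn_integral_suminf) (use d in auto)
  also have "\<dots> = (\<Sum>k. ennreal (LINT x|M. ?d k x))"
    using d by (subst nn_integral_eq_integral) auto
  also have "\<dots> \<le> (\<Sum>k. ennreal ((1/2)^k))"
    by (intro suminf_le ennreal_leI int) auto
  also have "\<dots> < \<infinity>"
    by (subst suminf_ennreal2) (auto intro: summable_geometric)
  finally have "AE x in M. (\<Sum>k. ennreal (?d k x)) \<noteq> \<infinity>"
    using d by (intro nn_integral_PInf_AE) auto
  then show ?thesis
  proof eventually_elim
    case (elim x)
    then have "summable (\<lambda>k. ?d k x)"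
      by (intro summable_suminf_not_top) auto
    then have "(\<lambda>k. ?d k x) \<longlonglongrightarrow> 0" by (rule summable_LIMSEQ_zero)
    then have "eventually (\<lambda>k. ?d k x < 1) sequentially"
      by (rule order_tendstoD) simp
    then have "\<forall>\<^sub>F k in sequentially. norm (s (Suc k) x - s k x) \<le> (sqrt (1/2))^k"
    proof eventually_elim
      case (elim k)
      then have "(norm (s (Suc k) x - s k x))\<^sup>2 \<le> (1/2)^k"
        by (simp add: field_simps power_one_over)
      then have "sqrt ((norm (s (Suc k) x - s k x))\<^sup>2) \<le> sqrt ((1/2)^k)"
        by (rule real_sqrt_le_mono)
      then show ?case by (simp add: real_sqrt_power)
    qed
    moreover have "summable (\<lambda>k. (sqrt (1/2))^k)"
      by (rule summable_geometric) (simp add: real_sqrt_divide)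
    ultimately have "summable (\<lambda>k. s (Suc k) x - s k x)"
      by (rule summable_comparison_test_ev)
    then have "convergent (\<lambda>n. \<Sum>k<n. (s (Suc k) x - s k x))"
      by (simp add: summable_iff_convergent)
    then have "convergent (\<lambda>n. s n x - s 0 x)"
      by (subst (asm) sum_lessThan_telescope)
    then have "convergent (\<lambda>n. (s n x - s 0 x) + s 0 x)"
      by (intro convergent_add convergent_const)
    then show ?case by simp
  qed
qed

lemma L2_fatou:
  fixes s :: "nat \<Rightarrow> 'm \<Rightarrow> 'c::euclidean_space"
  assumes s: "\<And>k. s k \<in> Lp 2 M" and g: "g \<in> borel_measurable M"
    and conv: "AE x in M. (\<lambda>k. s k x) \<longlonglongrightarrow> g x"
    and bd: "\<forall>\<^sub>F k in sequentially. L2_norm M (s k) \<le> C" and "0 \<le> C"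
  shows "g \<in> Lp 2 M \<and> L2_norm M g \<le> C"
proof -
  have "(\<integral>\<^sup>+x. ennreal ((norm (g x))\<^sup>2) \<partial>M)
      = (\<integral>\<^sup>+x. liminf (\<lambda>k. ennreal ((norm (s k x))\<^sup>2)) \<partial>M)"
  proof (rule nn_integral_cong_AE, use conv in eventually_elim)
    case (elim x)
    then have "(\<lambda>k. ennreal ((norm (s k x))\<^sup>2)) \<longlonglongrightarrow> ennreal ((norm (g x))\<^sup>2)"
      by (intro tendsto_ennrealI tendsto_intros)
    then show ?case by (metis lim_imp_Liminf sequentially_bot)
  qed
  also have "\<dots> \<le> liminf (\<lambda>k. \<integral>\<^sup>+x. ennreal ((norm (s k x))\<^sup>2) \<partial>M)"
    by (rule nn_integral_liminf) (use s in \<open>auto simp: Lp2_iff\<close>)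
  also have "\<dots> \<le> ennreal (C\<^sup>2)"
  proof -
    have *: "(\<integral>\<^sup>+x. ennreal ((norm (s k x))\<^sup>2) \<partial>M) = ennreal ((L2_norm M (s k))\<^sup>2)" for k
      unfolding L2_norm_sq_integral by (rule nn_integral_eq_integral) (use s in \<open>auto simp: Lp2_iff\<close>)
    have "liminf (\<lambda>k. \<integral>\<^sup>+x. ennreal ((norm (s k x))\<^sup>2) \<partial>M) \<le> liminf (\<lambda>k::nat. ennreal (C\<^sup>2))"
      unfolding * by (rule Liminf_mono, use bd in eventually_elim)
        (auto intro!: ennreal_leI power_mono L2_norm_nonneg)
    then show ?thesis by (simp add: Liminf_const)
  qed
  finally have le: "(\<integral>\<^sup>+x. ennreal ((norm (g x))\<^sup>2) \<partial>M) \<le> ennreal (C\<^sup>2)" .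
  have int: "integrable M (\<lambda>x. (norm (g x))\<^sup>2)"
    by (rule integrableI_bounded) (use g le in \<open>auto intro: le_less_trans\<close>)
  then have "ennreal (LINT x|M. (norm (g x))\<^sup>2) \<le> ennreal (C\<^sup>2)"
    using le by (subst (asm) nn_integral_eq_integral) auto
  then have "(L2_norm M g)\<^sup>2 \<le> C\<^sup>2"
    by (simp add: L2_norm_sq_integral)
  then show ?thesis
    using power2_le_imp_le \<open>0 \<le> C\<close> int g by (auto simp: Lp2_iff)
qed

text \<open>
  Riesz--Fischer: a rapidly convergent subsequence has a pointwise limit, and Fatou's lemma turns the Cauchy
  property into convergence in norm to that limit.
\<close>

lemma L2_complete:
  fixes f :: "nat \<Rightarrow> 'm \<Rightarrow> 'c::euclidean_space"
  assumes f: "\<And>n. f n \<in> Lp 2 M"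
    and cauchy: "\<And>e. 0 < e \<Longrightarrow> \<exists>N. \<forall>m\<ge>N. \<forall>n\<ge>N. L2_norm M (\<lambda>x. f m x - f n x) < e"
  obtains g where "g \<in> Lp 2 M" "(\<lambda>n. L2_norm M (\<lambda>x. f n x - g x)) \<longlonglongrightarrow> 0"
proof -
  have "\<forall>k. \<exists>N. \<forall>m\<ge>N. \<forall>n\<ge>N. L2_norm M (\<lambda>x. f m x - f n x) < (1/2)^k"
    using cauchy by (auto simp del: power_one_over)
  then obtain N where N: "\<And>k m n. m \<ge> N k \<Longrightarrow> n \<ge> N k \<Longrightarrow> L2_norm M (\<lambda>x. f m x - f n x) < (1/2)^k"
    by metis
  \<comment> \<open>The sum makes \<open>r\<close> monotone and at least \<open>N\<close>; the summand \<open>k\<close> makes it unbounded.\<close>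
  define r where "r k = (\<Sum>i\<le>k. N i) + k" for k
  have r_mono: "r k \<le> r (Suc k)" for k by (simp add: r_def)
  have r_N: "N k \<le> r k" for k
    unfolding r_def using member_le_sum[of k "{..k}" N] by simp
  have r_ge: "k \<le> r k" for k by (simp add: r_def)
  define s where "s k = f (r k)" for k
  have s: "s k \<in> Lp 2 M" for k by (simp add: s_def f)
  have "L2_norm M (\<lambda>x. s (Suc k) x - s k x) \<le> (1/2)^k" for k
    unfolding s_def using N[of k "r (Suc k)" "r k"] r_N[of k] r_mono[of k] by linarith
  from L2_fast_AE_convergent[OF s this]
  have conv: "AE x in M. (\<lambda>k. s k x) \<longlonglongrightarrow> lim (\<lambda>k. s k x)"
    by (simp add: convergent_LIMSEQ_iff)
  define g where "g x = lim (\<lambda>k. s k x)" for x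
  have g: "g \<in> borel_measurable M"
    unfolding g_def using s by (intro borel_measurable_lim_metric) (auto simp: Lp2_iff)
  \<comment> \<open>Fatou along the subsequence; with \<open>e = 1\<close> it gives \<open>g \<in> L\<^sup>2\<close>, with small \<open>e\<close> the convergence.\<close>
  have key: "(\<lambda>x. f n x - g x) \<in> Lp 2 M \<and> L2_norm M (\<lambda>x. f n x - g x) \<le> e"
    if "0 < e" "\<And>m. m \<ge> K \<Longrightarrow> L2_norm M (\<lambda>x. f n x - f m x) < e" for n e K
  proof (rule L2_fatou[where s="\<lambda>k x. f n x - s k x"])
    show "AE x in M. (\<lambda>k. f n x - s k x) \<longlonglongrightarrow> f n x - g x"
      using conv by eventually_elim (auto intro!: tendsto_intros simp: g_def)
    show "\<forall>\<^sub>F k in sequentially. L2_norm M (\<lambda>x. f n x - s k x) \<le> e"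
      using eventually_ge_at_top[of K]
      by eventually_elim (metis s_def that(2) r_ge order.trans less_imp_le)
    show "(\<lambda>x. f n x - s k x) \<in> Lp 2 M" for k by (rule Lp2_diff[OF f s])
    show "(\<lambda>x. f n x - g x) \<in> borel_measurable M" using f[of n] g by (auto simp: Lp2_iff)
  qed (use that in auto)
  have "g \<in> Lp 2 M"
  proof -
    obtain K where K: "\<And>m n. m \<ge> K \<Longrightarrow> n \<ge> K \<Longrightarrow> L2_norm M (\<lambda>x. f m x - f n x) < 1"
      using cauchy[of 1] by auto
    have "(\<lambda>x. f K x - g x) \<in> Lp 2 M" using key[of 1 K K] K by auto
    from Lp2_diff[OF f this, of K] show ?thesis by simp
  qed
  moreover have "(\<lambda>n. L2_norm M (\<lambda>x. f n x - g x)) \<longlonglongrightarrow> 0"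
  proof (rule LIMSEQ_I)
    fix e :: real assume "0 < e"
    then obtain K where K: "\<And>m n. m \<ge> K \<Longrightarrow> n \<ge> K \<Longrightarrow> L2_norm M (\<lambda>x. f m x - f n x) < e/2"
      using cauchy[of "e/2"] by auto
    have "L2_norm M (\<lambda>x. f n x - g x) \<le> e/2" if "n \<ge> K" for n
      using key[of "e/2" K n] K that \<open>0 < e\<close> by auto
    then have "\<forall>n\<ge>K. L2_norm M (\<lambda>x. f n x - g x) < e"
      using \<open>0 < e\<close> by (auto intro: le_less_trans[where y="e/2"])
    then show "\<exists>K. \<forall>n\<ge>K. norm (L2_norm M (\<lambda>x. f n x - g x) - 0) < e"
      by (auto simp: L2_norm_nonneg)
  qed
  ultimately show thesis by (rule that)
qed

lemma L2_norm_orthogonal_sum: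
  assumes e: "\<And>i. i \<in> I \<Longrightarrow> e i \<in> Lp 2 M" and "finite I"
    and orth: "\<And>i j. i \<in> I \<Longrightarrow> j \<in> I \<Longrightarrow> i \<noteq> j \<Longrightarrow> L2_ip M (e i) (e j) = 0"
  shows "(L2_norm M (\<lambda>x. \<Sum>i\<in>I. e i x))\<^sup>2 = (\<Sum>i\<in>I. (L2_norm M (e i))\<^sup>2)"
proof -
  note s = Lp2_sum[of I e, OF e]
  have "(L2_norm M (\<lambda>x. \<Sum>i\<in>I. e i x))\<^sup>2 = (\<Sum>i\<in>I. L2_ip M (e i) (\<lambda>x. \<Sum>i\<in>I. e i x))"
    unfolding L2_norm_sq by (rule L2_ip_sum_left[OF e s])
  also have "\<dots> = (\<Sum>i\<in>I. \<Sum>j\<in>I. L2_ip M (e j) (e i))"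
    by (intro sum.cong refl, subst L2_ip_commute, rule L2_ip_sum_left) (use e in auto)
  also have "\<dots> = (\<Sum>i\<in>I. \<Sum>j\<in>I. if i = j then L2_ip M (e i) (e i) else 0)"
    using orth by (intro sum.cong refl) auto
  also have "\<dots> = (\<Sum>i\<in>I. L2_ip M (e i) (e i))"
    by (intro sum.cong refl) (use \<open>finite I\<close> in auto)
  finally show ?thesis by (simp add: L2_norm_sq)
qed

text \<open>
  By Pythagoras, the norm of a block of the series is a block of the series of squared norms.
\<close>

lemma L2_orthogonal_series_converges:
  fixes e :: "nat \<Rightarrow> 'm \<Rightarrow> 'c::euclidean_space"
  assumes e: "\<And>i. e i \<in> Lp 2 M"
    and orth: "\<And>i j. i \<noteq> j \<Longrightarrow> L2_ip M (e i) (e j) = 0"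
    and summ: "summable (\<lambda>i. (L2_norm M (e i))\<^sup>2)"
  obtains g where "g \<in> Lp 2 M" "(\<lambda>n. L2_norm M (\<lambda>x. (\<Sum>i<n. e i x) - g x)) \<longlonglongrightarrow> 0"
proof (rule L2_complete[of "\<lambda>n x. \<Sum>i<n. e i x" M])
  show "(\<lambda>x. \<Sum>i<n. e i x) \<in> Lp 2 M" for n by (rule Lp2_sum[OF e])
  fix \<epsilon> :: real assume "0 < \<epsilon>"
  then have "0 < \<epsilon>\<^sup>2" by simp
  with summ[unfolded summable_Cauchy]
  obtain N where N: "\<And>m n. m \<ge> N \<Longrightarrow> norm (\<Sum>i=m..<n. (L2_norm M (e i))\<^sup>2) < \<epsilon>\<^sup>2" by blast
  have *: "L2_norm M (\<lambda>x. (\<Sum>i<n. e i x) - (\<Sum>i<m. e i x)) < \<epsilon>" if "N \<le> m" "m \<le> n" for m n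
  proof (rule power2_less_imp_less)
    have "(\<Sum>i<n. e i x) - (\<Sum>i<m. e i x) = (\<Sum>i=m..<n. e i x)" for x
      using \<open>m \<le> n\<close> by (simp add: sum_diff_nat_ivl[of 0 m n, symmetric] atLeast0LessThan)
    then have "(L2_norm M (\<lambda>x. (\<Sum>i<n. e i x) - (\<Sum>i<m. e i x)))\<^sup>2 = (\<Sum>i=m..<n. (L2_norm M (e i))\<^sup>2)"
      by (simp add: L2_norm_orthogonal_sum[OF e _ orth])
    also have "\<dots> < \<epsilon>\<^sup>2" using N[of m n] that by auto
    finally show "(L2_norm M (\<lambda>x. (\<Sum>i<n. e i x) - (\<Sum>i<m. e i x)))\<^sup>2 < \<epsilon>\<^sup>2" .
  qed (use \<open>0 < \<epsilon>\<close> in simp)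
  show "\<exists>N. \<forall>m\<ge>N. \<forall>n\<ge>N. L2_norm M (\<lambda>x. (\<Sum>i<m. e i x) - (\<Sum>i<n. e i x)) < \<epsilon>"
  proof (intro exI[of _ N] allI impI)
    fix m n assume "N \<le> m" "N \<le> n"
    then show "L2_norm M (\<lambda>x. (\<Sum>i<m. e i x) - (\<Sum>i<n. e i x)) < \<epsilon>"
      using *[of m n] *[of n m] L2_norm_minus_commute[of M "\<lambda>x. \<Sum>i<m. e i x" "\<lambda>x. \<Sum>i<n. e i x"]
      by (cases "m \<le> n") auto
  qed
qed (rule that)

text \<open>
  Bessel's inequality for unnormalised projections: the condition on \<open>F\<close> says that \<open>e i\<close> is the projection of \<open>F\<close> onto
  the line spanned by \<open>e i\<close>. Some of the projections may be \<open>0\<close>.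
\<close>

lemma L2_bessel:
  fixes e :: "nat \<Rightarrow> 'm \<Rightarrow> 'c::euclidean_space"
  assumes e: "\<And>i. e i \<in> Lp 2 M" and F: "F \<in> Lp 2 M"
    and orth: "\<And>i j. i \<noteq> j \<Longrightarrow> L2_ip M (e i) (e j) = 0"
    and proj: "\<And>i. L2_ip M F (e i) = L2_ip M (e i) (e i)"
  shows "summable (\<lambda>i. (L2_norm M (e i))\<^sup>2)"
proof (rule bounded_imp_summable)
  fix n
  let ?S = "\<lambda>x. \<Sum>i<Suc n. e i x" and ?q = "\<Sum>i<Suc n. (L2_norm M (e i))\<^sup>2"
  have S: "?S \<in> Lp 2 M" by (rule Lp2_sum[OF e])
  have q: "(L2_norm M ?S)\<^sup>2 = ?q"
    by (rule L2_norm_orthogonal_sum[OF e finite_lessThan orth])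
  have "L2_ip M ?S F = (\<Sum>i<Suc n. L2_ip M (e i) F)"
    by (rule L2_ip_sum_left[OF e F])
  also have "\<dots> = ?q"
    by (intro sum.cong refl) (metis L2_ip_commute L2_norm_sq proj)
  finally have r: "L2_ip M ?S F = ?q" .
  have "?q \<le> L2_norm M ?S * L2_norm M F"
    using order_trans[OF abs_ge_self L2_cauchy_schwarz[OF S F]] unfolding r .
  then have *: "(L2_norm M ?S)\<^sup>2 \<le> L2_norm M ?S * L2_norm M F" unfolding q .
  have "L2_norm M ?S \<le> L2_norm M F"
  proof (cases "L2_norm M ?S = 0")
    case False
    then have "0 < L2_norm M ?S" using L2_norm_nonneg[of M ?S] by linarith
    then show ?thesis using * by (simp only: power2_eq_square mult_le_cancel_left_pos)
  qed (metis L2_norm_nonneg)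
  then have "(L2_norm M ?S)\<^sup>2 \<le> (L2_norm M F)\<^sup>2" by (intro power_mono L2_norm_nonneg)
  then show "(\<Sum>i\<le>n. (L2_norm M (e i))\<^sup>2) \<le> (L2_norm M F)\<^sup>2"
    unfolding q by (simp only: lessThan_Suc_atMost)
qed simp

section \<open>Smooth functions and bump functions\<close>

lemma has_derivative_frechet: "f differentiable (at x) \<Longrightarrow> (f has_derivative frechet_derivative f (at x)) (at x)"
  by (simp add: frechet_derivative_works)

lemma Ck_SucI:
  assumes "\<And>x. (f has_derivative f' x) (at x)" "\<And>i. i \<in> Basis \<Longrightarrow> Ck k (\<lambda>x. f' x i)"
  shows "Ck (Suc k) f"
proof -
  have "frechet_derivative f (at x) = f' x" for x
    using frechet_derivative_at[OF assms(1)] by simp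
  then show ?thesis using assms by (auto simp: differentiable_def)
qed

lemma Ck_Suc_has_derivative:
  "Ck (Suc k) f \<Longrightarrow> (f has_derivative frechet_derivative f (at x)) (at x)"
  by (simp add: has_derivative_frechet)

lemma Ck_SucD: "Ck (Suc k) f \<Longrightarrow> Ck k f"
proof (induction k arbitrary: f)
  case 0
  then show ?case by (auto simp: continuous_on_eq_continuous_within intro: differentiable_imp_continuous_within)
next
  case (Suc k)
  from Suc.prems have "Ck (Suc k) (\<lambda>x. frechet_derivative f (at x) i)" if "i \<in> Basis" for i
    using that by simp
  then have "Ck k (\<lambda>x. frechet_derivative f (at x) i)" if "i \<in> Basis" for i
    using Suc.IH that by blast
  with Suc.prems show ?case by simp
qed

lemma Ck_const: "Ck k (\<lambda>x. c)"
  by (induction k arbitrary: c) (auto intro!: Ck_SucI[where f'="\<lambda>_ _. 0"])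

lemma Ck_add: "Ck k f \<Longrightarrow> Ck k g \<Longrightarrow> Ck k (\<lambda>x. f x + g x)"
proof (induction k arbitrary: f g)
  case (Suc k)
  note f = Suc.prems(1) and g = Suc.prems(2)
  show ?case
  proof (rule Ck_SucI)
    show "((\<lambda>x. f x + g x) has_derivative
        (\<lambda>h. frechet_derivative f (at x) h + frechet_derivative g (at x) h)) (at x)" for x
      by (intro has_derivative_add Ck_Suc_has_derivative[OF f] Ck_Suc_has_derivative[OF g])
    fix i :: 'a assume "i \<in> Basis"
    with f g have "Ck k (\<lambda>x. frechet_derivative f (at x) i)" "Ck k (\<lambda>x. frechet_derivative g (at x) i)"
      by auto
    then show "Ck k (\<lambda>x. frechet_derivative f (at x) i + frechet_derivative g (at x) i)"
      by (rule Suc.IH)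
  qed
qed (auto intro: continuous_intros)

lemma Ck_mult: "Ck k f \<Longrightarrow> Ck k g \<Longrightarrow> Ck k (\<lambda>x. f x * g x)"
proof (induction k arbitrary: f g)
  case (Suc k)
  note f = Suc.prems(1) and g = Suc.prems(2)
  show ?case
  proof (rule Ck_SucI)
    show "((\<lambda>x. f x * g x) has_derivative
        (\<lambda>h. f x * frechet_derivative g (at x) h + frechet_derivative f (at x) h * g x)) (at x)" for x
      by (intro has_derivative_mult Ck_Suc_has_derivative[OF f] Ck_Suc_has_derivative[OF g])
    fix i :: 'a assume "i \<in> Basis"
    with f g have "Ck k (\<lambda>x. frechet_derivative f (at x) i)" "Ck k (\<lambda>x. frechet_derivative g (at x) i)"
      by auto
    then show "Ck k (\<lambda>x. f x * frechet_derivative g (at x) i + frechet_derivative f (at x) i * g x)"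
      by (intro Ck_add Suc.IH Ck_SucD[OF f] Ck_SucD[OF g])
  qed
qed (auto intro: continuous_intros)

lemma Ck_prod: "(\<And>i. i \<in> I \<Longrightarrow> Ck k (f i)) \<Longrightarrow> Ck k (\<lambda>x. \<Prod>i\<in>I. f i x)"
  by (induction I rule: infinite_finite_induct) (auto intro: Ck_mult simp: Ck_const)

lemma frechet_derivative_affine:
  assumes L: "bounded_linear L" and f: "f differentiable (at (c + L x))"
  shows "((\<lambda>x. f (c + L x)) has_derivative (\<lambda>h. frechet_derivative f (at (c + L x)) (L h))) (at x)"
    "frechet_derivative (\<lambda>x. f (c + L x)) (at x) h = frechet_derivative f (at (c + L x)) (L h)"
proof -
  show *: "((\<lambda>x. f (c + L x)) has_derivative (\<lambda>h. frechet_derivative f (at (c + L x)) (L h))) (at x)"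
    by (rule has_derivative_compose[where f="\<lambda>x. c + L x" and g=f])
      (auto intro!: derivative_eq_intros bounded_linear.has_derivative[OF L] has_derivative_frechet[OF f])
  show "frechet_derivative (\<lambda>x. f (c + L x)) (at x) h = frechet_derivative f (at (c + L x)) (L h)"
    using frechet_derivative_at[OF *] by metis
qed

text \<open>
  If \<open>L\<close> maps coordinate directions to coordinate directions or to \<open>0\<close>, the partial derivatives of \<open>f (c + L x)\<close> are
  again of the same form, so that the induction on the order closes. Slices, projections and the exchange of the two
  factors of a product are all of this kind.
\<close>

lemma Ck_affine:
  fixes L :: "'a::euclidean_space \<Rightarrow> 'b::euclidean_space"
  assumes L: "bounded_linear L" and B: "\<And>i. i \<in> Basis \<Longrightarrow> L i \<in> insert 0 Basis"
  shows "Ck k f \<Longrightarrow> Ck k (\<lambda>x. f (c + L x))"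
proof (induction k arbitrary: f)
  case 0
  have "continuous_on UNIV (\<lambda>x. c + L x)"
    by (intro continuous_intros bounded_linear.continuous_on[OF L])
  with 0 show ?case by (auto intro: continuous_on_compose2[of UNIV f])
next
  case (Suc k)
  then have d: "f differentiable (at x)" for x by simp
  show ?case
  proof (rule Ck_SucI[OF frechet_derivative_affine(1)[OF L d]])
    fix i :: 'a assume "i \<in> Basis"
    then consider "L i = 0" | "L i \<in> Basis" using B by auto
    then show "Ck k (\<lambda>x. frechet_derivative f (at (c + L x)) (L i))"
    proof cases
      case 1
      then show ?thesis
        using linear_0[OF has_derivative_linear[OF has_derivative_frechet[OF d]]] by (simp add: Ck_const)
    next
      case 2
      with Suc.prems have "Ck k (\<lambda>x. frechet_derivative f (at x) (L i))" by simp
      from Suc.IH[OF this] show ?thesis .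
    qed
  qed
qed

text \<open>
  The functions \<open>t\<^sup>-\<^sup>k exp (-1/t)\<close>, extended by \<open>0\<close>. The derivative of a member of the family is a linear combination of two
  others; this makes smoothness a simple induction.
\<close>

definition flat_exp :: "nat \<Rightarrow> real \<Rightarrow> real" where
  "flat_exp k t = (if t > 0 then exp (- 1 / t) / t ^ k else 0)"

lemma flat_exp_tendsto_0: "(flat_exp k \<longlongrightarrow> 0) (at 0)"
proof -
  have "((\<lambda>t. (inverse t) ^ k / exp (inverse t)) \<longlongrightarrow> (0::real)) (at_right 0)"
    by (rule filterlim_compose[OF tendsto_power_div_exp_0 filterlim_inverse_at_top_right])
  then have "(flat_exp k \<longlongrightarrow> 0) (at_right 0)"
    by (rule Lim_transform_eventually)
      (auto simp: eventually_at_right_less flat_exp_def exp_minus field_simps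
        intro!: eventually_mono[OF eventually_at_right_less])
  moreover have "(flat_exp k \<longlongrightarrow> 0) (at_left 0)"
    by (rule Lim_transform_eventually[OF tendsto_const])
      (auto simp: flat_exp_def eventually_at_filter)
  ultimately show ?thesis by (simp add: filterlim_at_split)
qed

lemma flat_exp_derivative:
  "(flat_exp k has_real_derivative flat_exp (k + 2) t - real k * flat_exp (k + 1) t) (at t)"
proof -
  consider "t > 0" | "t < 0" | "t = 0" by linarith
  then show ?thesis
  proof cases
    case 1
    have "((\<lambda>t. exp (- 1 / t) / t ^ k) has_real_derivative
        flat_exp (k + 2) t - real k * flat_exp (k + 1) t) (at t)"
      using 1
      by (cases k) (auto intro!: derivative_eq_intros simp: flat_exp_def field_simps power2_eq_square,
          metis One_nat_def power_eq_if)
    then show ?thesis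
      by (rule DERIV_cong_ev[THEN iffD1, rotated -1])
        (use 1 in \<open>auto simp: flat_exp_def eventually_nhds intro!: exI[of _ "{0<..}"]\<close>)
  next
    case 2
    have "((\<lambda>t. 0) has_real_derivative flat_exp (k + 2) t - real k * flat_exp (k + 1) t) (at t)"
      using 2 by (auto simp: flat_exp_def)
    then show ?thesis
      by (rule DERIV_cong_ev[THEN iffD1, rotated -1])
        (use 2 in \<open>auto simp: flat_exp_def eventually_nhds intro!: exI[of _ "{..<0}"]\<close>)
  next
    case 3
    have "(\<lambda>h. (flat_exp k (0 + h) - flat_exp k 0) / h) = flat_exp (Suc k)"
      by (auto simp: flat_exp_def field_simps)
    then have "(flat_exp k has_real_derivative 0) (at 0)"
      using flat_exp_tendsto_0[of "Suc k"] by (simp add: DERIV_def)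
    then show ?thesis using 3 by (simp add: flat_exp_def)
  qed
qed

lemma Ck_flat_exp_affine:
  "Ck n (\<lambda>x. flat_exp k (p + q * (x \<bullet> v)))"
proof (induction n arbitrary: k)
  case 0
  have "continuous_on UNIV (flat_exp k)"
    by (rule DERIV_continuous_on) (rule flat_exp_derivative[THEN DERIV_subset], simp)
  then show ?case
    by (auto intro!: continuous_intros continuous_on_compose2[of UNIV "flat_exp k"])
next
  case (Suc n)
  let ?u = "\<lambda>x. p + q * (x \<bullet> v)"
  let ?d = "\<lambda>x. flat_exp (k + 2) (?u x) - real k * flat_exp (k + 1) (?u x)"
  show ?case
  proof (rule Ck_SucI[where f'="\<lambda>x h. (q * (h \<bullet> v)) * ?d x"])
    fix x
    show "((\<lambda>x. flat_exp k (?u x)) has_derivative (\<lambda>h. (q * (h \<bullet> v)) * ?d x)) (at x)"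
      by (rule DERIV_compose_FDERIV[OF flat_exp_derivative])
        (auto intro!: derivative_eq_intros)
  next
    fix i :: 'a
    have "Ck n (\<lambda>x. (q * (i \<bullet> v)) * (flat_exp (k + 2) (?u x) + (- real k) * flat_exp (k + 1) (?u x)))"
      by (intro Ck_mult Ck_add Ck_const Suc.IH)
    then show "Ck n (\<lambda>x. q * (i \<bullet> v) * ?d x)" by simp
  qed
qed

text \<open>
  A product of factors \<open>exp (-1/(n t))\<close>, \<open>t\<close> running over the signed distances to the faces of the box. These functions
  increase to the indicator of the box as \<open>n\<close> grows, which is the form of approximation that dominated convergence needs.
\<close>

definition box_bump :: "'a::euclidean_space \<Rightarrow> 'a \<Rightarrow> nat \<Rightarrow> 'a \<Rightarrow> real" where
  "box_bump a b n x = (\<Prod>i\<in>Basis. flat_exp 0 (Suc n * (x \<bullet> i - a \<bullet> i)) * flat_exp 0 (Suc n * (b \<bullet> i - x \<bullet> i)))"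

lemma flat_exp_0_bounds: "0 \<le> flat_exp 0 t" "flat_exp 0 t \<le> 1"
  by (auto simp: flat_exp_def)

lemma box_bump_bounds: "0 \<le> box_bump a b n x" "box_bump a b n x \<le> 1"
  unfolding box_bump_def
  by (auto intro!: prod_nonneg prod_le_1 mult_nonneg_nonneg mult_le_one simp: flat_exp_0_bounds)

lemma box_bump_outside: "x \<notin> box a b \<Longrightarrow> box_bump a b n x = 0"
  by (force simp: box_bump_def mem_box flat_exp_def not_less zero_less_mult_iff)

lemma box_bump_tendsto: "(\<lambda>n. box_bump a b n x) \<longlonglongrightarrow> indicator (box a b) x"
proof (cases "x \<in> box a b")
  case True
  have *: "(\<lambda>n. flat_exp 0 (Suc n * s)) \<longlonglongrightarrow> 1" if "0 < s" for s :: real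
  proof -
    have "(\<lambda>n. exp (- ((1 / s) * inverse (real (Suc n))))) \<longlonglongrightarrow> exp (- ((1 / s) * 0))"
      by (intro tendsto_intros LIMSEQ_inverse_real_of_nat)
    moreover have "exp (- ((1 / s) * inverse (real (Suc n)))) = flat_exp 0 (Suc n * s)" for n
      using that by (simp add: flat_exp_def field_simps add_pos_nonneg)
    ultimately show ?thesis by simp
  qed
  have "(\<lambda>n. box_bump a b n x) \<longlonglongrightarrow> (\<Prod>i\<in>(Basis::'a set). 1 * 1)"
    unfolding box_bump_def using True by (intro tendsto_prod tendsto_mult *) (auto simp: mem_box)
  then show ?thesis using True by simp
qed (simp add: box_bump_outside)

lemma box_bump_test:
  assumes "cbox a b \<subseteq> \<Omega>"
  shows "box_bump a b n \<in> test_functions \<Omega>"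
proof -
  have "Ck k (box_bump a b n)" for k
  proof -
    have "Ck k (\<lambda>x. \<Prod>i\<in>Basis. flat_exp 0 (- real (Suc n) * (a \<bullet> i) + real (Suc n) * (x \<bullet> i))
        * flat_exp 0 (real (Suc n) * (b \<bullet> i) + (- real (Suc n)) * (x \<bullet> i)))"
      by (intro Ck_prod Ck_mult Ck_flat_exp_affine)
    then show ?thesis by (simp add: box_bump_def[abs_def] algebra_simps)
  qed
  moreover have "\<forall>x. x \<notin> cbox a b \<longrightarrow> box_bump a b n x = 0"
    using box_subset_cbox box_bump_outside by blast
  ultimately show ?thesis
    using assms compact_cbox[of a b] unfolding test_functions_def by (intro CollectI conjI exI[of _ "cbox a b"]) auto
qed

section \<open>Test functions\<close>

lemma test_functions_Ck: "\<phi> \<in> test_functions \<Omega> \<Longrightarrow> Ck k \<phi>"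
  by (simp add: test_functions_def)

lemma test_functions_differentiable: "\<phi> \<in> test_functions \<Omega> \<Longrightarrow> \<phi> differentiable (at x)"
  using test_functions_Ck[of \<phi> \<Omega> "Suc 0"] by simp

lemma test_functions_has_derivative:
  "\<phi> \<in> test_functions \<Omega> \<Longrightarrow> (\<phi> has_derivative frechet_derivative \<phi> (at x)) (at x)"
  by (rule Ck_Suc_has_derivative[OF test_functions_Ck[where k="Suc 0"]])

lemma test_functions_continuous: "\<phi> \<in> test_functions \<Omega> \<Longrightarrow> continuous_on UNIV \<phi>"
  using test_functions_Ck[of \<phi> \<Omega> 0] by simp

lemma test_functions_measurable [measurable_dest]: "\<phi> \<in> test_functions \<Omega> \<Longrightarrow> \<phi> \<in> borel_measurable borel"
  by (intro borel_measurable_continuous_onI test_functions_continuous)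

text \<open>
  Outside the compact set that carries \<open>\<phi>\<close>, an open set, \<open>\<phi>\<close> vanishes identically, hence so do its derivatives.
\<close>

lemma test_functions_partial:
  assumes "\<phi> \<in> test_functions \<Omega>" "i \<in> Basis"
  shows "(\<lambda>x. frechet_derivative \<phi> (at x) i) \<in> test_functions \<Omega>"
proof -
  obtain K where K: "compact K" "K \<subseteq> \<Omega>" "\<And>x. x \<notin> K \<Longrightarrow> \<phi> x = 0"
    using assms by (auto simp: test_functions_def)
  have "frechet_derivative \<phi> (at x) i = 0" if "x \<notin> K" for x
  proof -
    have "((\<lambda>_. 0) has_derivative (\<lambda>_. 0)) (at x)" by simp
    then have "(\<phi> has_derivative (\<lambda>_. 0)) (at x)"
      by (rule has_derivative_transform_within_open[where s="- K"])
        (use K that in \<open>auto simp: compact_imp_closed\<close>)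
    then show ?thesis using frechet_derivative_at by metis
  qed
  moreover have "Ck k (\<lambda>x. frechet_derivative \<phi> (at x) i)" for k
    using test_functions_Ck[OF assms(1), of "Suc k"] assms(2) by simp
  ultimately show ?thesis using K by (auto simp: test_functions_def)
qed

lemma test_functions_bounded:
  assumes "\<phi> \<in> test_functions \<Omega>"
  obtains B where "\<And>x. \<bar>\<phi> x\<bar> \<le> B" "0 \<le> B"
proof -
  obtain K where K: "compact K" "\<And>x. x \<notin> K \<Longrightarrow> \<phi> x = 0"
    using assms by (auto simp: test_functions_def)
  have "compact (\<phi> ` K)"
    using K continuous_on_subset[OF test_functions_continuous[OF assms]] by (intro compact_continuous_image) auto
  then obtain B where B: "\<And>x. x \<in> K \<Longrightarrow> \<bar>\<phi> x\<bar> \<le> B"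
    using compact_imp_bounded bounded_iff by (metis imageI real_norm_def)
  have "\<bar>\<phi> x\<bar> \<le> max B 0" for x
    using B[of x] K(2)[of x] by (cases "x \<in> K") auto
  then show thesis using that by (metis max.cobounded2)
qed

lemma test_functions_mult:
  assumes "\<phi> \<in> test_functions \<Omega>" "\<psi> \<in> test_functions \<Omega>"
  shows "(\<lambda>x. \<phi> x * \<psi> x) \<in> test_functions \<Omega>"
proof -
  obtain K where "compact K" "K \<subseteq> \<Omega>" "\<forall>x. x \<notin> K \<longrightarrow> \<phi> x = 0"
    using assms(1) by (auto simp: test_functions_def)
  then show ?thesis
    using Ck_mult[OF test_functions_Ck[OF assms(1)] test_functions_Ck[OF assms(2)]]
    unfolding test_functions_def by (intro CollectI conjI exI[of _ K]) auto
qed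

text \<open>
  Lebesgue measure is translation invariant, so every difference quotient of \<open>\<phi>\<close> has integral \<open>0\<close>. The quotients are bounded
  and vanish outside a common compact set, and dominated convergence applies.
\<close>

lemma integral_partial_test_function:
  fixes \<phi> :: "'a::euclidean_space \<Rightarrow> real"
  assumes \<phi>: "\<phi> \<in> test_functions \<Omega>" and i: "i \<in> Basis"
  shows "(LINT x|lborel. frechet_derivative \<phi> (at x) i) = 0"
proof -
  let ?d = "\<lambda>x. frechet_derivative \<phi> (at x) i"
  obtain K where K: "compact K" "\<And>x. x \<notin> K \<Longrightarrow> \<phi> x = 0"
    using \<phi> by (auto simp: test_functions_def)
  obtain B where B: "\<And>x. \<bar>?d x\<bar> \<le> B" "0 \<le> B"
    using test_functions_bounded[OF test_functions_partial[OF \<phi> i]] by blast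
  let ?t = "\<lambda>n. 1 / real (Suc n)"
  let ?q = "\<lambda>n x. (\<phi> (x + ?t n *\<^sub>R i) - \<phi> x) / ?t n"
  have int\<phi>: "integrable lborel \<phi>"
  proof -
    have "integrable lborel (\<lambda>x. indicator K x *\<^sub>R \<phi> x)"
      using K continuous_on_subset[OF test_functions_continuous[OF \<phi>]] by (intro borel_integrable_compact) auto
    moreover have "(\<lambda>x. indicator K x *\<^sub>R \<phi> x) = \<phi>"
      by (rule ext) (use K in \<open>auto simp: indicator_def\<close>)
    ultimately show ?thesis by metis
  qed
  have shift: "integrable lborel (\<lambda>x. \<phi> (x + c))" "(LINT x|lborel. \<phi> (x + c)) = (LINT x|lborel. \<phi> x)" for c
  proof -
    have D: "distr lborel borel ((+) c) = (lborel :: 'a measure)" by (rule lborel_distr_plus)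
    have "integrable (distr lborel borel ((+) c)) \<phi>" unfolding D by (rule int\<phi>)
    then show "integrable lborel (\<lambda>x. \<phi> (x + c))"
      by (subst (asm) integrable_distr_eq) (use \<phi> in \<open>auto simp: add.commute\<close>)
    have "(LINT x|distr lborel borel ((+) c). \<phi> x) = (LINT x|lborel. \<phi> (c + x))"
      by (rule integral_distr) (use \<phi> in auto)
    then show "(LINT x|lborel. \<phi> (x + c)) = (LINT x|lborel. \<phi> x)"
      unfolding D by (simp add: add.commute)
  qed
  have zero: "(LINT x|lborel. ?q n x) = 0" for n
    using shift[of "?t n *\<^sub>R i"] int\<phi> by simp
  \<comment> \<open>The steps have length at most \<open>1\<close>, so the quotients live in the unit neighbourhood of \<open>K\<close>.\<close>
  let ?K = "{x + y | x y. x \<in> K \<and> y \<in> cball 0 1}"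
  have "compact ?K" using K(1) by (intro compact_sums) auto
  have "(\<lambda>n. LINT x|lborel. ?q n x) \<longlonglongrightarrow> (LINT x|lborel. ?d x)"
  proof (rule integral_dominated_convergence)
    show "?d \<in> borel_measurable lborel"
      using test_functions_measurable[OF test_functions_partial[OF \<phi> i]] by simp
    show "?q n \<in> borel_measurable lborel" for n using shift(1) int\<phi> by auto
    show "integrable lborel (\<lambda>x. indicator ?K x *\<^sub>R B)"
      by (rule borel_integrable_compact[OF \<open>compact ?K\<close>]) simp
    show "AE x in lborel. (\<lambda>n. ?q n x) \<longlonglongrightarrow> ?d x"
    proof (rule AE_I2)
      fix x
      have "((\<lambda>t. \<phi> (x + t *\<^sub>R i)) has_derivative (\<lambda>t. frechet_derivative \<phi> (at (x + 0 *\<^sub>R i)) (t *\<^sub>R i))) (at 0)"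
        by (rule has_derivative_compose[OF _ test_functions_has_derivative[OF \<phi>]])
          (auto intro!: derivative_eq_intros)
      moreover have "frechet_derivative \<phi> (at x) (t *\<^sub>R i) = ?d x * t" for t
        using linear_scale[OF has_derivative_linear[OF test_functions_has_derivative[OF \<phi>]]] by simp
      ultimately have "((\<lambda>t. \<phi> (x + t *\<^sub>R i)) has_real_derivative ?d x) (at 0)"
        by (simp add: has_field_derivative_def)
      then have "((\<lambda>h. (\<phi> (x + h *\<^sub>R i) - \<phi> x) / h) \<longlongrightarrow> ?d x) (at 0)"
        by (simp add: DERIV_def)
      moreover have "filterlim ?t (at 0) sequentially"
        using LIMSEQ_inverse_real_of_nat by (auto simp: filterlim_at inverse_eq_divide)
      ultimately show "(\<lambda>n. ?q n x) \<longlonglongrightarrow> ?d x"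
        by (rule filterlim_compose)
    qed
    show "AE x in lborel. norm (?q n x) \<le> indicator ?K x *\<^sub>R B" for n
    proof (rule AE_I2)
      fix x
      have t: "0 < ?t n" "?t n \<le> 1" by auto
      show "norm (?q n x) \<le> indicator ?K x *\<^sub>R B"
      proof (cases "x \<in> ?K")
        case True
        \<comment> \<open>Mean value theorem along the segment in direction \<open>i\<close>.\<close>
        have "\<bar>\<phi> (x + ?t n *\<^sub>R i) - \<phi> x\<bar> \<le> B * ?t n"
        proof -
          let ?f = "\<lambda>t. \<phi> (x + t *\<^sub>R i)"
          have "\<exists>s\<in>{0<..<?t n}. ?f (?t n) - ?f 0 = frechet_derivative \<phi> (at (x + s *\<^sub>R i)) ((?t n - 0) *\<^sub>R i)"
          proof (rule mvt_simple)
            fix s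
            show "(?f has_derivative (\<lambda>t. frechet_derivative \<phi> (at (x + s *\<^sub>R i)) (t *\<^sub>R i))) (at s within {0..?t n})"
              by (rule has_derivative_compose[OF _ test_functions_has_derivative[OF \<phi>]])
                (auto intro!: derivative_eq_intros)
          qed (use t in auto)
          then obtain s where "\<phi> (x + ?t n *\<^sub>R i) - \<phi> x = frechet_derivative \<phi> (at (x + s *\<^sub>R i)) (?t n *\<^sub>R i)"
            by auto
          also have "\<dots> = ?t n * ?d (x + s *\<^sub>R i)"
            using linear_scale[OF has_derivative_linear[OF test_functions_has_derivative[OF \<phi>]]] by simp
          finally show ?thesis using B(1)[of "x + s *\<^sub>R i"] t by (simp add: abs_mult mult.commute divide_right_mono)
        qed
        then have "\<bar>\<phi> (x + ?t n *\<^sub>R i) - \<phi> x\<bar> / ?t n \<le> B"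
          using t by (simp add: pos_divide_le_eq del: divide_divide_eq_right)
        then show ?thesis using True t by (simp add: abs_mult)
      next
        case False
        have "x \<notin> K"
        proof
          assume "x \<in> K"
          then have "x \<in> ?K" by (intro CollectI exI[of _ x] exI[of _ 0]) auto
          with False show False by blast
        qed
        moreover have "x + ?t n *\<^sub>R i \<notin> K"
        proof
          assume *: "x + ?t n *\<^sub>R i \<in> K"
          have "- (?t n *\<^sub>R i) \<in> cball 0 1" using t i by simp
          with * have "\<exists>a b. x = a + b \<and> a \<in> K \<and> b \<in> cball 0 1"
            by (intro exI[of _ "x + ?t n *\<^sub>R i"] exI[of _ "- (?t n *\<^sub>R i)"]) auto
          with False show False by blast
        qed
        ultimately show ?thesis using K(2) B(2) by simp
      qed
    qed
  qed
  then show ?thesis unfolding zero using LIMSEQ_unique tendsto_const by blast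
qed

text \<open>
  The map \<open>R\<close> is a left inverse of \<open>x \<mapsto> c + L x\<close>; it carries the compact support of \<open>\<Phi>\<close> to a compact set that
  supports the composition.
\<close>

lemma test_functions_affine:
  fixes L :: "'a::euclidean_space \<Rightarrow> 'b::euclidean_space"
  assumes \<Phi>: "\<Phi> \<in> test_functions X" and L: "bounded_linear L"
    and B: "\<And>i. i \<in> Basis \<Longrightarrow> L i \<in> insert 0 Basis"
    and R: "continuous_on UNIV R" "\<And>x. R (c + L x) = x" "R ` X \<subseteq> Y"
  shows "(\<lambda>x. \<Phi> (c + L x)) \<in> test_functions Y"
    and "frechet_derivative (\<lambda>x. \<Phi> (c + L x)) (at x) h = frechet_derivative \<Phi> (at (c + L x)) (L h)"
proof -
  obtain K where K: "compact K" "K \<subseteq> X" "\<And>z. z \<notin> K \<Longrightarrow> \<Phi> z = 0"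
    using \<Phi> by (auto simp: test_functions_def)
  have "compact (R ` K)"
    by (intro compact_continuous_image continuous_on_subset[OF R(1)] K(1)) simp
  moreover have "R ` K \<subseteq> Y" using K(2) R(3) by auto
  moreover have "\<forall>x. x \<notin> R ` K \<longrightarrow> \<Phi> (c + L x) = 0" by (metis K(3) R(2) imageI)
  moreover have "Ck k (\<lambda>x. \<Phi> (c + L x))" for k
    by (rule Ck_affine[OF L B test_functions_Ck[OF \<Phi>]])
  ultimately show "(\<lambda>x. \<Phi> (c + L x)) \<in> test_functions Y" unfolding test_functions_def by blast
  show "frechet_derivative (\<lambda>x. \<Phi> (c + L x)) (at x) h = frechet_derivative \<Phi> (at (c + L x)) (L h)"
    by (rule frechet_derivative_affine(2)[OF L test_functions_differentiable[OF \<Phi>]])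
qed

lemma test_functions_slice_fst:
  fixes \<Phi> :: "'a::euclidean_space \<times> 'b::euclidean_space \<Rightarrow> real"
  assumes \<Phi>: "\<Phi> \<in> test_functions (A \<times> B)"
  shows "(\<lambda>x. \<Phi> (x, y)) \<in> test_functions A"
    "frechet_derivative (\<lambda>x. \<Phi> (x, y)) (at x) i = frechet_derivative \<Phi> (at (x, y)) (i, 0)"
proof -
  let ?L = "\<lambda>x::'a. (x, 0::'b)"
  have L: "bounded_linear ?L" by (intro bounded_linear_Pair bounded_linear_ident bounded_linear_zero)
  have B: "?L i \<in> insert 0 Basis" if "i \<in> Basis" for i
    using that by (simp add: Basis_prod_def)
  have R: "continuous_on UNIV fst" "\<And>x. fst ((0, y) + ?L x) = x" "fst ` (A \<times> B) \<subseteq> A"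
    by (auto intro: continuous_intros)
  show "(\<lambda>x. \<Phi> (x, y)) \<in> test_functions A"
    using test_functions_affine(1)[OF \<Phi> L B R] by simp
  show "frechet_derivative (\<lambda>x. \<Phi> (x, y)) (at x) i = frechet_derivative \<Phi> (at (x, y)) (i, 0)"
    using test_functions_affine(2)[OF \<Phi> L B R, of x i] by simp
qed

lemma test_functions_slice_snd:
  fixes \<Phi> :: "'a::euclidean_space \<times> 'b::euclidean_space \<Rightarrow> real"
  assumes \<Phi>: "\<Phi> \<in> test_functions (A \<times> B)"
  shows "(\<lambda>y. \<Phi> (x, y)) \<in> test_functions B"
    "frechet_derivative (\<lambda>y. \<Phi> (x, y)) (at y) i = frechet_derivative \<Phi> (at (x, y)) (0, i)"
proof -
  let ?L = "\<lambda>y::'b. (0::'a, y)"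
  have L: "bounded_linear ?L" by (intro bounded_linear_Pair bounded_linear_ident bounded_linear_zero)
  have B: "?L i \<in> insert 0 Basis" if "i \<in> Basis" for i
    using that by (simp add: Basis_prod_def)
  have R: "continuous_on UNIV snd" "\<And>y. snd ((x, 0) + ?L y) = y" "snd ` (A \<times> B) \<subseteq> B"
    by (auto intro: continuous_intros)
  show "(\<lambda>y. \<Phi> (x, y)) \<in> test_functions B"
    using test_functions_affine(1)[OF \<Phi> L B R] by simp
  show "frechet_derivative (\<lambda>y. \<Phi> (x, y)) (at y) i = frechet_derivative \<Phi> (at (x, y)) (0, i)"
    using test_functions_affine(2)[OF \<Phi> L B R, of y i] by simp
qed

lemma test_functions_swap:
  fixes \<Phi> :: "'a::euclidean_space \<times> 'b::euclidean_space \<Rightarrow> real"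
  assumes \<Phi>: "\<Phi> \<in> test_functions (A \<times> B)"
  shows "(\<lambda>z. \<Phi> (prod.swap z)) \<in> test_functions (B \<times> A)"
    "frechet_derivative (\<lambda>z. \<Phi> (prod.swap z)) (at z) i = frechet_derivative \<Phi> (at (prod.swap z)) (prod.swap i)"
proof -
  have L: "bounded_linear (prod.swap :: 'b \<times> 'a \<Rightarrow> 'a \<times> 'b)"
    unfolding prod.swap_def by (intro bounded_linear_Pair bounded_linear_fst bounded_linear_snd)
  have B: "prod.swap i \<in> insert 0 (Basis :: ('a \<times> 'b) set)" if "i \<in> Basis" for i :: "'b \<times> 'a"
    using that by (auto simp: Basis_prod_def)
  have R: "continuous_on UNIV (prod.swap :: 'a \<times> 'b \<Rightarrow> 'b \<times> 'a)"
      "\<And>z :: 'b \<times> 'a. prod.swap (0 + prod.swap z) = z" "prod.swap ` (A \<times> B) \<subseteq> B \<times> A"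
    by (auto simp: prod.swap_def[abs_def] intro!: continuous_intros)
  show "(\<lambda>z. \<Phi> (prod.swap z)) \<in> test_functions (B \<times> A)"
    using test_functions_affine(1)[OF \<Phi> L B R] by simp
  show "frechet_derivative (\<lambda>z. \<Phi> (prod.swap z)) (at z) i = frechet_derivative \<Phi> (at (prod.swap z)) (prod.swap i)"
    using test_functions_affine(2)[OF \<Phi> L B R, of z i] by simp
qed

lemma test_functions_tensor:
  fixes \<phi> :: "'a::euclidean_space \<Rightarrow> real" and \<psi> :: "'b::euclidean_space \<Rightarrow> real"
  assumes \<phi>: "\<phi> \<in> test_functions A" and \<psi>: "\<psi> \<in> test_functions B"
  shows "(\<lambda>z. \<phi> (fst z) * \<psi> (snd z)) \<in> test_functions (A \<times> B)"
    "frechet_derivative (\<lambda>z. \<phi> (fst z) * \<psi> (snd z)) (at z) (0, j)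
      = \<phi> (fst z) * frechet_derivative \<psi> (at (snd z)) j"
proof -
  obtain K where K: "compact K" "K \<subseteq> A" "\<And>x. x \<notin> K \<Longrightarrow> \<phi> x = 0"
    using \<phi> by (auto simp: test_functions_def)
  obtain K' where K': "compact K'" "K' \<subseteq> B" "\<And>x. x \<notin> K' \<Longrightarrow> \<psi> x = 0"
    using \<psi> by (auto simp: test_functions_def)
  have "Ck k (\<lambda>z::'a \<times> 'b. \<phi> (0 + fst z))" for k
    by (rule Ck_affine[OF bounded_linear_fst _ test_functions_Ck[OF \<phi>]]) (auto simp: Basis_prod_def)
  moreover have "Ck k (\<lambda>z::'a \<times> 'b. \<psi> (0 + snd z))" for k
    by (rule Ck_affine[OF bounded_linear_snd _ test_functions_Ck[OF \<psi>]]) (auto simp: Basis_prod_def)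
  ultimately have "Ck k (\<lambda>z::'a \<times> 'b. \<phi> (fst z) * \<psi> (snd z))" for k
    using Ck_mult[of k "\<lambda>z::'a \<times> 'b. \<phi> (fst z)"] by simp
  moreover have "compact (K \<times> K')" "K \<times> K' \<subseteq> A \<times> B" using K K' by (auto intro: compact_Times)
  moreover have "\<forall>z. z \<notin> K \<times> K' \<longrightarrow> \<phi> (fst z) * \<psi> (snd z) = 0" using K(3) K'(3) by (auto simp: mem_Times_iff)
  ultimately show t: "(\<lambda>z. \<phi> (fst z) * \<psi> (snd z)) \<in> test_functions (A \<times> B)"
    unfolding test_functions_def by blast
  obtain x y where z: "z = (x, y)" by fastforce
  have "frechet_derivative (\<lambda>y. \<phi> x * \<psi> y) (at y) j = \<phi> x * frechet_derivative \<psi> (at y) j"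
    using frechet_derivative_at[OF has_derivative_mult_right[OF test_functions_has_derivative[OF \<psi>], of "\<phi> x" y]]
    by metis
  then show "frechet_derivative (\<lambda>z. \<phi> (fst z) * \<psi> (snd z)) (at z) (0, j)
      = \<phi> (fst z) * frechet_derivative \<psi> (at (snd z)) j"
    using test_functions_slice_snd(2)[OF t, of x y j] z by simp
qed

section \<open>The fundamental lemma of the calculus of variations\<close>

text \<open>
  Boxes form an intersection-stable generator of the Borel sets, so that all integrals over Borel sets vanish. The bounded
  support is used for complements, where the total integral enters.
\<close>

lemma AE_zero_if_box_integrals_zero:
  fixes f :: "'a::euclidean_space \<Rightarrow> real"
  assumes f: "integrable lborel f" and supp: "\<And>x. x \<notin> cbox c d \<Longrightarrow> f x = 0"
    and zero: "\<And>a b. (LINT x:box a b|lborel. f x) = 0"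
  shows "AE x in lborel. f x = 0"
proof (rule sigma_finite_measure.density_zero[OF sigma_finite_lborel f])
  fix A :: "'a set" assume "A \<in> sets lborel"
  then have A: "A \<in> sigma_sets UNIV (range (\<lambda>(a, b). box a b))"
    by (simp add: borel_eq_box)
  have sets: "A \<in> sigma_sets UNIV (range (\<lambda>(a, b). box a b)) \<Longrightarrow> A \<in> sets lborel" for A :: "'a set"
    by (simp add: borel_eq_box)
  have si: "A \<in> sets lborel \<Longrightarrow> set_integrable lborel A f" for A
    using integrable_mult_indicator[OF _ f, of A] by (simp add: set_integrable_def)
  \<comment> \<open>Enlarging the closed box by \<open>1\<close> on each side gives an open box that contains the support.\<close>
  have total: "(LINT x|lborel. f x) = 0"
  proof -
    have "(LINT x|lborel. f x) = (LINT x:box (c - One) (d + One)|lborel. f x)"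
      unfolding set_lebesgue_integral_def
    proof (intro Bochner_Integration.integral_cong refl)
      fix x
      have "x \<in> box (c - One) (d + One)" if "x \<in> cbox c d"
        using that by (force simp: mem_box inner_simps)
      then show "f x = indicat_real (box (c - One) (d + One)) x *\<^sub>R f x"
        using supp[of x] by (auto simp: indicator_def)
    qed
    then show ?thesis using zero by simp
  qed
  have "Int_stable (range (\<lambda>(a, b). box a b :: 'a set))"
    by (auto simp: Int_stable_def box_Int_box)
  moreover have "range (\<lambda>(a, b). box a b :: 'a set) \<subseteq> Pow UNIV" by simp
  ultimately show "(LINT x:A|lborel. f x) = 0"
    using A
  proof (induction rule: sigma_sets_induct_disjoint)
    case (basic A)
    then show ?case using zero by auto
  next
    case (compl A)
    have "(LINT x:UNIV - A|lborel. f x) = (LINT x|lborel. f x - indicator A x *\<^sub>R f x)"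
      unfolding set_lebesgue_integral_def
      by (intro Bochner_Integration.integral_cong refl) (auto simp: indicator_def)
    also have "\<dots> = (LINT x|lborel. f x) - (LINT x:A|lborel. f x)"
      unfolding set_lebesgue_integral_def
      by (rule Bochner_Integration.integral_diff[OF f]) (use si[OF sets[OF compl(1)]] in \<open>simp add: set_integrable_def\<close>)
    finally show ?case using compl total by simp
  next
    case (union A)
    have "(LINT x:(\<Union>i. A i)|lborel. f x) = (\<Sum>i. (LINT x:A i|lborel. f x))"
    proof (rule lebesgue_integral_countable_add)
      have *: "A i \<in> sets lborel" for i using union(2) sets by blast
      then show "A i \<in> sets lborel" for i .
      show "set_integrable lborel (\<Union>i. A i) f" using * by (intro si sets.countable_UN) auto
    qed (use union(1) in \<open>auto simp: disjoint_family_on_def\<close>)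
    then show ?case using union by simp
  qed (simp_all add: set_lebesgue_integral_def)
qed

lemma open_in_sets_lebesgue: "open S \<Longrightarrow> S \<in> sets lebesgue"
  by auto

lemma finite_measure_lebesgue_on_bounded:
  assumes "open \<Omega>" "bounded \<Omega>"
  shows "finite_measure (lebesgue_on \<Omega>)"
  by (rule finite_measure_lebesgue_on) (use assms in \<open>auto intro: lmeasurable_open\<close>)

lemma borel_measurable_lebesgue_onI:
  "f \<in> borel_measurable borel \<Longrightarrow> f \<in> borel_measurable (lebesgue_on \<Omega>)"
  for f :: "'a::euclidean_space \<Rightarrow> 'c::topological_space"
  by (intro measurable_restrict_space1 measurable_completion) simp

text \<open>
  Bump functions converge to indicators of boxes, so that the integrals of \<open>f\<close> over all boxes with closure in \<open>\<Omega>\<close> vanish.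
  Since \<open>\<Omega>\<close> is a countable union of such closed boxes, it suffices to consider the restriction of \<open>f\<close> to each of them.
\<close>

lemma fundamental_lemma:
  fixes f :: "'a::euclidean_space \<Rightarrow> real"
  assumes op: "open \<Omega>" and f: "integrable (lebesgue_on \<Omega>) f"
    and zero: "\<And>\<phi>. \<phi> \<in> test_functions \<Omega> \<Longrightarrow> (LINT x|lebesgue_on \<Omega>. f x * \<phi> x) = 0"
  shows "AE x in lebesgue_on \<Omega>. f x = 0"
proof -
  note S[simp] = open_in_sets_lebesgue[OF op]
  have box0: "(LINT x|lebesgue_on \<Omega>. f x * indicator (box a b) x) = 0" if "cbox a b \<subseteq> \<Omega>" for a b
  proof -
    have "(\<lambda>n. LINT x|lebesgue_on \<Omega>. f x * box_bump a b n x)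
        \<longlonglongrightarrow> (LINT x|lebesgue_on \<Omega>. f x * indicator (box a b) x)"
    proof (rule integral_dominated_convergence[where w="\<lambda>x. \<bar>f x\<bar>"])
      show "(\<lambda>x. f x * indicator (box a b) x) \<in> borel_measurable (lebesgue_on \<Omega>)"
        by (rule borel_measurable_times[OF borel_measurable_integrable[OF f]
              borel_measurable_lebesgue_onI]) auto
      show "(\<lambda>x. f x * box_bump a b n x) \<in> borel_measurable (lebesgue_on \<Omega>)" for n
        by (rule borel_measurable_times[OF borel_measurable_integrable[OF f]
              borel_measurable_lebesgue_onI[OF test_functions_measurable[OF box_bump_test[OF that]]]])
      show "AE x in lebesgue_on \<Omega>. (\<lambda>n. f x * box_bump a b n x) \<longlonglongrightarrow> f x * indicator (box a b) x"
        by (intro AE_I2 tendsto_mult tendsto_const box_bump_tendsto)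
      show "AE x in lebesgue_on \<Omega>. norm (f x * box_bump a b n x) \<le> \<bar>f x\<bar>" for n
        using box_bump_bounds[of a b n] by (intro AE_I2) (simp add: abs_mult mult_left_le)
    qed (use f in auto)
    then show ?thesis
      unfolding zero[OF box_bump_test[OF that]] by (simp add: LIMSEQ_const_iff)
  qed
  obtain \<D> where \<D>: "countable \<D>" "\<D> \<subseteq> Pow \<Omega>" "\<And>X. X \<in> \<D> \<Longrightarrow> \<exists>a b. X = cbox a b" "\<Union>\<D> = \<Omega>"
    using open_countable_Union_open_cbox[OF op] by blast
  have "AE x in lebesgue_on \<Omega>. \<forall>X\<in>\<D>. x \<in> X \<longrightarrow> f x = 0"
  proof (rule AE_ball_countable'[OF _ \<D>(1)])
    fix X assume "X \<in> \<D>"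
    then obtain c d where X: "X = cbox c d" and sub: "cbox c d \<subseteq> \<Omega>" using \<D> by blast
    let ?g = "\<lambda>x. indicator (cbox c d) x * f x"
    have intg: "integrable lebesgue ?g"
    proof -
      have "integrable lebesgue (\<lambda>x. indicator \<Omega> x *\<^sub>R f x)"
        using f by (subst (asm) integrable_restrict_space) auto
      from integrable_mult_indicator[OF _ this, of "cbox c d"]
      have "integrable lebesgue (\<lambda>x. indicator (cbox c d) x * (indicator \<Omega> x * f x))" by auto
      then show ?thesis
        by (rule Bochner_Integration.integrable_cong[THEN iffD1, OF refl, rotated])
          (use sub in \<open>auto simp: indicator_def\<close>)
    qed
    obtain g' where g': "g' \<in> borel_measurable lborel" "AE x in lborel. ?g x = g' x"
      using completion_ex_borel_measurable_real[OF borel_measurable_integrable[OF intg]] by blast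
    let ?h = "\<lambda>x. indicator (cbox c d) x * g' x"
    have gh: "AE x in lborel. ?g x = ?h x" using g'(2) by eventually_elim (auto simp: indicator_def)
    have hb: "?h \<in> borel_measurable lborel" using g'(1) by auto
    have inth: "integrable lborel ?h"
    proof -
      have "integrable lebesgue ?h"
        using intg by (rule Bochner_Integration.integrable_cong_AE_imp)
          (use hb AE_completion[OF gh] in \<open>auto intro: measurable_completion\<close>)
      then show ?thesis using hb by (simp add: integrable_completion)
    qed
    have "AE x in lborel. ?h x = 0"
    proof (rule AE_zero_if_box_integrals_zero[OF inth])
      fix a b
      \<comment> \<open>The intersection of two boxes is the box with corners \<open>?p\<close> and \<open>?q\<close>.\<close>
      let ?p = "\<Sum>i\<in>Basis. max (a\<bullet>i) (c\<bullet>i) *\<^sub>R i" and ?q = "\<Sum>i\<in>Basis. min (b\<bullet>i) (d\<bullet>i) *\<^sub>R i"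
      have pq: "cbox ?p ?q \<subseteq> \<Omega>" using sub unfolding Int_interval[symmetric] by blast
      \<comment> \<open>The integral over the closed box \<open>cbox c d\<close> is compared with integrals over open boxes.\<close>
      have fr: "AE x in lebesgue. x \<notin> cbox c d - box c d"
        using negligible_frontier_interval[of c d] by (intro AE_not_in) (simp add: negligible_iff_null_sets)
      have "(LINT x:box a b|lborel. ?h x) = (LINT x|lebesgue. indicator (box a b) x * ?h x)"
        unfolding set_lebesgue_integral_def using hb by (subst integral_completion) auto
      also have "\<dots> = (LINT x|lebesgue. indicator \<Omega> x *\<^sub>R (f x * indicator (box ?p ?q) x))"
      proof (rule integral_cong_AE)
        show "(\<lambda>x. indicator (box a b) x * ?h x) \<in> borel_measurable lebesgue"
          using hb by (intro measurable_completion) auto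
        have "integrable lebesgue (\<lambda>x. indicator \<Omega> x *\<^sub>R f x)"
          using f by (subst (asm) integrable_restrict_space) auto
        then have "(\<lambda>x. (indicator \<Omega> x *\<^sub>R f x) * indicator (box ?p ?q) x) \<in> borel_measurable lebesgue"
          by (intro borel_measurable_times) (auto intro: measurable_completion)
        then show "(\<lambda>x. indicator \<Omega> x *\<^sub>R (f x * indicator (box ?p ?q) x)) \<in> borel_measurable lebesgue"
          by (simp add: mult_ac)
        show "AE x in lebesgue. indicator (box a b) x * ?h x = indicator \<Omega> x *\<^sub>R (f x * indicator (box ?p ?q) x)"
          using AE_completion[OF gh] fr
        proof eventually_elim
          case (elim x)
          have "x \<in> box ?p ?q \<longleftrightarrow> x \<in> box a b \<and> x \<in> box c d"
            unfolding box_Int_box[symmetric] by simp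
          then show ?case using elim sub box_subset_cbox[of c d] by (auto simp: indicator_def)
        qed
      qed
      also have "\<dots> = 0"
        using box0[OF pq] by (subst (asm) integral_restrict_space) auto
      finally show "(LINT x:box a b|lborel. ?h x) = 0" .
    qed (auto simp: indicator_def)
    with gh have "AE x in lborel. x \<in> X \<longrightarrow> f x = 0"
      by eventually_elim (auto simp: X indicator_def)
    then have "AE x in lebesgue. x \<in> X \<longrightarrow> f x = 0" by (rule AE_completion)
    then show "AE x in lebesgue_on \<Omega>. x \<in> X \<longrightarrow> f x = 0"
      by (subst AE_restrict_space_iff) auto
  qed
  moreover have "AE x in lebesgue_on \<Omega>. x \<in> \<Omega>" using AE_space[of "lebesgue_on \<Omega>"] by simp
  ultimately show ?thesis by eventually_elim (use \<D>(4) in auto)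
qed

lemma test_functions_Lp2:
  assumes "open \<Omega>" "bounded \<Omega>" "\<phi> \<in> test_functions X"
  shows "\<phi> \<in> Lp 2 (lebesgue_on \<Omega>)"
  using test_functions_bounded[OF assms(3)]
  by (metis Lp2_bounded finite_measure_lebesgue_on_bounded[OF assms(1,2)]
      borel_measurable_lebesgue_onI[OF test_functions_measurable[OF assms(3)]] real_norm_def)

section \<open>Sobolev functions and their gradients\<close>

text \<open>
  All computations are done with explicit representatives of the weak gradient; \<open>wgrad\<close> enters only through the uniqueness
  of weak gradients.
\<close>

definition sobolev_pair :: "'a::euclidean_space set \<Rightarrow> ('a \<Rightarrow> real) \<Rightarrow> ('a \<Rightarrow> 'a) \<Rightarrow> bool" where
  "sobolev_pair \<Omega> u G \<longleftrightarrow> u \<in> Lp 2 (lebesgue_on \<Omega>) \<and> has_weak_gradient \<Omega> u G"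

lemma H1_iff: "u \<in> H1 \<Omega> \<longleftrightarrow> (\<exists>G. sobolev_pair \<Omega> u G)"
  by (auto simp: H1_def sobolev_pair_def)

lemma sobolev_pair_wgrad: "u \<in> H1 \<Omega> \<Longrightarrow> sobolev_pair \<Omega> u (wgrad \<Omega> u)"
  unfolding H1_def sobolev_pair_def wgrad_def by (auto intro: someI[of "has_weak_gradient \<Omega> u"])

lemma sobolev_pair_H1: "sobolev_pair \<Omega> u G \<Longrightarrow> u \<in> H1 \<Omega>"
  by (auto simp: H1_iff)

lemma sobolev_pair_L2:
  assumes "sobolev_pair \<Omega> u G"
  shows "u \<in> Lp 2 (lebesgue_on \<Omega>)" "G \<in> Lp 2 (lebesgue_on \<Omega>)"
  using assms by (auto simp: sobolev_pair_def has_weak_gradient_def)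

lemma sobolev_pairD:
  assumes "sobolev_pair \<Omega> u G" "\<phi> \<in> test_functions \<Omega>" "i \<in> Basis"
  shows "(LINT x|lebesgue_on \<Omega>. u x * frechet_derivative \<phi> (at x) i) =
        - (LINT x|lebesgue_on \<Omega>. (G x \<bullet> i) * \<phi> x)"
  using assms by (auto simp: sobolev_pair_def has_weak_gradient_def)

lemma sobolev_pairI:
  assumes "u \<in> Lp 2 (lebesgue_on \<Omega>)" "G \<in> Lp 2 (lebesgue_on \<Omega>)"
   "\<And>\<phi> i. \<phi> \<in> test_functions \<Omega> \<Longrightarrow> i \<in> Basis \<Longrightarrow>
     (LINT x|lebesgue_on \<Omega>. u x * frechet_derivative \<phi> (at x) i) =
        - (LINT x|lebesgue_on \<Omega>. (G x \<bullet> i) * \<phi> x)"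
  shows "sobolev_pair \<Omega> u G"
  using assms by (auto simp: sobolev_pair_def has_weak_gradient_def)

lemma H1_norm_nonneg: "0 \<le> H1_norm \<Omega> u"
  by (simp add: H1_norm_def H1_inner_def L2_inner_def dirichlet_form_def)

lemma L2_inner_scale: "L2_inner \<Omega> (\<lambda>y. c * u y) v = c * L2_inner \<Omega> u v"
  by (simp add: L2_inner_def mult.assoc)

context
  fixes \<Omega> :: "'a::euclidean_space set"
  assumes op: "open \<Omega>" and bd: "bounded \<Omega>"
begin

lemma sobolev_integrable:
  assumes "sobolev_pair \<Omega> u G" "\<phi> \<in> test_functions \<Omega>" "i \<in> Basis"
  shows "integrable (lebesgue_on \<Omega>) (\<lambda>x. u x * frechet_derivative \<phi> (at x) i)"
    "integrable (lebesgue_on \<Omega>) (\<lambda>x. (G x \<bullet> i) * \<phi> x)"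
  using sobolev_pair_L2[OF assms(1)] test_functions_Lp2[OF op bd assms(2)]
    test_functions_Lp2[OF op bd test_functions_partial[OF assms(2,3)]]
  by (auto intro!: Lp2_times_integrable Lp2_inner_const)

text \<open>
  The components of the difference of two weak gradients are orthogonal to all test functions, and the fundamental lemma
  applies to them.
\<close>

lemma weak_gradient_unique_AE:
  assumes "sobolev_pair \<Omega> u G" "sobolev_pair \<Omega> v H" "AE x in lebesgue_on \<Omega>. u x = v x"
  shows "AE x in lebesgue_on \<Omega>. G x = H x"
proof -
  note L = sobolev_pair_L2[OF assms(1)] sobolev_pair_L2[OF assms(2)]
  have "AE x in lebesgue_on \<Omega>. \<forall>i\<in>Basis. (G x - H x) \<bullet> i = 0"
  proof (rule AE_ball_countable')
    fix i :: 'a assume i: "i \<in> Basis"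
    show "AE x in lebesgue_on \<Omega>. (G x - H x) \<bullet> i = 0"
    proof (rule fundamental_lemma[OF op])
      show "integrable (lebesgue_on \<Omega>) (\<lambda>x. (G x - H x) \<bullet> i)"
        by (intro Lp2_integrable[OF finite_measure_lebesgue_on_bounded[OF op bd]] Lp2_inner_const Lp2_diff L)
      fix \<phi> assume \<phi>: "\<phi> \<in> test_functions \<Omega>"
      have "(LINT x|lebesgue_on \<Omega>. (G x - H x) \<bullet> i * \<phi> x)
         = (LINT x|lebesgue_on \<Omega>. (G x \<bullet> i) * \<phi> x) - (LINT x|lebesgue_on \<Omega>. (H x \<bullet> i) * \<phi> x)"
        using sobolev_integrable(2)[OF assms(1) \<phi> i] sobolev_integrable(2)[OF assms(2) \<phi> i]
        by (simp add: inner_simps algebra_simps)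
      also have "(LINT x|lebesgue_on \<Omega>. u x * frechet_derivative \<phi> (at x) i)
          = (LINT x|lebesgue_on \<Omega>. v x * frechet_derivative \<phi> (at x) i)"
        by (rule integral_cong_AE)
          (use assms(3) sobolev_integrable(1)[OF assms(1) \<phi> i] sobolev_integrable(1)[OF assms(2) \<phi> i] in auto)
      then have "(LINT x|lebesgue_on \<Omega>. (G x \<bullet> i) * \<phi> x) = (LINT x|lebesgue_on \<Omega>. (H x \<bullet> i) * \<phi> x)"
        using sobolev_pairD[OF assms(1) \<phi> i] sobolev_pairD[OF assms(2) \<phi> i] by simp
      finally show "(LINT x|lebesgue_on \<Omega>. (G x - H x) \<bullet> i * \<phi> x) = 0" by simp
    qed
  qed (simp add: countable_finite)
  then show ?thesis
  proof eventually_elim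
    case (elim x)
    then have "G x - H x = 0" by (metis euclidean_eqI inner_zero_left)
    then show ?case by simp
  qed
qed

lemma sobolev_pair_AE_cong:
  assumes "sobolev_pair \<Omega> u G" "AE x in lebesgue_on \<Omega>. u x = v x" "AE x in lebesgue_on \<Omega>. G x = H x"
    "v \<in> borel_measurable (lebesgue_on \<Omega>)" "H \<in> borel_measurable (lebesgue_on \<Omega>)"
  shows "sobolev_pair \<Omega> v H"
proof (rule sobolev_pairI)
  note L = sobolev_pair_L2[OF assms(1)]
  show v: "v \<in> Lp 2 (lebesgue_on \<Omega>)" and H: "H \<in> Lp 2 (lebesgue_on \<Omega>)"
    using L assms Lp2_AE_cong by blast+
  fix \<phi> and i :: 'a assume \<phi>: "\<phi> \<in> test_functions \<Omega>" and i: "i \<in> Basis"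
  note p = sobolev_integrable[OF assms(1) \<phi> i]
  have "(LINT x|lebesgue_on \<Omega>. v x * frechet_derivative \<phi> (at x) i)
     = (LINT x|lebesgue_on \<Omega>. u x * frechet_derivative \<phi> (at x) i)"
  proof (rule integral_cong_AE)
    show "(\<lambda>x. v x * frechet_derivative \<phi> (at x) i) \<in> borel_measurable (lebesgue_on \<Omega>)"
      using assms(4) test_functions_Lp2[OF op bd test_functions_partial[OF \<phi> i]] by (auto simp: Lp2_iff)
  qed (use assms(2) p in auto)
  moreover have "(LINT x|lebesgue_on \<Omega>. (H x \<bullet> i) * \<phi> x) = (LINT x|lebesgue_on \<Omega>. (G x \<bullet> i) * \<phi> x)"
  proof (rule integral_cong_AE)
    show "(\<lambda>x. (H x \<bullet> i) * \<phi> x) \<in> borel_measurable (lebesgue_on \<Omega>)"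
      using assms(5) test_functions_Lp2[OF op bd \<phi>] by (auto simp: Lp2_iff)
  qed (use assms(3) p in auto)
  ultimately show "(LINT x|lebesgue_on \<Omega>. v x * frechet_derivative \<phi> (at x) i) =
        - (LINT x|lebesgue_on \<Omega>. (H x \<bullet> i) * \<phi> x)"
    using sobolev_pairD[OF assms(1) \<phi> i] by simp
qed

lemma sobolev_pair_scale:
  assumes "sobolev_pair \<Omega> u G"
  shows "sobolev_pair \<Omega> (\<lambda>x. c * u x) (\<lambda>x. c *\<^sub>R G x)"
  by (rule sobolev_pairI)
    (use sobolev_pair_L2[OF assms] sobolev_pairD[OF assms] in \<open>auto intro: Lp2_scaleR Lp2_cmult simp: mult.assoc\<close>)

lemma sobolev_pair_add:
  assumes "sobolev_pair \<Omega> u G" "sobolev_pair \<Omega> v H"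
  shows "sobolev_pair \<Omega> (\<lambda>x. u x + v x) (\<lambda>x. G x + H x)"
proof (rule sobolev_pairI)
  fix \<phi> and i :: 'a assume \<phi>: "\<phi> \<in> test_functions \<Omega>" and i: "i \<in> Basis"
  show "(LINT x|lebesgue_on \<Omega>. (u x + v x) * frechet_derivative \<phi> (at x) i) =
        - (LINT x|lebesgue_on \<Omega>. ((G x + H x) \<bullet> i) * \<phi> x)"
    using sobolev_integrable[OF assms(1) \<phi> i] sobolev_integrable[OF assms(2) \<phi> i]
     sobolev_pairD[OF assms(1) \<phi> i] sobolev_pairD[OF assms(2) \<phi> i]
    by (simp add: distrib_right inner_add_left)
qed (use sobolev_pair_L2[OF assms(1)] sobolev_pair_L2[OF assms(2)] in \<open>auto intro: Lp2_add\<close>)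

lemma sobolev_pair_diff:
  assumes "sobolev_pair \<Omega> u G" "sobolev_pair \<Omega> v H"
  shows "sobolev_pair \<Omega> (\<lambda>x. u x - v x) (\<lambda>x. G x - H x)"
  using sobolev_pair_add[OF assms(1) sobolev_pair_scale[OF assms(2), of "-1"]] by simp

lemma sobolev_pair_zero: "sobolev_pair \<Omega> (\<lambda>x. 0) (\<lambda>x. 0)"
  by (rule sobolev_pairI) (auto simp: Lp2_zero)

lemma sobolev_pair_sum:
  assumes "\<And>j. j \<in> J \<Longrightarrow> sobolev_pair \<Omega> (u j) (G j)"
  shows "sobolev_pair \<Omega> (\<lambda>x. \<Sum>j\<in>J. u j x) (\<lambda>x. \<Sum>j\<in>J. G j x)"
  using assms by (induction J rule: infinite_finite_induct)
    (auto intro: sobolev_pair_add simp: sobolev_pair_zero)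

text \<open>
  Both sides of the defining identity are \<open>L\<^sup>2\<close> inner products with a fixed function, hence continuous.
\<close>

lemma sobolev_pair_closed:
  assumes p: "\<And>n. sobolev_pair \<Omega> (u n) (G n)" and v: "v \<in> Lp 2 (lebesgue_on \<Omega>)" and H: "H \<in> Lp 2 (lebesgue_on \<Omega>)"
    and lim: "(\<lambda>n. L2_norm (lebesgue_on \<Omega>) (\<lambda>x. u n x - v x)) \<longlonglongrightarrow> 0"
      "(\<lambda>n. L2_norm (lebesgue_on \<Omega>) (\<lambda>x. G n x - H x)) \<longlonglongrightarrow> 0"
  shows "sobolev_pair \<Omega> v H"
proof (rule sobolev_pairI[OF v H])
  fix \<phi> and i :: 'a assume \<phi>: "\<phi> \<in> test_functions \<Omega>" and i: "i \<in> Basis"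
  note L = sobolev_pair_L2[OF p]
  note t = test_functions_Lp2[OF op bd \<phi>] test_functions_Lp2[OF op bd test_functions_partial[OF \<phi> i]]
  have t': "(\<lambda>x. \<phi> x *\<^sub>R i) \<in> Lp 2 (lebesgue_on \<Omega>)"
    by (rule Lp2_bound[OF t(1), where C=1]) (use t i in \<open>auto simp: Lp2_iff\<close>)
  have "(\<lambda>n. LINT x|lebesgue_on \<Omega>. u n x * frechet_derivative \<phi> (at x) i)
      \<longlonglongrightarrow> (LINT x|lebesgue_on \<Omega>. v x * frechet_derivative \<phi> (at x) i)"
    using L2_ip_tendsto[OF L(1) v t(2) lim(1)] by (simp add: L2_ip_def)
  moreover have "(\<lambda>n. - (LINT x|lebesgue_on \<Omega>. (G n x \<bullet> i) * \<phi> x))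
      \<longlonglongrightarrow> - (LINT x|lebesgue_on \<Omega>. (H x \<bullet> i) * \<phi> x)"
    using tendsto_minus[OF L2_ip_tendsto[OF L(2) H t' lim(2)]]
    by (simp add: L2_ip_def mult.commute)
  ultimately show "(LINT x|lebesgue_on \<Omega>. v x * frechet_derivative \<phi> (at x) i) =
        - (LINT x|lebesgue_on \<Omega>. (H x \<bullet> i) * \<phi> x)"
    unfolding sobolev_pairD[OF p \<phi> i] by (rule LIMSEQ_unique)
qed

lemma sobolev_pair_limit:
  assumes p: "\<And>n. sobolev_pair \<Omega> (u n) (G n)" and g: "g \<in> Lp 2 (lebesgue_on \<Omega>)"
    and lim: "(\<lambda>n. L2_norm (lebesgue_on \<Omega>) (\<lambda>x. (u n x, G n x) - g x)) \<longlonglongrightarrow> 0"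
  shows "sobolev_pair \<Omega> (\<lambda>x. fst (g x)) (\<lambda>x. snd (g x))"
    and "(\<lambda>n. L2_norm (lebesgue_on \<Omega>) (\<lambda>x. u n x - fst (g x))) \<longlonglongrightarrow> 0"
proof -
  note L = sobolev_pair_L2[OF p]
  have d: "(\<lambda>x. (u n x, G n x) - g x) \<in> Lp 2 (lebesgue_on \<Omega>)" for n
    by (intro Lp2_diff Lp2_Pair L g)
  have le: "L2_norm (lebesgue_on \<Omega>) (\<lambda>x. u n x - fst (g x)) \<le> L2_norm (lebesgue_on \<Omega>) (\<lambda>x. (u n x, G n x) - g x)"
    "L2_norm (lebesgue_on \<Omega>) (\<lambda>x. G n x - snd (g x)) \<le> L2_norm (lebesgue_on \<Omega>) (\<lambda>x. (u n x, G n x) - g x)" for n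
    using L2_norm_fst_le[OF d, of n] L2_norm_snd_le[OF d, of n] by simp_all
  show l1: "(\<lambda>n. L2_norm (lebesgue_on \<Omega>) (\<lambda>x. u n x - fst (g x))) \<longlonglongrightarrow> 0"
    by (rule tendsto_sandwich[OF _ _ tendsto_const lim]) (simp_all add: le L2_norm_nonneg)
  have l2: "(\<lambda>n. L2_norm (lebesgue_on \<Omega>) (\<lambda>x. G n x - snd (g x))) \<longlonglongrightarrow> 0"
    by (rule tendsto_sandwich[OF _ _ tendsto_const lim]) (simp_all add: le L2_norm_nonneg)
  show "sobolev_pair \<Omega> (\<lambda>x. fst (g x)) (\<lambda>x. snd (g x))"
    by (rule sobolev_pair_closed[OF p Lp2_fst_comp[OF g] Lp2_snd_comp[OF g] l1 l2])
qed

text \<open>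
  Integration by parts: \<open>\<phi> \<psi>\<close> is a test function, and integrals of its derivatives vanish.
\<close>

lemma sobolev_pair_test_function:
  assumes \<phi>: "\<phi> \<in> test_functions \<Omega>"
  shows "sobolev_pair \<Omega> \<phi> (\<lambda>x. \<Sum>i\<in>Basis. frechet_derivative \<phi> (at x) i *\<^sub>R i)"
proof (rule sobolev_pairI)
  show "(\<lambda>x. \<Sum>i\<in>Basis. frechet_derivative \<phi> (at x) i *\<^sub>R i) \<in> Lp 2 (lebesgue_on \<Omega>)"
  proof (rule Lp2_sum)
    fix i :: 'a assume i: "i \<in> Basis"
    note t = test_functions_Lp2[OF op bd test_functions_partial[OF \<phi> i]]
    show "(\<lambda>x. frechet_derivative \<phi> (at x) i *\<^sub>R i) \<in> Lp 2 (lebesgue_on \<Omega>)"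
      by (rule Lp2_bound[OF t, where C=1]) (use t i in \<open>auto simp: Lp2_iff\<close>)
  qed
  fix \<psi> and i :: 'a assume \<psi>: "\<psi> \<in> test_functions \<Omega>" and i: "i \<in> Basis"
  let ?p = "\<lambda>x. \<phi> x * \<psi> x"
  note pt = test_functions_mult[OF \<phi> \<psi>]
  have der: "frechet_derivative ?p (at x) i
      = \<phi> x * frechet_derivative \<psi> (at x) i + frechet_derivative \<phi> (at x) i * \<psi> x" for x
    using frechet_derivative_at[OF has_derivative_mult[OF test_functions_has_derivative[OF \<phi>]
        test_functions_has_derivative[OF \<psi>]], of x] by metis
  have "(LINT x|lebesgue_on \<Omega>. frechet_derivative ?p (at x) i) = (LINT x|lborel. frechet_derivative ?p (at x) i)"
  proof -
    note q = test_functions_partial[OF pt i]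
    obtain K where K: "K \<subseteq> \<Omega>" "\<And>x. x \<notin> K \<Longrightarrow> frechet_derivative ?p (at x) i = 0"
      using q by (auto simp: test_functions_def)
    have "(LINT x|lebesgue_on \<Omega>. frechet_derivative ?p (at x) i)
        = (LINT x|lebesgue. indicator \<Omega> x *\<^sub>R frechet_derivative ?p (at x) i)"
      using op by (intro integral_restrict_space) auto
    also have "\<dots> = (LINT x|lebesgue. frechet_derivative ?p (at x) i)"
      by (intro Bochner_Integration.integral_cong refl) (use K in \<open>auto simp: indicator_def\<close>)
    also have "\<dots> = (LINT x|lborel. frechet_derivative ?p (at x) i)"
      by (rule integral_completion) (use test_functions_measurable[OF q] in simp)
    finally show ?thesis .
  qed
  also have "\<dots> = 0" by (rule integral_partial_test_function[OF pt i])
  finally have "(LINT x|lebesgue_on \<Omega>. \<phi> x * frechet_derivative \<psi> (at x) i + frechet_derivative \<phi> (at x) i * \<psi> x) = 0"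
    unfolding der .
  moreover have "integrable (lebesgue_on \<Omega>) (\<lambda>x. \<phi> x * frechet_derivative \<psi> (at x) i)"
    "integrable (lebesgue_on \<Omega>) (\<lambda>x. frechet_derivative \<phi> (at x) i * \<psi> x)"
    using \<phi> \<psi> i by (auto intro!: Lp2_times_integrable test_functions_Lp2[OF op bd] test_functions_partial)
  ultimately show "(LINT x|lebesgue_on \<Omega>. \<phi> x * frechet_derivative \<psi> (at x) i)
     = - (LINT x|lebesgue_on \<Omega>. (\<Sum>i\<in>Basis. frechet_derivative \<phi> (at x) i *\<^sub>R i) \<bullet> i * \<psi> x)"
    using i by (simp add: inner_sum_left_Basis inner_sum_left inner_Basis if_distrib cong: if_cong)
qed (rule test_functions_Lp2[OF op bd \<phi>])

lemma dirichlet_form_eq: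
  assumes u: "sobolev_pair \<Omega> u G" and v: "sobolev_pair \<Omega> v H"
  shows "dirichlet_form \<Omega> u v = L2_ip (lebesgue_on \<Omega>) G H"
proof -
  have *: "AE x in lebesgue_on \<Omega>. wgrad \<Omega> u x = G x" "wgrad \<Omega> u \<in> borel_measurable (lebesgue_on \<Omega>)"
      "G \<in> borel_measurable (lebesgue_on \<Omega>)" if "sobolev_pair \<Omega> u G" for u G
    using weak_gradient_unique_AE[OF sobolev_pair_wgrad[OF sobolev_pair_H1[OF that]] that]
      sobolev_pair_L2[OF that] sobolev_pair_L2[OF sobolev_pair_wgrad[OF sobolev_pair_H1[OF that]]]
    by (auto simp: Lp2_iff)
  show ?thesis
    unfolding dirichlet_form_def L2_ip_def[symmetric]
    by (rule L2_ip_cong_AE) (use *[OF u] *[OF v] in auto)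
qed

lemma dirichlet_form_scale:
  assumes "sobolev_pair \<Omega> u G" "sobolev_pair \<Omega> v K"
  shows "dirichlet_form \<Omega> (\<lambda>x. c * u x) v = c * dirichlet_form \<Omega> u v"
  by (simp add: dirichlet_form_eq[OF sobolev_pair_scale[OF assms(1)] assms(2)]
      dirichlet_form_eq[OF assms] L2_ip_scaleR_left)

lemma dirichlet_form_zero: "sobolev_pair \<Omega> u G \<Longrightarrow> dirichlet_form \<Omega> u (\<lambda>_. 0) = 0"
  by (simp add: dirichlet_form_eq[OF _ sobolev_pair_zero] L2_ip_def)

lemma L2_inner_eq: "L2_inner \<Omega> u v = L2_ip (lebesgue_on \<Omega>) u v"
  by (simp add: L2_inner_def L2_ip_def)

text \<open>
  The map \<open>u \<mapsto> (u, \<nabla>u)\<close> embeds \<open>H\<^sup>1\<close> isometrically into an \<open>L\<^sup>2\<close> space of vector-valued functions. In this way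
  completeness, Bessel's inequality and the triangle inequality for \<open>H\<^sup>1\<close> are instances of the \<open>L\<^sup>2\<close> results.
\<close>

lemma H1_inner_eq:
  assumes u: "sobolev_pair \<Omega> u G" and v: "sobolev_pair \<Omega> v H"
  shows "H1_inner \<Omega> u v = L2_ip (lebesgue_on \<Omega>) (\<lambda>x. (u x, G x)) (\<lambda>x. (v x, H x))"
  using Lp2_inner_integrable[OF sobolev_pair_L2(1)[OF u] sobolev_pair_L2(1)[OF v]]
    Lp2_inner_integrable[OF sobolev_pair_L2(2)[OF u] sobolev_pair_L2(2)[OF v]]
  by (simp add: H1_inner_def L2_inner_eq dirichlet_form_eq[OF u v] L2_ip_def)

lemma H1_norm_eq:
  "sobolev_pair \<Omega> u G \<Longrightarrow> H1_norm \<Omega> u = L2_norm (lebesgue_on \<Omega>) (\<lambda>x. (u x, G x))"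
  by (simp add: H1_norm_def L2_norm_def H1_inner_eq)

lemma H1_norm_sq:
  assumes "sobolev_pair \<Omega> u G"
  shows "(H1_norm \<Omega> u)\<^sup>2 = (L2_norm (lebesgue_on \<Omega>) u)\<^sup>2 + (L2_norm (lebesgue_on \<Omega>) G)\<^sup>2"
  using Lp2_inner_integrable[OF sobolev_pair_L2(1)[OF assms] sobolev_pair_L2(1)[OF assms]]
    Lp2_inner_integrable[OF sobolev_pair_L2(2)[OF assms] sobolev_pair_L2(2)[OF assms]]
  by (simp add: H1_norm_eq[OF assms] L2_norm_sq L2_ip_def)

lemma H1_add: "u \<in> H1 \<Omega> \<Longrightarrow> v \<in> H1 \<Omega> \<Longrightarrow> (\<lambda>x. u x + v x) \<in> H1 \<Omega>"
  using sobolev_pair_add by (meson H1_iff)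

lemma H1_cmult: "u \<in> H1 \<Omega> \<Longrightarrow> (\<lambda>x. c * u x) \<in> H1 \<Omega>"
  using sobolev_pair_scale by (meson H1_iff)

lemma H1_diff: "u \<in> H1 \<Omega> \<Longrightarrow> v \<in> H1 \<Omega> \<Longrightarrow> (\<lambda>x. u x - v x) \<in> H1 \<Omega>"
  using sobolev_pair_diff by (meson H1_iff)

lemma H1_norm_triangle:
  assumes "u \<in> H1 \<Omega>" "v \<in> H1 \<Omega>"
  shows "H1_norm \<Omega> (\<lambda>x. u x + v x) \<le> H1_norm \<Omega> u + H1_norm \<Omega> v"
proof -
  obtain G K where p: "sobolev_pair \<Omega> u G" "sobolev_pair \<Omega> v K" using assms by (auto simp: H1_iff)
  have "L2_norm (lebesgue_on \<Omega>) (\<lambda>x. (u x, G x) + (v x, K x))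
     \<le> L2_norm (lebesgue_on \<Omega>) (\<lambda>x. (u x, G x)) + L2_norm (lebesgue_on \<Omega>) (\<lambda>x. (v x, K x))"
    by (intro L2_norm_triangle Lp2_Pair sobolev_pair_L2[OF p(1)] sobolev_pair_L2[OF p(2)])
  then show ?thesis
    using H1_norm_eq[OF p(1)] H1_norm_eq[OF p(2)] H1_norm_eq[OF sobolev_pair_add[OF p]]
    by simp
qed

lemma H1_norm_cmult:
  assumes "u \<in> H1 \<Omega>"
  shows "H1_norm \<Omega> (\<lambda>x. c * u x) = \<bar>c\<bar> * H1_norm \<Omega> u"
proof -
  obtain G where p: "sobolev_pair \<Omega> u G" using assms by (auto simp: H1_iff)
  show ?thesis
    using H1_norm_eq[OF p] H1_norm_eq[OF sobolev_pair_scale[OF p, of c]]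
      L2_norm_scaleR[of "lebesgue_on \<Omega>" c "\<lambda>x. (u x, G x)"] by simp
qed

lemma H1_norm_zero: "H1_norm \<Omega> (\<lambda>_. 0) = 0"
  using H1_norm_cmult[OF sobolev_pair_H1[OF sobolev_pair_zero], of 0] by simp

lemma H1_norm_cong_AE:
  assumes "u \<in> H1 \<Omega>" "v \<in> H1 \<Omega>" "AE x in lebesgue_on \<Omega>. u x = v x"
  shows "H1_norm \<Omega> u = H1_norm \<Omega> v"
proof -
  obtain G K where p: "sobolev_pair \<Omega> u G" "sobolev_pair \<Omega> v K" using assms(1,2) by (auto simp: H1_iff)
  have "AE x in lebesgue_on \<Omega>. (u x, G x) = (v x, K x)"
    using assms(3) weak_gradient_unique_AE[OF p assms(3)] by eventually_elim simp
  then show ?thesis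
    unfolding H1_norm_eq[OF p(1)] H1_norm_eq[OF p(2)]
    by (rule L2_norm_cong_AE) (intro Lp2_measurable Lp2_Pair sobolev_pair_L2[OF p(1)] sobolev_pair_L2[OF p(2)])+
qed

lemma H1_norm_diff_triangle:
  assumes "u \<in> H1 \<Omega>" "v \<in> H1 \<Omega>" "w \<in> H1 \<Omega>"
  shows "H1_norm \<Omega> (\<lambda>x. u x - w x) \<le> H1_norm \<Omega> (\<lambda>x. u x - v x) + H1_norm \<Omega> (\<lambda>x. v x - w x)"
  using H1_norm_triangle[OF H1_diff[OF assms(1,2)] H1_diff[OF assms(2,3)]] by simp

end

section \<open>Averages over one factor of a product measure\<close>

locale finite_pair = M1: finite_measure M1 + M2: finite_measure M2
  for M1 :: "'x measure" and M2 :: "'y measure"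
begin

sublocale pair_sigma_finite M1 M2 ..

lemma finite_product: "finite_measure (M1 \<Otimes>\<^sub>M M2)"
  by (rule finite_measure_pair_measure[OF M2.finite_measure_axioms M1.finite_measure_axioms])

text \<open>
  The integral of \<open>F(\<cdot>, y)\<close> against the fixed weight \<open>f\<close>. It is the adjoint of \<open>G \<mapsto> f \<otimes> G\<close>.
\<close>

definition avg :: "('x \<Rightarrow> real) \<Rightarrow> ('x \<times> 'y \<Rightarrow> 'c::euclidean_space) \<Rightarrow> 'y \<Rightarrow> 'c" where
  "avg f F y = (LINT x|M1. f x *\<^sub>R F (x, y))"

lemma Lp2_tensor:
  fixes f :: "'x \<Rightarrow> real" and G :: "'y \<Rightarrow> 'c::euclidean_space"
  assumes f: "f \<in> Lp 2 M1" and G: "G \<in> Lp 2 M2"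
  shows "(\<lambda>z. f (fst z) *\<^sub>R G (snd z)) \<in> Lp 2 (M1 \<Otimes>\<^sub>M M2)"
  unfolding Lp2_iff
proof
  have [measurable]: "f \<in> borel_measurable M1" "G \<in> borel_measurable M2" using f G by (auto simp: Lp2_iff)
  show "(\<lambda>z. f (fst z) *\<^sub>R G (snd z)) \<in> borel_measurable (M1 \<Otimes>\<^sub>M M2)" by measurable
  show "integrable (M1 \<Otimes>\<^sub>M M2) (\<lambda>z. (norm (f (fst z) *\<^sub>R G (snd z)))\<^sup>2)"
  proof (rule Fubini_integrable)
    show "integrable M1 (\<lambda>x. LINT y|M2. norm ((norm (f (fst (x, y)) *\<^sub>R G (snd (x, y))))\<^sup>2))"
      using f by (simp add: power_mult_distrib Lp2_iff)
    show "AE x in M1. integrable M2 (\<lambda>y. (norm (f (fst (x, y)) *\<^sub>R G (snd (x, y))))\<^sup>2)"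
      using G by (simp add: power_mult_distrib Lp2_iff)
  qed measurable
qed

lemma Lp2_fst: "f \<in> Lp 2 M1 \<Longrightarrow> (\<lambda>z. f (fst z)) \<in> Lp 2 (M1 \<Otimes>\<^sub>M M2)" for f :: "'x \<Rightarrow> real"
  using Lp2_tensor[of f "\<lambda>_. 1::real"] by (simp add: Lp2_iff)

lemma Lp2_AE_slice:
  fixes F :: "'x \<times> 'y \<Rightarrow> 'c::euclidean_space"
  assumes F: "F \<in> Lp 2 (M1 \<Otimes>\<^sub>M M2)"
  shows "AE y in M2. (\<lambda>x. F (x, y)) \<in> Lp 2 M1"
proof -
  have [measurable]: "F \<in> borel_measurable (M1 \<Otimes>\<^sub>M M2)" using F by (auto simp: Lp2_iff)
  have "AE y in M2. integrable M1 (\<lambda>x. (norm (F (x, y)))\<^sup>2)"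
    by (rule AE_integrable_snd) (use F in \<open>simp add: Lp2_iff case_prod_unfold\<close>)
  with AE_space show ?thesis
    by eventually_elim (auto simp: Lp2_iff)
qed

lemma avg_measurable:
  fixes F :: "'x \<times> 'y \<Rightarrow> 'c::euclidean_space"
  assumes "f \<in> Lp 2 M1" "F \<in> Lp 2 (M1 \<Otimes>\<^sub>M M2)"
  shows "avg f F \<in> borel_measurable M2"
proof -
  have [measurable]: "f \<in> borel_measurable M1" "F \<in> borel_measurable (M1 \<Otimes>\<^sub>M M2)"
    using assms by (auto simp: Lp2_iff)
  show ?thesis unfolding avg_def by measurable
qed

text \<open>
  Cauchy--Schwarz on almost every slice, followed by integration over the second variable.
\<close>

lemma avg_bound:
  fixes F :: "'x \<times> 'y \<Rightarrow> 'c::euclidean_space"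
  assumes f: "f \<in> Lp 2 M1" and F: "F \<in> Lp 2 (M1 \<Otimes>\<^sub>M M2)"
  shows "avg f F \<in> Lp 2 M2" "L2_norm M2 (avg f F) \<le> L2_norm M1 f * L2_norm (M1 \<Otimes>\<^sub>M M2) F"
proof -
  note m = avg_measurable[OF f F]
  have F2: "integrable (M1 \<Otimes>\<^sub>M M2) (case_prod (\<lambda>x y. (norm (F (x, y)))\<^sup>2))"
    using F by (simp add: Lp2_iff case_prod_unfold)
  have bd: "AE y in M2. (norm (avg f F y))\<^sup>2 \<le> (L2_norm M1 f)\<^sup>2 * (LINT x|M1. (norm (F (x, y)))\<^sup>2)"
    using Lp2_AE_slice[OF F]
  proof eventually_elim
    case (elim y)
    have n: "(\<lambda>x. norm (f x)) \<in> Lp 2 M1" "(\<lambda>x. norm (F (x, y))) \<in> Lp 2 M1"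
      using f elim by (auto simp: Lp2_iff)
    have "norm (avg f F y) \<le> (LINT x|M1. norm (f x *\<^sub>R F (x, y)))"
      unfolding avg_def by (rule integral_norm_bound)
    also have "\<dots> = L2_ip M1 (\<lambda>x. norm (f x)) (\<lambda>x. norm (F (x, y)))" by (simp add: L2_ip_def)
    also have "\<dots> \<le> L2_norm M1 (\<lambda>x. norm (f x)) * L2_norm M1 (\<lambda>x. norm (F (x, y)))"
      using L2_cauchy_schwarz[OF n] by linarith
    finally have "(norm (avg f F y))\<^sup>2 \<le> (L2_norm M1 (\<lambda>x. norm (f x)) * L2_norm M1 (\<lambda>x. norm (F (x, y))))\<^sup>2"
      by (intro power_mono) auto
    then show ?case by (simp add: power_mult_distrib L2_norm_sq_integral)
  qed
  have int: "integrable M2 (\<lambda>y. (L2_norm M1 f)\<^sup>2 * (LINT x|M1. (norm (F (x, y)))\<^sup>2))"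
    by (intro integrable_mult_right integrable_snd[OF F2])
  show L: "avg f F \<in> Lp 2 M2"
    unfolding Lp2_iff
  proof
    show "integrable M2 (\<lambda>y. (norm (avg f F y))\<^sup>2)"
      by (rule Bochner_Integration.integrable_bound[OF int]) (use m bd in \<open>auto elim: eventually_mono\<close>)
  qed (rule m)
  have "(L2_norm M2 (avg f F))\<^sup>2 \<le> (LINT y|M2. (L2_norm M1 f)\<^sup>2 * (LINT x|M1. (norm (F (x, y)))\<^sup>2))"
    unfolding L2_norm_sq_integral[of M2] by (rule integral_mono_AE[OF _ int bd]) (use L in \<open>simp add: Lp2_iff\<close>)
  also have "\<dots> = (L2_norm M1 f)\<^sup>2 * (L2_norm (M1 \<Otimes>\<^sub>M M2) F)\<^sup>2"
    using integral_snd[OF F2] by (simp add: L2_norm_sq_integral case_prod_unfold)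
  finally have "(L2_norm M2 (avg f F))\<^sup>2 \<le> (L2_norm M1 f * L2_norm (M1 \<Otimes>\<^sub>M M2) F)\<^sup>2"
    by (simp add: power_mult_distrib)
  then show "L2_norm M2 (avg f F) \<le> L2_norm M1 f * L2_norm (M1 \<Otimes>\<^sub>M M2) F"
    by (rule power2_le_imp_le) (simp add: L2_norm_nonneg)
qed

lemma avg_diff_AE:
  fixes F G :: "'x \<times> 'y \<Rightarrow> 'c::euclidean_space"
  assumes f: "f \<in> Lp 2 M1" and F: "F \<in> Lp 2 (M1 \<Otimes>\<^sub>M M2)" and G: "G \<in> Lp 2 (M1 \<Otimes>\<^sub>M M2)"
  shows "AE y in M2. avg f (\<lambda>z. F z - G z) y = avg f F y - avg f G y"
  using Lp2_AE_slice[OF F] Lp2_AE_slice[OF G]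
  by eventually_elim
    (simp add: avg_def scaleR_diff_right Lp2_scaleR_integrable[OF f])

text \<open>
  Fubini's theorem. The integrals on the two sides are those that appear when a function on the product is tested against
  a tensor product.
\<close>

lemma avg_adjoint:
  fixes F :: "'x \<times> 'y \<Rightarrow> 'c::euclidean_space"
  assumes f: "f \<in> Lp 2 M1" and F: "F \<in> Lp 2 (M1 \<Otimes>\<^sub>M M2)" and G: "G \<in> Lp 2 M2"
  shows "L2_ip M2 (avg f F) G = L2_ip (M1 \<Otimes>\<^sub>M M2) F (\<lambda>z. f (fst z) *\<^sub>R G (snd z))"
proof -
  have "integrable (M1 \<Otimes>\<^sub>M M2) (\<lambda>z. F z \<bullet> (f (fst z) *\<^sub>R G (snd z)))"
    by (rule Lp2_inner_integrable[OF F Lp2_tensor[OF f G]])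
  then have int: "integrable (M1 \<Otimes>\<^sub>M M2) (case_prod (\<lambda>x y. F (x, y) \<bullet> (f x *\<^sub>R G y)))"
    by (simp add: case_prod_unfold)
  have [measurable]: "f \<in> borel_measurable M1" "F \<in> borel_measurable (M1 \<Otimes>\<^sub>M M2)" "G \<in> borel_measurable M2"
    using assms by (auto simp: Lp2_iff)
  have [measurable]: "avg f F \<in> borel_measurable M2" by (rule avg_measurable[OF f F])
  have "L2_ip M2 (avg f F) G = (LINT y|M2. LINT x|M1. F (x, y) \<bullet> (f x *\<^sub>R G y))"
    unfolding L2_ip_def
  proof (rule integral_cong_AE)
    show "AE y in M2. avg f F y \<bullet> G y = (LINT x|M1. F (x, y) \<bullet> (f x *\<^sub>R G y))"
      using Lp2_AE_slice[OF F]
    proof eventually_elim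
      case (elim y)
      have "avg f F y \<bullet> G y = (LINT x|M1. (f x *\<^sub>R F (x, y)) \<bullet> G y)"
        unfolding avg_def by (rule integral_inner_left[symmetric]) (rule Lp2_scaleR_integrable[OF f elim])
      then show ?case by simp
    qed
  qed measurable
  also have "\<dots> = L2_ip (M1 \<Otimes>\<^sub>M M2) F (\<lambda>z. f (fst z) *\<^sub>R G (snd z))"
    unfolding integral_snd[OF int] by (simp add: L2_ip_def case_prod_unfold)
  finally show ?thesis .
qed

lemma avg_tensor:
  fixes G :: "'y \<Rightarrow> 'c::euclidean_space"
  assumes "f \<in> Lp 2 M1" "f' \<in> Lp 2 M1"
  shows "avg f (\<lambda>z. f' (fst z) *\<^sub>R G (snd z)) = (\<lambda>y. L2_ip M1 f f' *\<^sub>R G y)"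
proof -
  have "avg f (\<lambda>z. f' (fst z) *\<^sub>R G (snd z)) y = L2_ip M1 f f' *\<^sub>R G y" for y
  proof -
  have "avg f (\<lambda>z. f' (fst z) *\<^sub>R G (snd z)) y = (LINT x|M1. (f x * f' x) *\<^sub>R G y)"
    by (simp add: avg_def)
  also have "\<dots> = (LINT x|M1. f x * f' x) *\<^sub>R G y" by (rule integral_scaleR_left) (use assms in \<open>intro Lp2_times_integrable\<close>)
  finally show ?thesis by (simp add: L2_ip_def)
  qed
  then show ?thesis by blast
qed

lemma L2_ip_tensor:
  fixes G G' :: "'y \<Rightarrow> 'c::euclidean_space"
  assumes "f \<in> Lp 2 M1" "f' \<in> Lp 2 M1" "G \<in> Lp 2 M2" "G' \<in> Lp 2 M2"
  shows "L2_ip (M1 \<Otimes>\<^sub>M M2) (\<lambda>z. f (fst z) *\<^sub>R G (snd z)) (\<lambda>z. f' (fst z) *\<^sub>R G' (snd z))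
     = L2_ip M1 f f' * L2_ip M2 G G'"
proof -
  have "L2_ip (M1 \<Otimes>\<^sub>M M2) (\<lambda>z. f (fst z) *\<^sub>R G (snd z)) (\<lambda>z. f' (fst z) *\<^sub>R G' (snd z))
      = L2_ip M2 (avg f' (\<lambda>z. f (fst z) *\<^sub>R G (snd z))) G'"
    by (rule avg_adjoint[symmetric]) (use assms in \<open>auto intro: Lp2_tensor\<close>)
  also have "\<dots> = L2_ip M1 f f' * L2_ip M2 G G'"
    using assms by (simp add: avg_tensor L2_ip_scaleR_left L2_ip_commute)
  finally show ?thesis .
qed

lemma L2_norm_tensor:
  fixes G :: "'y \<Rightarrow> 'c::euclidean_space"
  assumes "f \<in> Lp 2 M1" "G \<in> Lp 2 M2"
  shows "L2_norm (M1 \<Otimes>\<^sub>M M2) (\<lambda>z. f (fst z) *\<^sub>R G (snd z)) = L2_norm M1 f * L2_norm M2 G"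
  using assms by (simp add: L2_norm_def L2_ip_tensor real_sqrt_mult)

lemma Lp2_swap:
  fixes F :: "'x \<times> 'y \<Rightarrow> 'c::euclidean_space"
  assumes "F \<in> Lp 2 (M1 \<Otimes>\<^sub>M M2)"
  shows "(\<lambda>z. F (prod.swap z)) \<in> Lp 2 (M2 \<Otimes>\<^sub>M M1)"
  unfolding Lp2_iff
proof
  have m: "F \<in> borel_measurable (M1 \<Otimes>\<^sub>M M2)" using assms by (auto simp: Lp2_iff)
  show "(\<lambda>z. F (prod.swap z)) \<in> borel_measurable (M2 \<Otimes>\<^sub>M M1)"
    using measurable_pair_swap[OF m] by (simp add: prod.swap_def case_prod_unfold)
  have "integrable (M2 \<Otimes>\<^sub>M M1) (\<lambda>(x,y). (norm (F (y, x)))\<^sup>2)"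
    using integrable_product_swap[of "\<lambda>z. (norm (F z))\<^sup>2"] assms by (simp add: Lp2_iff)
  then show "integrable (M2 \<Otimes>\<^sub>M M1) (\<lambda>z. (norm (F (prod.swap z)))\<^sup>2)"
    by (simp add: prod.swap_def case_prod_unfold)
qed

lemma LINT_swap:
  fixes F :: "'x \<times> 'y \<Rightarrow> 'c::euclidean_space"
  assumes m: "F \<in> borel_measurable (M1 \<Otimes>\<^sub>M M2)"
  shows "(LINT z|(M2 \<Otimes>\<^sub>M M1). F (prod.swap z)) = (LINT z|(M1 \<Otimes>\<^sub>M M2). F z)"
  using integral_product_swap[OF m] by (simp add: prod.swap_def case_prod_unfold)

end

section \<open>Lebesgue measure on a product of domains\<close>

lemma null_sets_lborel_vimage_fst:
  assumes "N \<in> null_sets (lborel :: 'a::euclidean_space measure)"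
  shows "fst -` N \<in> null_sets (lborel :: ('a \<times> 'b::euclidean_space) measure)"
proof -
  have "N \<times> (UNIV::'b set) \<in> null_sets (lborel \<Otimes>\<^sub>M lborel)"
    using assms by (rule lborel.times_in_null_sets1) simp
  then show ?thesis by (simp add: lborel_prod fst_vimage_eq_Times)
qed

lemma null_sets_lborel_vimage_snd:
  assumes "N \<in> null_sets (lborel :: 'b::euclidean_space measure)"
  shows "snd -` N \<in> null_sets (lborel :: ('a::euclidean_space \<times> 'b) measure)"
proof -
  have "(UNIV::'a set) \<times> N \<in> null_sets (lborel \<Otimes>\<^sub>M lborel)"
    by (rule lborel.times_in_null_sets2[OF _ assms]) simp
  then show ?thesis by (simp add: lborel_prod snd_vimage_eq_Times)
qed

text \<open>
  Lebesgue measurable sets differ from Borel sets by null sets, so that a Borel map that pulls null sets back to null sets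
  is measurable for the completed \<open>\<sigma>\<close>-algebras.
\<close>

lemma measurable_lebesgueI:
  fixes f :: "'a::euclidean_space \<Rightarrow> 'b::euclidean_space"
  assumes f: "f \<in> borel \<rightarrow>\<^sub>M borel"
    and null: "\<And>N. N \<in> null_sets lborel \<Longrightarrow> f -` N \<in> null_sets lborel"
  shows "f \<in> lebesgue \<rightarrow>\<^sub>M lebesgue"
proof (rule completion.measurable_completion2)
  show m: "f \<in> lebesgue \<rightarrow>\<^sub>M lborel"
    using f by (intro measurable_completion) simp
  show "null_sets lborel \<subseteq> null_sets (distr lebesgue lborel f)"
  proof
    fix N :: "'b set" assume N: "N \<in> null_sets lborel"
    then show "N \<in> null_sets (distr lebesgue lborel f)"
      using m null[OF N] by (auto simp: null_sets_def emeasure_distr)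
  qed
qed

lemma measurable_fst_lebesgue:
  "(fst :: 'a::euclidean_space \<times> 'b::euclidean_space \<Rightarrow> 'a) \<in> lebesgue \<rightarrow>\<^sub>M lebesgue"
  by (intro measurable_lebesgueI null_sets_lborel_vimage_fst borel_measurable_continuous_onI continuous_intros)

lemma measurable_snd_lebesgue:
  "(snd :: 'a::euclidean_space \<times> 'b::euclidean_space \<Rightarrow> 'b) \<in> lebesgue \<rightarrow>\<^sub>M lebesgue"
  by (intro measurable_lebesgueI null_sets_lborel_vimage_snd borel_measurable_continuous_onI continuous_intros)

lemma AE_lborel_fst:
  assumes "AE x in (lborel :: 'a::euclidean_space measure). P x"
  shows "AE z in (lborel :: ('a \<times> 'b::euclidean_space) measure). P (fst z)"
proof -
  obtain N where "N \<in> null_sets lborel" "{x. \<not> P x} \<subseteq> N"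
    using assms by (auto simp: eventually_ae_filter)
  then show ?thesis
    using AE_not_in[OF null_sets_lborel_vimage_fst[of N]] by (auto elim!: eventually_mono)
qed

lemma AE_lborel_snd:
  assumes "AE x in (lborel :: 'b::euclidean_space measure). P x"
  shows "AE z in (lborel :: ('a::euclidean_space \<times> 'b) measure). P (snd z)"
proof -
  obtain N where "N \<in> null_sets lborel" "{x. \<not> P x} \<subseteq> N"
    using assms by (auto simp: eventually_ae_filter)
  then show ?thesis
    using AE_not_in[OF null_sets_lborel_vimage_snd[of N]] by (auto elim!: eventually_mono)
qed

lemma AE_main_part:
  assumes "S \<in> sets (completion M)"
  shows "AE x in M. x \<in> S \<longleftrightarrow> x \<in> main_part M S"
  using AE_notin_null_part[OF assms] main_part_null_part_Un[OF assms]
  by (auto elim!: eventually_mono)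

lemma emeasure_lebesgue_Times:
  fixes X :: "'a::euclidean_space set" and Y :: "'b::euclidean_space set"
  assumes X: "X \<in> sets lebesgue" and Y: "Y \<in> sets lebesgue"
  shows "emeasure lebesgue (X \<times> Y) = emeasure lebesgue X * emeasure lebesgue Y"
proof -
  let ?X = "main_part lborel X" and ?Y = "main_part lborel Y"
  have Xm: "?X \<in> sets lborel" "?Y \<in> sets lborel"
    using main_part_sets[OF X] main_part_sets[OF Y] .
  have XY: "X \<times> Y = (fst -` X \<inter> space lebesgue) \<inter> (snd -` Y \<inter> space lebesgue)" by auto
  have s: "X \<times> Y \<in> sets lebesgue"
    unfolding XY using measurable_sets[OF measurable_fst_lebesgue X] measurable_sets[OF measurable_snd_lebesgue Y]
    by (rule sets.Int)
  have sm: "?X \<times> ?Y \<in> sets (lborel :: ('a \<times> 'b) measure)"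
    unfolding lborel_prod[symmetric] by (rule pair_measureI[OF Xm])
  have "AE z in (lborel :: ('a \<times> 'b) measure). z \<in> X \<times> Y \<longleftrightarrow> z \<in> ?X \<times> ?Y"
    using AE_lborel_fst[OF AE_main_part[OF X]] AE_lborel_snd[OF AE_main_part[OF Y]]
    by eventually_elim (auto simp: mem_Times_iff)
  then have "AE z in (lebesgue :: ('a \<times> 'b) measure). z \<in> X \<times> Y \<longleftrightarrow> z \<in> ?X \<times> ?Y"
    by (rule AE_completion)
  then have "emeasure lebesgue (X \<times> Y) = emeasure lebesgue (?X \<times> ?Y)"
    by (rule emeasure_eq_AE) (use s sm in auto)
  also have "\<dots> = emeasure (lborel \<Otimes>\<^sub>M lborel) (?X \<times> ?Y)" using sm by (simp add: lborel_prod)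
  also have "\<dots> = emeasure lborel ?X * emeasure lborel ?Y"
    using Xm by (rule lborel.emeasure_pair_measure_Times)
  also have "\<dots> = emeasure lebesgue X * emeasure lebesgue Y" using X Y by simp
  finally show ?thesis .
qed

lemma lebesgue_on_borel_representative:
  fixes f :: "'a::euclidean_space \<Rightarrow> real"
  assumes S: "S \<in> sets lebesgue" and f: "f \<in> borel_measurable (lebesgue_on S)"
  obtains g where "g \<in> borel_measurable borel" "AE x in lebesgue_on S. f x = g x"
proof -
  have "(\<lambda>x. indicator S x *\<^sub>R f x) \<in> borel_measurable lebesgue"
    using f S by (subst (asm) borel_measurable_restrict_space_iff) auto
  then obtain g where g: "g \<in> borel_measurable lborel" "AE x in lborel. indicator S x *\<^sub>R f x = g x"
    using completion_ex_borel_measurable_real by blast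
  have "AE x in lebesgue_on S. f x = g x"
    using AE_completion[OF g(2)] S by (subst AE_restrict_space_iff) (auto elim!: eventually_mono)
  then show thesis using g(1) that by simp
qed

locale domain_pair =
  fixes A :: "'a::euclidean_space set" and B :: "'b::euclidean_space set"
  assumes opA: "open A" and bdA: "bounded A" and opB: "open B" and bdB: "bounded B"
begin

abbreviation "LA \<equiv> lebesgue_on A"

abbreviation "LB \<equiv> lebesgue_on B"

abbreviation "LAB \<equiv> lebesgue_on (A \<times> B)"

abbreviation "PAB \<equiv> LA \<Otimes>\<^sub>M LB"

lemma opAB: "open (A \<times> B)" and bdAB: "bounded (A \<times> B)"
  by (simp_all add: opA opB bdA bdB open_Times bounded_Times)

sublocale finite_pair LA LB
  by (intro finite_pair.intro finite_measure_lebesgue_on_bounded opA bdA opB bdB)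

lemma measurable_fst_LAB: "fst \<in> LAB \<rightarrow>\<^sub>M LA"
  by (rule measurable_restrict_space3[OF measurable_fst_lebesgue]) auto

lemma measurable_snd_LAB: "snd \<in> LAB \<rightarrow>\<^sub>M LB"
  by (rule measurable_restrict_space3[OF measurable_snd_lebesgue]) auto

lemma measurable_id_LAB: "(\<lambda>z. z) \<in> LAB \<rightarrow>\<^sub>M PAB"
  using measurable_Pair[OF measurable_fst_LAB measurable_snd_LAB] by simp

text \<open>
  Lebesgue measure on \<open>A \<times> B\<close> is the completion of the product of the Lebesgue measures on the factors. The two agree on
  the product \<open>\<sigma>\<close>-algebra, and this is how Fubini's theorem becomes available on \<open>A \<times> B\<close>.
\<close>

lemma distr_LAB: "distr LAB PAB (\<lambda>z. z) = PAB"
proof (rule sym, rule pair_measure_eqI)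
  fix X Y assume X: "X \<in> sets LA" and Y: "Y \<in> sets LB"
  have sub: "X \<subseteq> A" "Y \<subseteq> B" "X \<in> sets lebesgue" "Y \<in> sets lebesgue"
    using X Y open_in_sets_lebesgue[OF opA] open_in_sets_lebesgue[OF opB]
    by (simp_all add: sets_restrict_space_iff)
  have XY: "X \<times> Y \<in> sets PAB" using X Y by simp
  have "emeasure (distr LAB PAB (\<lambda>z. z)) (X \<times> Y) = emeasure LAB (X \<times> Y)"
  proof (subst emeasure_distr[OF measurable_id_LAB XY])
    have "(\<lambda>z. z) -` (X \<times> Y) \<inter> space LAB = X \<times> Y" using sub(1,2) by auto
    then show "emeasure LAB ((\<lambda>z. z) -` (X \<times> Y) \<inter> space LAB) = emeasure LAB (X \<times> Y)" by simp
  qed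
  also have "\<dots> = emeasure lebesgue (X \<times> Y)"
    by (rule emeasure_restrict_space) (use sub(1,2) open_in_sets_lebesgue[OF opAB] in auto)
  also have "\<dots> = emeasure LA X * emeasure LB Y"
    using sub open_in_sets_lebesgue[OF opA] open_in_sets_lebesgue[OF opB]
    by (simp add: emeasure_lebesgue_Times emeasure_restrict_space)
  finally show "emeasure LA X * emeasure LB Y = emeasure (distr LAB PAB (\<lambda>z. z)) (X \<times> Y)" ..
qed (auto intro: M1.sigma_finite_measure_axioms M2.sigma_finite_measure_axioms)

context
  fixes F :: "'a \<times> 'b \<Rightarrow> 'c::euclidean_space"
  assumes F: "F \<in> borel_measurable PAB"

begin

lemma measurable_LAB: "F \<in> borel_measurable LAB"
  using measurable_compose[OF measurable_id_LAB F] .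

lemma LINT_LAB: "(LINT z|LAB. F z) = (LINT z|PAB. F z)"
  using integral_distr[OF measurable_id_LAB F] by (simp add: distr_LAB)

lemma integrable_LAB: "integrable LAB F \<longleftrightarrow> integrable PAB F"
  using integrable_distr_eq[OF measurable_id_LAB F] by (simp add: distr_LAB)

end

lemma Lp2_LAB: "F \<in> Lp 2 PAB \<Longrightarrow> F \<in> Lp 2 LAB" for F :: "'a \<times> 'b \<Rightarrow> 'c::euclidean_space"
proof -
  assume F: "F \<in> Lp 2 PAB"
  note m = Lp2_measurable[OF F]
  have "(\<lambda>z. (norm (F z))\<^sup>2) \<in> borel_measurable PAB" using m by measurable
  from integrable_LAB[OF this] show ?thesis
    using F measurable_LAB[OF m] by (simp add: Lp2_iff)
qed

lemma Lp2_PAB: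
  fixes F :: "'a \<times> 'b \<Rightarrow> 'c::euclidean_space"
  assumes "F \<in> Lp 2 LAB" and m: "F \<in> borel_measurable PAB"
  shows "F \<in> Lp 2 PAB"
proof -
  have "(\<lambda>z. (norm (F z))\<^sup>2) \<in> borel_measurable PAB" using m by measurable
  from integrable_LAB[OF this] show ?thesis using assms by (simp add: Lp2_iff)
qed

lemma L2_ip_LAB:
  fixes F G :: "'a \<times> 'b \<Rightarrow> 'c::euclidean_space"
  assumes "F \<in> Lp 2 PAB" "G \<in> Lp 2 PAB"
  shows "L2_ip LAB F G = L2_ip PAB F G"
  unfolding L2_ip_def
  by (rule LINT_LAB[OF borel_measurable_inner[OF Lp2_measurable[OF assms(1)] Lp2_measurable[OF assms(2)]]])

lemma L2_norm_LAB:
  fixes F :: "'a \<times> 'b \<Rightarrow> 'c::euclidean_space"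
  shows "F \<in> Lp 2 PAB \<Longrightarrow> L2_norm LAB F = L2_norm PAB F"
  by (simp add: L2_norm_def L2_ip_LAB)

lemma AE_zero_LAB:
  fixes F :: "'a \<times> 'b \<Rightarrow> 'c::euclidean_space"
  assumes F: "F \<in> Lp 2 PAB"
  shows "(AE z in LAB. F z = 0) \<longleftrightarrow> (AE z in PAB. F z = 0)"
  using L2_norm_eq_0_iff[OF F] L2_norm_eq_0_iff[OF Lp2_LAB[OF F]] L2_norm_LAB[OF F] by simp

lemma borel_measurable_pair:
  fixes g :: "'a \<times> 'b \<Rightarrow> 'c::topological_space"
  assumes "g \<in> borel_measurable borel"
  shows "g \<in> borel_measurable PAB"
proof -
  have "(\<lambda>x. x) \<in> LA \<rightarrow>\<^sub>M borel" "(\<lambda>x. x) \<in> LB \<rightarrow>\<^sub>M borel"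
    by (auto intro: borel_measurable_lebesgue_onI)
  then have "(\<lambda>z. (fst z, snd z)) \<in> PAB \<rightarrow>\<^sub>M borel \<Otimes>\<^sub>M borel"
    by (intro measurable_Pair) (auto intro: measurable_compose[OF measurable_fst] measurable_compose[OF measurable_snd])
  then have "(\<lambda>z. z) \<in> PAB \<rightarrow>\<^sub>M borel" by (simp add: borel_prod)
  from measurable_compose[OF this assms] show ?thesis by simp
qed

lemma LAB_representative_real:
  fixes F :: "'a \<times> 'b \<Rightarrow> real"
  assumes "F \<in> Lp 2 LAB"
  obtains F' where "F' \<in> borel_measurable PAB" "AE z in LAB. F z = F' z"
proof -
  have "F \<in> borel_measurable LAB" using assms by (auto simp: Lp2_iff)
  then obtain g where "g \<in> borel_measurable borel" "AE z in LAB. F z = g z"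
    using lebesgue_on_borel_representative[OF open_in_sets_lebesgue[OF opAB]] by metis
  then show thesis using that[OF borel_measurable_pair] by blast
qed

text \<open>
  A function on \<open>A \<times> B\<close> that is Lebesgue measurable need not be measurable for the product \<open>\<sigma>\<close>-algebra, and its slices may
  fail to be measurable on a null set. Passing to a Borel representative removes the difficulty.
\<close>

lemma LAB_representative:
  fixes F :: "'a \<times> 'b \<Rightarrow> 'c::euclidean_space"
  assumes F: "F \<in> Lp 2 LAB"
  obtains F' where "F' \<in> Lp 2 PAB" "AE z in LAB. F z = F' z"
proof -
  have "\<forall>i. \<exists>F'. F' \<in> borel_measurable PAB \<and> (AE z in LAB. F z \<bullet> i = F' z)"
  proof
    fix i
    show "\<exists>F'. F' \<in> borel_measurable PAB \<and> (AE z in LAB. F z \<bullet> i = F' z)"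
      by (rule LAB_representative_real[OF Lp2_inner_const[OF F, of i]]) (rule exI, rule conjI)
  qed
  from choice[OF this] obtain R
    where R': "\<forall>i. R i \<in> borel_measurable PAB \<and> (AE z in LAB. F z \<bullet> i = R i z)" ..
  have R: "R i \<in> borel_measurable PAB" "AE z in LAB. F z \<bullet> i = R i z" for i
    by (rule R'[rule_format, THEN conjunct1], rule R'[rule_format, THEN conjunct2])
  define F' where "F' z = (\<Sum>i\<in>Basis. R i z *\<^sub>R i)" for z
  have m: "F' \<in> borel_measurable PAB"
    unfolding F'_def using R(1) by measurable
  have "AE z in LAB. \<forall>i\<in>Basis. F z \<bullet> i = R i z"
    by (rule AE_ball_countable'[OF R(2)]) (simp add: countable_finite)
  then have ae: "AE z in LAB. F z = F' z"
  proof eventually_elim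
    case (elim z)
    have "F' z = (\<Sum>i\<in>Basis. (F z \<bullet> i) *\<^sub>R i)"
      unfolding F'_def using elim by (intro sum.cong refl) simp
    then show ?case by (simp only: euclidean_representation)
  qed
  have "F' \<in> Lp 2 LAB" by (rule Lp2_AE_cong[OF F ae measurable_LAB[OF m]])
  then have "F' \<in> Lp 2 PAB"
  proof -
    have "(\<lambda>z. (norm (F' z))\<^sup>2) \<in> borel_measurable PAB" using m by measurable
    from integrable_LAB[OF this] show ?thesis
      using \<open>F' \<in> Lp 2 LAB\<close> m by (simp add: Lp2_iff)
  qed
  then show thesis using ae by (rule that)
qed

lemma sobolev_representative:
  assumes "h \<in> H1 (A \<times> B)"
  obtains h' H where "sobolev_pair (A \<times> B) h' H" "sobolev_pair (A \<times> B) h H"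
    "h' \<in> Lp 2 PAB" "H \<in> Lp 2 PAB" "AE z in LAB. h z = h' z"
proof -
  obtain G where p: "sobolev_pair (A \<times> B) h G" using assms H1_iff by blast
  note L = sobolev_pair_L2[OF p]
  obtain h' where h': "h' \<in> Lp 2 PAB" "AE z in LAB. h z = h' z" by (rule LAB_representative[OF L(1)])
  obtain H where H: "H \<in> Lp 2 PAB" "AE z in LAB. G z = H z" by (rule LAB_representative[OF L(2)])
  note m = Lp2_measurable[OF Lp2_LAB[OF h'(1)]] Lp2_measurable[OF Lp2_LAB[OF H(1)]]
  have "sobolev_pair (A \<times> B) h' H"
    by (rule sobolev_pair_AE_cong[OF opAB bdAB p h'(2) H(2) m])
  moreover have "sobolev_pair (A \<times> B) h H"
    by (rule sobolev_pair_AE_cong[OF opAB bdAB p _ H(2) Lp2_measurable[OF L(1)] m(2)]) simp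
  ultimately show thesis using h' H by (intro that)
qed

lemma test_pair_Lp2: "\<Phi> \<in> test_functions X \<Longrightarrow> \<Phi> \<in> Lp 2 PAB"
proof -
  assume \<Phi>: "\<Phi> \<in> test_functions X"
  obtain C where "\<And>z. \<bar>\<Phi> z\<bar> \<le> C" using test_functions_bounded[OF \<Phi>] by blast
  then show ?thesis
    using Lp2_bounded[OF finite_product
       borel_measurable_pair[OF test_functions_measurable[OF \<Phi>]], of C]
    by simp
qed

end

lemma domain_pair_swap: "domain_pair A B \<Longrightarrow> domain_pair B A"
  by (simp add: domain_pair_def)

section \<open>Sobolev functions on a product of domains\<close>

context domain_pair
begin

lemma sobolev_pair_PAB:
  assumes p: "sobolev_pair (A \<times> B) h G" and m: "h \<in> Lp 2 PAB" "G \<in> Lp 2 PAB"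
    and \<Phi>: "\<Phi> \<in> test_functions (A \<times> B)" and k: "k \<in> Basis"
  shows "(LINT z|PAB. h z * frechet_derivative \<Phi> (at z) k) = - (LINT z|PAB. (G z \<bullet> k) * \<Phi> z)"
proof -
  note t = test_pair_Lp2[OF \<Phi>] test_pair_Lp2[OF test_functions_partial[OF \<Phi> k]]
  have "(LINT z|PAB. h z * frechet_derivative \<Phi> (at z) k) = (LINT z|LAB. h z * frechet_derivative \<Phi> (at z) k)"
    by (rule LINT_LAB[symmetric]) (intro borel_measurable_times Lp2_measurable m t)
  moreover have "(LINT z|PAB. (G z \<bullet> k) * \<Phi> z) = (LINT z|LAB. (G z \<bullet> k) * \<Phi> z)"
    by (rule LINT_LAB[symmetric]) (intro borel_measurable_times Lp2_measurable Lp2_inner_const m t)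
  ultimately show ?thesis using sobolev_pairD[OF p \<Phi> k] by simp
qed

text \<open>
  Averages are better behaved than restrictions to slices: testing \<open>h\<close> with \<open>\<phi> \<otimes> \<psi>\<close> for all \<open>\<phi>\<close> and using the fundamental
  lemma on \<open>A\<close>, the identity that defines the weak gradient in the second variables holds after integration over \<open>B\<close>, for
  almost every point of \<open>A\<close>. It can then be integrated against an arbitrary \<open>L\<^sup>2\<close> weight \<open>f\<close>.
\<close>

lemma avg_sobolev_pair:
  assumes p: "sobolev_pair (A \<times> B) h G" and m: "h \<in> Lp 2 PAB" "G \<in> Lp 2 PAB" and f: "f \<in> Lp 2 LA"
  shows "sobolev_pair B (avg f h) (avg f (\<lambda>z. snd (G z)))"
proof (rule sobolev_pairI)
  note G2 = Lp2_snd_comp[OF m(2)]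
  show "avg f h \<in> Lp 2 LB" "avg f (\<lambda>z. snd (G z)) \<in> Lp 2 LB"
    using avg_bound(1)[OF f m(1)] avg_bound(1)[OF f G2] .
  fix \<psi> and j :: 'b assume \<psi>: "\<psi> \<in> test_functions B" and j: "j \<in> Basis"
  let ?d = "\<lambda>y. frechet_derivative \<psi> (at y) j"
  have k: "(0, j) \<in> (Basis :: ('a \<times> 'b) set)" using j by (simp add: Basis_prod_def)
  note d\<psi> = test_functions_partial[OF \<psi> j]
  note L\<psi> = test_functions_Lp2[OF opB bdB \<psi>] and Ld = test_functions_Lp2[OF opB bdB d\<psi>]
  have L\<psi>j: "(\<lambda>y. \<psi> y *\<^sub>R j) \<in> Lp 2 LB"
    by (rule Lp2_bound[OF L\<psi>, where C=1]) (use Lp2_measurable[OF L\<psi>] j in auto)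
  obtain C where C: "\<And>y. \<bar>\<psi> y\<bar> \<le> C" using test_functions_bounded[OF \<psi>] by blast
  obtain C' where C': "\<And>y. \<bar>?d y\<bar> \<le> C'" using test_functions_bounded[OF d\<psi>] by blast
  \<comment> \<open>The weak gradient is correct if the integral of \<open>W\<close> against \<open>f\<close> vanishes for every weight \<open>f\<close>; the test functions show
    this for \<open>f = \<phi>\<close>, hence \<open>D = 0\<close>.\<close>
  let ?W1 = "\<lambda>z. h z * ?d (snd z)" and ?W2 = "\<lambda>z. (snd (G z) \<bullet> j) * \<psi> (snd z)"
  let ?W = "\<lambda>z. ?W1 z + ?W2 z"
  have W1: "?W1 \<in> Lp 2 PAB"
    by (rule Lp2_mult_bounded[OF m(1) _ C']) (rule measurable_compose[OF measurable_snd Lp2_measurable[OF Ld]])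
  have W2: "?W2 \<in> Lp 2 PAB"
    by (rule Lp2_mult_bounded[OF Lp2_inner_const[OF G2] _ C])
      (rule measurable_compose[OF measurable_snd Lp2_measurable[OF L\<psi>]])
  have W: "?W \<in> Lp 2 PAB" by (rule Lp2_add[OF W1 W2])
  let ?D = "\<lambda>x. LINT y|LB. ?W (x, y)"
  have fub: "(LINT x|LA. ?D x * q x) = (LINT z|PAB. ?W z * q (fst z))" if "q \<in> Lp 2 LA" for q
    using integral_fst'[OF Lp2_times_integrable[OF W Lp2_fst[OF that]]] by simp
  have "AE x in LA. ?D x = 0"
  proof (rule fundamental_lemma[OF opA])
    show "integrable LA ?D" by (rule integrable_fst'[OF Lp2_integrable[OF finite_product W]])
    fix \<phi> assume \<phi>: "\<phi> \<in> test_functions A"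
    note t = test_functions_tensor[OF \<phi> \<psi>]
    note L\<phi> = Lp2_fst[OF test_functions_Lp2[OF opA bdA \<phi>]]
    have "(LINT x|LA. ?D x * \<phi> x) = (LINT z|PAB. ?W z * \<phi> (fst z))"
      by (rule fub[OF test_functions_Lp2[OF opA bdA \<phi>]])
    also have "\<dots> = (LINT z|PAB. ?W1 z * \<phi> (fst z)) + (LINT z|PAB. ?W2 z * \<phi> (fst z))"
      unfolding distrib_right
      by (rule Bochner_Integration.integral_add) (intro Lp2_times_integrable W1 W2 L\<phi>)+
    also have "(LINT z|PAB. ?W1 z * \<phi> (fst z))
        = (LINT z|PAB. h z * frechet_derivative (\<lambda>z. \<phi> (fst z) * \<psi> (snd z)) (at z) (0, j))"
      by (simp add: t(2) mult_ac)
    also have "\<dots> = - (LINT z|PAB. (G z \<bullet> (0, j)) * (\<phi> (fst z) * \<psi> (snd z)))"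
      by (rule sobolev_pair_PAB[OF p m t(1) k])
    also have "(LINT z|PAB. (G z \<bullet> (0, j)) * (\<phi> (fst z) * \<psi> (snd z))) = (LINT z|PAB. ?W2 z * \<phi> (fst z))"
      by (simp add: inner_prod_def mult_ac)
    finally show "(LINT x|LA. ?D x * \<phi> x) = 0" by simp
  qed
  then have "(LINT x|LA. ?D x * f x) = 0"
    by (intro integral_eq_zero_AE) (auto elim!: eventually_mono)
  then have "(LINT z|PAB. ?W z * f (fst z)) = 0" using fub[OF f] by simp
  also have "(LINT z|PAB. ?W z * f (fst z)) = (LINT z|PAB. ?W1 z * f (fst z)) + (LINT z|PAB. ?W2 z * f (fst z))"
    unfolding distrib_right
    by (rule Bochner_Integration.integral_add) (intro Lp2_times_integrable W1 W2 Lp2_fst[OF f])+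
  finally have sum: "(LINT z|PAB. ?W1 z * f (fst z)) + (LINT z|PAB. ?W2 z * f (fst z)) = 0" .
  have "(LINT z|PAB. ?W1 z * f (fst z)) = L2_ip PAB h (\<lambda>z. f (fst z) *\<^sub>R ?d (snd z))"
    by (simp add: L2_ip_def mult_ac)
  also have "\<dots> = (LINT y|LB. avg f h y * ?d y)"
    using avg_adjoint[OF f m(1) Ld] by (simp add: L2_ip_def)
  finally have e1: "(LINT z|PAB. ?W1 z * f (fst z)) = (LINT y|LB. avg f h y * ?d y)" .
  have "(LINT z|PAB. ?W2 z * f (fst z)) = L2_ip PAB (\<lambda>z. snd (G z)) (\<lambda>z. f (fst z) *\<^sub>R (\<psi> (snd z) *\<^sub>R j))"
    by (simp add: L2_ip_def mult_ac)
  also have "\<dots> = (LINT y|LB. (avg f (\<lambda>z. snd (G z)) y \<bullet> j) * \<psi> y)"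
    using avg_adjoint[OF f G2 L\<psi>j] by (simp add: L2_ip_def mult.commute)
  finally have e2: "(LINT z|PAB. ?W2 z * f (fst z)) = (LINT y|LB. (avg f (\<lambda>z. snd (G z)) y \<bullet> j) * \<psi> y)" .
  show "(LINT y|LB. avg f h y * ?d y) = - (LINT y|LB. (avg f (\<lambda>z. snd (G z)) y \<bullet> j) * \<psi> y)"
    using sum unfolding e1 e2 by simp
qed

end

context domain_pair
begin

interpretation sw: domain_pair B A by (rule domain_pair_swap) (rule domain_pair_axioms)

text \<open>
  The exchange of the factors gives the results for averages over the second factor.
\<close>

lemma sobolev_pair_swap:
  assumes p: "sobolev_pair (A \<times> B) h G" and m: "h \<in> Lp 2 PAB" "G \<in> Lp 2 PAB"
  shows "sobolev_pair (B \<times> A) (\<lambda>z. h (prod.swap z)) (\<lambda>z. prod.swap (G (prod.swap z)))"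
proof (rule sobolev_pairI)
  have h': "(\<lambda>z. h (prod.swap z)) \<in> Lp 2 sw.PAB" by (rule Lp2_swap[OF m(1)])
  have "(\<lambda>z. prod.swap (G z)) \<in> Lp 2 PAB"
    unfolding prod.swap_def by (intro Lp2_Pair Lp2_fst_comp Lp2_snd_comp m)
  then have G': "(\<lambda>z. prod.swap (G (prod.swap z))) \<in> Lp 2 sw.PAB" by (rule Lp2_swap)
  show "(\<lambda>z. h (prod.swap z)) \<in> Lp 2 sw.LAB" "(\<lambda>z. prod.swap (G (prod.swap z))) \<in> Lp 2 sw.LAB"
    using sw.Lp2_LAB[OF h'] sw.Lp2_LAB[OF G'] .
  fix \<Phi> and k :: "'b \<times> 'a" assume \<Phi>: "\<Phi> \<in> test_functions (B \<times> A)" and k: "k \<in> Basis"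
  let ?\<Psi> = "\<lambda>z. \<Phi> (prod.swap z)"
  have k': "prod.swap k \<in> Basis" using k by (auto simp: Basis_prod_def)
  note \<Psi> = test_functions_swap[OF \<Phi>]
  note d\<Phi> = test_functions_partial[OF \<Phi> k]
  have "(LINT z|sw.LAB. h (prod.swap z) * frechet_derivative \<Phi> (at z) k)
      = (LINT z|sw.PAB. h (prod.swap z) * frechet_derivative \<Phi> (at z) k)"
    by (rule sw.LINT_LAB) (intro borel_measurable_times Lp2_measurable h' sw.test_pair_Lp2[OF d\<Phi>])
  also have "\<dots> = (LINT z|sw.PAB. h (prod.swap z) * frechet_derivative ?\<Psi> (at (prod.swap z)) (prod.swap k))"
    unfolding \<Psi>(2) by simp
  also have "\<dots> = (LINT z|PAB. h z * frechet_derivative ?\<Psi> (at z) (prod.swap k))"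
    by (rule LINT_swap[where F="\<lambda>z. h z * frechet_derivative ?\<Psi> (at z) (prod.swap k)"])
      (intro borel_measurable_times Lp2_measurable m test_pair_Lp2[OF test_functions_partial[OF \<Psi>(1) k']])
  also have "\<dots> = - (LINT z|PAB. (G z \<bullet> prod.swap k) * ?\<Psi> z)"
    by (rule sobolev_pair_PAB[OF p m \<Psi>(1) k'])
  also have "(LINT z|PAB. (G z \<bullet> prod.swap k) * ?\<Psi> z)
      = (LINT z|sw.PAB. (G (prod.swap z) \<bullet> prod.swap k) * ?\<Psi> (prod.swap z))"
    by (rule LINT_swap[where F="\<lambda>z. (G z \<bullet> prod.swap k) * ?\<Psi> z", symmetric])
      (intro borel_measurable_times Lp2_measurable Lp2_inner_const m test_pair_Lp2[OF \<Psi>(1)])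
  also have "\<dots> = (LINT z|sw.PAB. (prod.swap (G (prod.swap z)) \<bullet> k) * \<Phi> z)"
    by (simp add: inner_prod_def add.commute)
  also have "\<dots> = (LINT z|sw.LAB. (prod.swap (G (prod.swap z)) \<bullet> k) * \<Phi> z)"
    by (rule sw.LINT_LAB[symmetric])
      (intro borel_measurable_times Lp2_measurable Lp2_inner_const G' sw.test_pair_Lp2[OF \<Phi>])
  finally show "(LINT z|sw.LAB. h (prod.swap z) * frechet_derivative \<Phi> (at z) k)
     = - (LINT z|sw.LAB. (prod.swap (G (prod.swap z)) \<bullet> k) * \<Phi> z)" .
qed

definition avg_snd :: "('b \<Rightarrow> real) \<Rightarrow> ('a \<times> 'b \<Rightarrow> 'c::euclidean_space) \<Rightarrow> 'a \<Rightarrow> 'c" where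
  "avg_snd g F = sw.avg g (\<lambda>z. F (prod.swap z))"

lemma avg_snd_sobolev_pair:
  assumes p: "sobolev_pair (A \<times> B) h G" and m: "h \<in> Lp 2 PAB" "G \<in> Lp 2 PAB" and g: "g \<in> Lp 2 LB"
  shows "sobolev_pair A (avg_snd g h) (avg_snd g (\<lambda>z. fst (G z)))"
proof -
  have "(\<lambda>z. prod.swap (G z)) \<in> Lp 2 PAB"
    unfolding prod.swap_def by (intro Lp2_Pair Lp2_fst_comp Lp2_snd_comp m)
  from sw.avg_sobolev_pair[OF sobolev_pair_swap[OF p m] Lp2_swap[OF m(1)] Lp2_swap[OF this] g]
  show ?thesis by (simp add: avg_snd_def)
qed

lemma avg_snd_adjoint:
  fixes F :: "'a \<times> 'b \<Rightarrow> 'c::euclidean_space"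
  assumes g: "g \<in> Lp 2 LB" and F: "F \<in> Lp 2 PAB" and G: "G \<in> Lp 2 LA"
  shows "L2_ip LA (avg_snd g F) G = L2_ip PAB F (\<lambda>z. g (snd z) *\<^sub>R G (fst z))"
proof -
  have m: "(\<lambda>z. F z \<bullet> (g (snd z) *\<^sub>R G (fst z))) \<in> borel_measurable PAB"
    using Lp2_measurable[OF F] Lp2_measurable[OF g] Lp2_measurable[OF G] by measurable
  have "L2_ip LA (avg_snd g F) G = L2_ip sw.PAB (\<lambda>z. F (prod.swap z)) (\<lambda>z. g (fst z) *\<^sub>R G (snd z))"
    unfolding avg_snd_def by (rule sw.avg_adjoint[OF g Lp2_swap[OF F] G])
  also have "\<dots> = L2_ip PAB F (\<lambda>z. g (snd z) *\<^sub>R G (fst z))"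
    using LINT_swap[OF m] by (simp add: L2_ip_def)
  finally show ?thesis .
qed

lemma Lp2_tensor_swap:
  fixes F :: "'a \<Rightarrow> 'c::euclidean_space"
  assumes "g \<in> Lp 2 LB" "F \<in> Lp 2 LA"
  shows "(\<lambda>z. g (snd z) *\<^sub>R F (fst z)) \<in> Lp 2 PAB"
  using sw.Lp2_swap[OF sw.Lp2_tensor[OF assms]] by simp

lemma tensor_sobolev_L2:
  assumes p: "sobolev_pair A f F" and q: "sobolev_pair B g G"
  shows "(\<lambda>z. f (fst z) * g (snd z)) \<in> Lp 2 PAB"
    "(\<lambda>z. (g (snd z) *\<^sub>R F (fst z), f (fst z) *\<^sub>R G (snd z))) \<in> Lp 2 PAB"
  using Lp2_tensor[OF sobolev_pair_L2(1)[OF p] sobolev_pair_L2(1)[OF q]]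
    Lp2_Pair[OF Lp2_tensor_swap[OF sobolev_pair_L2(1)[OF q] sobolev_pair_L2(2)[OF p]]
       Lp2_tensor[OF sobolev_pair_L2(1)[OF p] sobolev_pair_L2(2)[OF q]]]
  by simp_all

text \<open>
  For a coordinate direction of one factor, the identity on that factor is applied to the slices of the test function and
  integrated over the other factor.
\<close>

lemma sobolev_pair_tensor:
  assumes p: "sobolev_pair A f F" and q: "sobolev_pair B g G"
  shows "sobolev_pair (A \<times> B) (\<lambda>z. f (fst z) * g (snd z))
     (\<lambda>z. (g (snd z) *\<^sub>R F (fst z), f (fst z) *\<^sub>R G (snd z)))"
proof (rule sobolev_pairI)
  let ?u = "\<lambda>z. f (fst z) * g (snd z)"
  let ?U = "\<lambda>z. (g (snd z) *\<^sub>R F (fst z), f (fst z) *\<^sub>R G (snd z))"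
  note L = tensor_sobolev_L2[OF p q]
  note Lf = sobolev_pair_L2[OF p] and Lg = sobolev_pair_L2[OF q]
  show "?u \<in> Lp 2 LAB" "?U \<in> Lp 2 LAB" using Lp2_LAB[OF L(1)] Lp2_LAB[OF L(2)] .
  fix \<Phi> and k :: "'a \<times> 'b" assume \<Phi>: "\<Phi> \<in> test_functions (A \<times> B)" and k: "k \<in> Basis"
  note d\<Phi> = test_functions_partial[OF \<Phi> k]
  note int1 = Lp2_times_integrable[OF L(1) test_pair_Lp2[OF d\<Phi>]]
  note int2 = Lp2_times_integrable[OF Lp2_inner_const[OF L(2), of k] test_pair_Lp2[OF \<Phi>]]
  have "(LINT z|PAB. ?u z * frechet_derivative \<Phi> (at z) k) = - (LINT z|PAB. (?U z \<bullet> k) * \<Phi> z)"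
  proof -
    consider (A) i where "i \<in> Basis" "k = (i, 0)" | (B) j where "j \<in> Basis" "k = (0, j)"
      using k by (auto simp: Basis_prod_def)
    then show ?thesis
    proof cases
      case (A i)
      have int1': "integrable PAB (case_prod (\<lambda>x y. ?u (x, y) * frechet_derivative \<Phi> (at (x, y)) k))"
        and int2': "integrable PAB (case_prod (\<lambda>x y. (?U (x, y) \<bullet> k) * \<Phi> (x, y)))"
        using int1 int2 by (simp_all add: case_prod_unfold)
      have "(LINT z|PAB. ?u z * frechet_derivative \<Phi> (at z) k)
          = (LINT y|LB. LINT x|LA. ?u (x, y) * frechet_derivative \<Phi> (at (x, y)) k)"
        using integral_snd[OF int1'] by (simp add: case_prod_unfold)
      also have "\<dots> = (LINT y|LB. g y * (LINT x|LA. f x * frechet_derivative (\<lambda>x. \<Phi> (x, y)) (at x) i))"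
        unfolding test_functions_slice_fst(2)[OF \<Phi>] by (simp add: A mult_ac flip: integral_mult_right_zero)
      also have "\<dots> = (LINT y|LB. g y * - (LINT x|LA. (F x \<bullet> i) * \<Phi> (x, y)))"
        unfolding sobolev_pairD[OF p test_functions_slice_fst(1)[OF \<Phi>] A(1)] ..
      also have "\<dots> = - (LINT y|LB. LINT x|LA. (?U (x, y) \<bullet> k) * \<Phi> (x, y))"
        by (simp add: A inner_prod_def mult_ac flip: integral_mult_right_zero)
      also have "\<dots> = - (LINT z|PAB. (?U z \<bullet> k) * \<Phi> z)"
        using integral_snd[OF int2'] by (simp add: case_prod_unfold)
      finally show ?thesis .
    next
      case (B j)
      have "(LINT z|PAB. ?u z * frechet_derivative \<Phi> (at z) k)
          = (LINT x|LA. LINT y|LB. ?u (x, y) * frechet_derivative \<Phi> (at (x, y)) k)"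
        using integral_fst'[OF int1] by simp
      also have "\<dots> = (LINT x|LA. f x * (LINT y|LB. g y * frechet_derivative (\<lambda>y. \<Phi> (x, y)) (at y) j))"
        unfolding test_functions_slice_snd(2)[OF \<Phi>] by (simp add: B mult_ac flip: integral_mult_right_zero)
      also have "\<dots> = (LINT x|LA. f x * - (LINT y|LB. (G y \<bullet> j) * \<Phi> (x, y)))"
        unfolding sobolev_pairD[OF q test_functions_slice_snd(1)[OF \<Phi>] B(1)] ..
      also have "\<dots> = - (LINT x|LA. LINT y|LB. (?U (x, y) \<bullet> k) * \<Phi> (x, y))"
        by (simp add: B inner_prod_def mult_ac flip: integral_mult_right_zero)
      also have "\<dots> = - (LINT z|PAB. (?U z \<bullet> k) * \<Phi> z)"
        using integral_fst'[OF int2] by simp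
      finally show ?thesis .
    qed
  qed
  then show "(LINT z|LAB. ?u z * frechet_derivative \<Phi> (at z) k) = - (LINT z|LAB. (?U z \<bullet> k) * \<Phi> z)"
    using LINT_LAB[OF borel_measurable_integrable[OF int1]] LINT_LAB[OF borel_measurable_integrable[OF int2]]
    by simp
qed

text \<open>
  The gradient of \<open>f \<otimes> g\<close> is \<open>(g \<nabla>f, f \<nabla>g)\<close>; by adjointness, each component pairs with \<open>\<nabla>h\<close> as a Dirichlet form on one
  factor.
\<close>

lemma tensor_dirichlet_form:
  assumes p: "sobolev_pair A f F" and q: "sobolev_pair B g G"
    and h: "sobolev_pair (A \<times> B) h H" and m: "h \<in> Lp 2 PAB" "H \<in> Lp 2 PAB"
  shows "dirichlet_form (A \<times> B) (\<lambda>z. f (fst z) * g (snd z)) h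
    = dirichlet_form A f (avg_snd g h) + dirichlet_form B g (avg f h)"
proof -
  note Lf = sobolev_pair_L2[OF p] and Lg = sobolev_pair_L2[OF q]
  note H1 = Lp2_fst_comp[OF m(2)] and H2 = Lp2_snd_comp[OF m(2)]
  note T1 = Lp2_tensor_swap[OF Lg(1) Lf(2)] and T2 = Lp2_tensor[OF Lf(1) Lg(2)]
  let ?U = "\<lambda>z. (g (snd z) *\<^sub>R F (fst z), f (fst z) *\<^sub>R G (snd z))"
  have "dirichlet_form (A \<times> B) (\<lambda>z. f (fst z) * g (snd z)) h = L2_ip LAB ?U H"
    by (rule dirichlet_form_eq[OF opAB bdAB sobolev_pair_tensor[OF p q] h])
  also have "\<dots> = L2_ip PAB ?U H" by (rule L2_ip_LAB[OF tensor_sobolev_L2(2)[OF p q] m(2)])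
  also have "\<dots> = L2_ip PAB (\<lambda>z. fst (H z)) (\<lambda>z. g (snd z) *\<^sub>R F (fst z))
      + L2_ip PAB (\<lambda>z. snd (H z)) (\<lambda>z. f (fst z) *\<^sub>R G (snd z))"
    using Lp2_inner_integrable[OF H1 T1] Lp2_inner_integrable[OF H2 T2]
    by (simp add: L2_ip_def inner_prod_def inner_commute)
  also have "\<dots> = L2_ip LA (avg_snd g (\<lambda>z. fst (H z))) F + L2_ip LB (avg f (\<lambda>z. snd (H z))) G"
    by (simp add: avg_snd_adjoint[OF Lg(1) H1 Lf(2)] avg_adjoint[OF Lf(1) H2 Lg(2)])
  also have "L2_ip LA (avg_snd g (\<lambda>z. fst (H z))) F = dirichlet_form A f (avg_snd g h)"
    by (simp add: dirichlet_form_eq[OF opA bdA p avg_snd_sobolev_pair[OF h m Lg(1)]] L2_ip_commute)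
  also have "L2_ip LB (avg f (\<lambda>z. snd (H z))) G = dirichlet_form B g (avg f h)"
    by (simp add: dirichlet_form_eq[OF opB bdB q avg_sobolev_pair[OF h m Lf(1)]] L2_ip_commute)
  finally show ?thesis .
qed

lemma tensor_L2_inner:
  assumes f: "f \<in> Lp 2 LA" and g: "g \<in> Lp 2 LB" and h: "h \<in> Lp 2 PAB"
  shows "L2_inner (A \<times> B) (\<lambda>z. f (fst z) * g (snd z)) h = L2_inner B g (avg f h)"
    "L2_inner (A \<times> B) (\<lambda>z. f (fst z) * g (snd z)) h = L2_inner A f (avg_snd g h)"
proof -
  have *: "L2_inner (A \<times> B) (\<lambda>z. f (fst z) * g (snd z)) h = L2_ip PAB h (\<lambda>z. f (fst z) * g (snd z))"
    using L2_ip_LAB[of "\<lambda>z. f (fst z) * g (snd z)" h] Lp2_tensor[OF f g] h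
    by (simp add: L2_inner_def L2_ip_def mult.commute)
  show "L2_inner (A \<times> B) (\<lambda>z. f (fst z) * g (snd z)) h = L2_inner B g (avg f h)"
    using * avg_adjoint[OF f h g] by (simp add: L2_inner_def L2_ip_def mult.commute)
  show "L2_inner (A \<times> B) (\<lambda>z. f (fst z) * g (snd z)) h = L2_inner A f (avg_snd g h)"
    using * avg_snd_adjoint[OF g h f] by (simp add: L2_inner_def L2_ip_def mult_ac)
qed

text \<open>
  If \<open>f\<close> is a Neumann solution, the term on \<open>A\<close> in \<open>tensor_dirichlet_form\<close> is known: average \<open>h\<close> against \<open>g\<close> and use the result as
  a test function on \<open>A\<close>.
\<close>

lemma tensor_neumann_identity:
  assumes neu: "neumann_solution A \<mu> f" and q: "sobolev_pair B g G"
    and h: "sobolev_pair (A \<times> B) h H" and m: "h \<in> Lp 2 PAB" "H \<in> Lp 2 PAB"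
  shows "dirichlet_form (A \<times> B) (\<lambda>z. f (fst z) * g (snd z)) h
    = \<mu> * L2_inner (A \<times> B) (\<lambda>z. f (fst z) * g (snd z)) h + dirichlet_form B g (avg f h)"
proof -
  have p: "sobolev_pair A f (wgrad A f)" using neu by (auto simp: neumann_solution_def intro: sobolev_pair_wgrad)
  note Lf = sobolev_pair_L2[OF p] and Lg = sobolev_pair_L2[OF q]
  have "avg_snd g h \<in> H1 A"
    by (rule sobolev_pair_H1[OF avg_snd_sobolev_pair[OF h m Lg(1)]])
  then show ?thesis
    using neu tensor_dirichlet_form[OF p q h m] tensor_L2_inner(2)[OF Lf(1) Lg(1) m(1)]
    by (simp add: neumann_solution_def)
qed

lemma avg_H1_norm_le:
  assumes p: "sobolev_pair (A \<times> B) w W" and m: "w \<in> Lp 2 PAB" "W \<in> Lp 2 PAB" and f: "f \<in> Lp 2 LA"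
  shows "H1_norm B (avg f w) \<le> L2_norm LA f * H1_norm (A \<times> B) w"
proof (rule power2_le_imp_le)
  note W2 = Lp2_snd_comp[OF m(2)]
  have "(H1_norm B (avg f w))\<^sup>2 = (L2_norm LB (avg f w))\<^sup>2 + (L2_norm LB (avg f (\<lambda>z. snd (W z))))\<^sup>2"
    by (rule H1_norm_sq[OF opB bdB avg_sobolev_pair[OF p m f]])
  also have "\<dots> \<le> (L2_norm LA f * L2_norm PAB w)\<^sup>2 + (L2_norm LA f * L2_norm PAB W)\<^sup>2"
  proof (intro add_mono power_mono L2_norm_nonneg avg_bound(2)[OF f m(1)])
    have "L2_norm LB (avg f (\<lambda>z. snd (W z))) \<le> L2_norm LA f * L2_norm PAB (\<lambda>z. snd (W z))"
      by (rule avg_bound(2)[OF f W2])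
    also have "\<dots> \<le> L2_norm LA f * L2_norm PAB W"
      by (intro mult_left_mono L2_norm_snd_le m L2_norm_nonneg)
    finally show "L2_norm LB (avg f (\<lambda>z. snd (W z))) \<le> L2_norm LA f * L2_norm PAB W" .
  qed
  also have "\<dots> = (L2_norm LA f * H1_norm (A \<times> B) w)\<^sup>2"
    by (simp add: power_mult_distrib H1_norm_sq[OF opAB bdAB p] L2_norm_LAB m distrib_left)
  finally show "(H1_norm B (avg f w))\<^sup>2 \<le> (L2_norm LA f * H1_norm (A \<times> B) w)\<^sup>2" .
qed (simp add: L2_norm_nonneg H1_norm_nonneg)

lemma avg_diff_H1_norm_le:
  assumes p: "sobolev_pair (A \<times> B) v V" and mv: "v \<in> Lp 2 PAB" "V \<in> Lp 2 PAB"
    and q: "sobolev_pair (A \<times> B) w W" and mw: "w \<in> Lp 2 PAB" "W \<in> Lp 2 PAB" and f: "f \<in> Lp 2 LA"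
  shows "H1_norm B (\<lambda>y. avg f v y - avg f w y) \<le> L2_norm LA f * H1_norm (A \<times> B) (\<lambda>z. v z - w z)"
proof -
  note d = sobolev_pair_diff[OF opAB bdAB p q] Lp2_diff[OF mv(1) mw(1)] Lp2_diff[OF mv(2) mw(2)]
  have "H1_norm B (\<lambda>y. avg f v y - avg f w y) = H1_norm B (avg f (\<lambda>z. v z - w z))"
  proof (rule H1_norm_cong_AE[OF opB bdB])
    show "(\<lambda>y. avg f v y - avg f w y) \<in> H1 B"
      by (intro H1_diff opB bdB sobolev_pair_H1[OF avg_sobolev_pair[OF p mv f]]
          sobolev_pair_H1[OF avg_sobolev_pair[OF q mw f]])
    show "avg f (\<lambda>z. v z - w z) \<in> H1 B" by (rule sobolev_pair_H1[OF avg_sobolev_pair[OF d f]])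
    show "AE y in LB. avg f v y - avg f w y = avg f (\<lambda>z. v z - w z) y"
      using avg_diff_AE[OF f mv(1) mw(1)] by eventually_elim simp
  qed
  also have "\<dots> \<le> L2_norm LA f * H1_norm (A \<times> B) (\<lambda>z. v z - w z)"
    by (rule avg_H1_norm_le[OF d f])
  finally show ?thesis .
qed

lemma tensor_H1_norm_le:
  assumes p: "sobolev_pair A u U" and q: "sobolev_pair B v V"
  shows "H1_norm (A \<times> B) (\<lambda>z. u (fst z) * v (snd z)) \<le> H1_norm A u * H1_norm B v"
proof (rule power2_le_imp_le)
  note Lu = sobolev_pair_L2[OF p] and Lv = sobolev_pair_L2[OF q]
  interpret sw: domain_pair B A by (rule domain_pair_swap) (rule domain_pair_axioms)
  let ?a = "(L2_norm LA u)\<^sup>2" and ?a' = "(L2_norm LA U)\<^sup>2"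
  let ?b = "(L2_norm LB v)\<^sup>2" and ?b' = "(L2_norm LB V)\<^sup>2"
  let ?G = "\<lambda>z. (v (snd z) *\<^sub>R U (fst z), u (fst z) *\<^sub>R V (snd z))"
  have uv: "(L2_norm PAB (\<lambda>z. u (fst z) * v (snd z)))\<^sup>2 = ?a * ?b"
    using L2_norm_tensor[OF Lu(1) Lv(1)] by (simp add: power_mult_distrib)
  have t1: "L2_ip PAB (\<lambda>z. v (snd z) *\<^sub>R U (fst z)) (\<lambda>z. v (snd z) *\<^sub>R U (fst z)) = ?b * ?a'"
  proof -
    have "L2_ip LA (avg_snd v (\<lambda>z. v (snd z) *\<^sub>R U (fst z))) U
       = L2_ip PAB (\<lambda>z. v (snd z) *\<^sub>R U (fst z)) (\<lambda>z. v (snd z) *\<^sub>R U (fst z))"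
      by (rule avg_snd_adjoint[OF Lv(1) Lp2_tensor_swap[OF Lv(1) Lu(2)] Lu(2)])
    moreover have "avg_snd v (\<lambda>z. v (snd z) *\<^sub>R U (fst z)) = (\<lambda>x. ?b *\<^sub>R U x)"
      unfolding avg_snd_def using sw.avg_tensor[OF Lv(1) Lv(1), of U] by (simp add: L2_norm_sq)
    ultimately show ?thesis by (simp add: L2_ip_scaleR_left L2_norm_sq)
  qed
  have t2: "L2_ip PAB (\<lambda>z. u (fst z) *\<^sub>R V (snd z)) (\<lambda>z. u (fst z) *\<^sub>R V (snd z)) = ?a * ?b'"
    using L2_ip_tensor[OF Lu(1) Lu(1) Lv(2) Lv(2)] by (simp add: L2_norm_sq)
  have "L2_ip PAB ?G ?G = L2_ip PAB (\<lambda>z. v (snd z) *\<^sub>R U (fst z)) (\<lambda>z. v (snd z) *\<^sub>R U (fst z))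
      + L2_ip PAB (\<lambda>z. u (fst z) *\<^sub>R V (snd z)) (\<lambda>z. u (fst z) *\<^sub>R V (snd z))"
    unfolding L2_ip_def inner_prod_def fst_conv snd_conv
    by (intro Bochner_Integration.integral_add Lp2_inner_integrable Lp2_tensor_swap Lp2_tensor Lu Lv)
  then have "(L2_norm PAB ?G)\<^sup>2 = ?b * ?a' + ?a * ?b'"
    by (simp only: L2_norm_sq[of PAB ?G] t1 t2)
  then have "(H1_norm (A \<times> B) (\<lambda>z. u (fst z) * v (snd z)))\<^sup>2 = ?a * ?b + (?b * ?a' + ?a * ?b')"
    using H1_norm_sq[OF opAB bdAB sobolev_pair_tensor[OF p q]] tensor_sobolev_L2[OF p q] uv
    by (simp add: L2_norm_LAB)
  also have "\<dots> \<le> (?a + ?a') * (?b + ?b')" by (simp add: algebra_simps)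
  also have "\<dots> = (H1_norm A u * H1_norm B v)\<^sup>2"
    by (simp add: power_mult_distrib H1_norm_sq[OF opA bdA p] H1_norm_sq[OF opB bdB q])
  finally show "(H1_norm (A \<times> B) (\<lambda>z. u (fst z) * v (snd z)))\<^sup>2 \<le> (H1_norm A u * H1_norm B v)\<^sup>2" .
qed (simp add: H1_norm_nonneg)

end

section \<open>Completeness of the Neumann eigenfunctions\<close>

locale neumann_basis =
  fixes A :: "'a::euclidean_space set" and lam :: "nat \<Rightarrow> real" and f :: "nat \<Rightarrow> 'a \<Rightarrow> real"
  assumes opA: "open A" and bdA: "bounded A" and data: "neumann_eigendata A lam f"
begin

lemma neumann: "1 \<le> j \<Longrightarrow> neumann_solution A (lam j) (f j)"
  and lam_nonneg: "1 \<le> j \<Longrightarrow> 0 \<le> lam j"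
  using data by (auto simp: neumann_eigendata_def)

lemma orthonormal_H1: "1 \<le> i \<Longrightarrow> 1 \<le> j \<Longrightarrow> H1_inner A (f i) (f j) = (if i = j then 1 else 0)"
  using data by (simp add: neumann_eigendata_def)

lemma maximal: "v \<in> H1 A \<Longrightarrow> (\<And>j. 1 \<le> j \<Longrightarrow> H1_inner A v (f j) = 0) \<Longrightarrow> ae_zero A v"
  using data by (simp add: neumann_eigendata_def)

lemma pair_f: "1 \<le> j \<Longrightarrow> sobolev_pair A (f j) (wgrad A (f j))"
  using neumann by (auto simp: neumann_solution_def intro: sobolev_pair_wgrad)

lemma f_L2: "1 \<le> j \<Longrightarrow> f j \<in> Lp 2 (lebesgue_on A)"
  using sobolev_pair_L2(1)[OF pair_f] .

text \<open>
  For a Neumann solution the \<open>H\<^sup>1\<close> inner product with any function is \<open>1 + \<lambda>\<close> times the \<open>L\<^sup>2\<close> inner product.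
\<close>

lemma orthogonal_L2:
  assumes "1 \<le> i" "1 \<le> j"
  shows "L2_ip (lebesgue_on A) (f i) (f j) = (if i = j then 1 / (1 + lam j) else 0)"
proof -
  have "f j \<in> H1 A" using pair_f[OF assms(2)] by (rule sobolev_pair_H1)
  then have "H1_inner A (f i) (f j) = (1 + lam i) * L2_ip (lebesgue_on A) (f i) (f j)"
    using neumann[OF assms(1)] by (simp add: neumann_solution_def H1_inner_def L2_inner_def L2_ip_def algebra_simps)
  moreover have "1 + lam i \<noteq> 0" using lam_nonneg[OF assms(1)] by simp
  ultimately have "L2_ip (lebesgue_on A) (f i) (f j) = H1_inner A (f i) (f j) / (1 + lam i)"
    by simp
  then show ?thesis using orthonormal_H1[OF assms] by simp
qed

text \<open>
  Maximality is a statement about \<open>H\<^sup>1\<close>; it yields that a test function \<open>\<phi>\<close> equals its Fourier series in \<open>H\<^sup>1\<close>, because the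
  remainder is orthogonal to all eigenfunctions. In particular the series converges in \<open>L\<^sup>2\<close>, so \<open>w\<close> is orthogonal to
  \<open>\<phi>\<close>, and the fundamental lemma applies.
\<close>

lemma complete_L2:
  assumes w: "w \<in> Lp 2 (lebesgue_on A)" and orth: "\<And>j. 1 \<le> j \<Longrightarrow> L2_ip (lebesgue_on A) w (f j) = 0"
  shows "AE x in lebesgue_on A. w x = 0"
proof (rule fundamental_lemma[OF opA])
  let ?L = "lebesgue_on A"
  show "integrable ?L w" by (rule Lp2_integrable[OF finite_measure_lebesgue_on_bounded[OF opA bdA] w])
  fix \<phi> assume \<phi>: "\<phi> \<in> test_functions A"
  define G where "G = (\<lambda>x. \<Sum>i\<in>Basis. frechet_derivative \<phi> (at x) i *\<^sub>R i)"
  have p\<phi>: "sobolev_pair A \<phi> G" unfolding G_def by (rule sobolev_pair_test_function[OF opA bdA \<phi>])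
  note L\<phi> = sobolev_pair_L2[OF p\<phi>]
  define F where "F = (\<lambda>x. (\<phi> x, G x))"
  \<comment> \<open>The isometric images of the eigenfunctions; \<open>c\<close> are the Fourier coefficients of \<open>\<phi>\<close>.\<close>
  define E where "E j = (\<lambda>x. (f (Suc j) x, wgrad A (f (Suc j)) x))" for j
  define c where "c j = L2_ip ?L F (E j)" for j
  define e where "e j = (\<lambda>x. c j *\<^sub>R E j x)" for j
  have pf: "sobolev_pair A (f (Suc j)) (wgrad A (f (Suc j)))" for j by (rule pair_f) simp
  have F: "F \<in> Lp 2 ?L" unfolding F_def by (rule Lp2_Pair[OF L\<phi>])
  have E: "E j \<in> Lp 2 ?L" for j unfolding E_def by (rule Lp2_Pair[OF sobolev_pair_L2[OF pf]])
  have e: "e j \<in> Lp 2 ?L" for j unfolding e_def by (rule Lp2_scaleR[OF E])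
  have EE: "L2_ip ?L (E i) (E j) = (if i = j then 1 else 0)" for i j
    using orthonormal_H1[of "Suc i" "Suc j"] H1_inner_eq[OF opA bdA pf pf, of i j] by (simp add: E_def)
  have ip_e: "L2_ip ?L X (e j) = c j * L2_ip ?L X (E j)" for X j
    unfolding e_def by (subst L2_ip_commute) (simp add: L2_ip_scaleR_left L2_ip_commute)
  have eE: "L2_ip ?L (e i) (E j) = (if i = j then c j else 0)" for i j
    unfolding e_def by (simp add: L2_ip_scaleR_left EE)
  have summ: "summable (\<lambda>j. (L2_norm ?L (e j))\<^sup>2)"
  proof (rule L2_bessel[OF e F])
    show "L2_ip ?L (e i) (e j) = 0" if "i \<noteq> j" for i j using that by (simp add: ip_e eE)
    show "L2_ip ?L F (e j) = L2_ip ?L (e j) (e j)" for j by (simp add: ip_e eE c_def)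
  qed
  obtain g where g: "g \<in> Lp 2 ?L" "(\<lambda>n. L2_norm ?L (\<lambda>x. (\<Sum>i<n. e i x) - g x)) \<longlonglongrightarrow> 0"
    by (rule L2_orthogonal_series_converges[OF e _ summ]) (simp_all add: ip_e eE)
  define u where "u n = (\<lambda>x. \<Sum>i<n. c i * f (Suc i) x)" for n
  define U where "U n = (\<lambda>x. \<Sum>i<n. c i *\<^sub>R wgrad A (f (Suc i)) x)" for n
  have pu: "sobolev_pair A (u n) (U n)" for n
    unfolding u_def U_def by (intro sobolev_pair_sum sobolev_pair_scale opA bdA pf)
  have sum_eq: "(\<Sum>i<n. e i x) = (u n x, U n x)" for n x
    by (simp add: e_def E_def u_def U_def sum_prod)
  note lim = sobolev_pair_limit[OF opA bdA pu g(1) g(2)[unfolded sum_eq]]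
  have pv: "sobolev_pair A (\<lambda>x. \<phi> x - fst (g x)) (\<lambda>x. G x - snd (g x))"
    by (rule sobolev_pair_diff[OF opA bdA p\<phi> lim(1)])
  have "ae_zero A (\<lambda>x. \<phi> x - fst (g x))"
  proof (rule maximal)
    show "(\<lambda>x. \<phi> x - fst (g x)) \<in> H1 A" by (rule sobolev_pair_H1[OF pv])
    fix j :: nat assume "1 \<le> j"
    then obtain i where j: "j = Suc i" by (cases j) auto
    have "(\<lambda>n. L2_ip ?L (\<lambda>x. \<Sum>i<n. e i x) (E i)) \<longlonglongrightarrow> L2_ip ?L g (E i)"
      by (rule L2_ip_tendsto[OF Lp2_sum[OF e] g(1) E g(2)])
    moreover have "\<forall>\<^sub>F n in sequentially. L2_ip ?L (\<lambda>x. \<Sum>i<n. e i x) (E i) = c i"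
      using eventually_gt_at_top[of i]
      by eventually_elim (simp add: L2_ip_sum_left[OF e E] eE)
    ultimately have gE: "L2_ip ?L g (E i) = c i"
      using tendsto_eventually LIMSEQ_unique by metis
    have "H1_inner A (\<lambda>x. \<phi> x - fst (g x)) (f j) = L2_ip ?L (\<lambda>x. F x - g x) (E i)"
      using H1_inner_eq[OF opA bdA pv pf, of i] by (simp add: j E_def F_def minus_prod_def)
    also have "\<dots> = 0" by (simp add: L2_ip_diff_left[OF F g(1) E] gE c_def)
    finally show "H1_inner A (\<lambda>x. \<phi> x - fst (g x)) (f j) = 0" .
  qed
  then have ae: "AE x in ?L. \<phi> x = fst (g x)" by (auto simp: ae_zero_def)
  have "(\<lambda>n. L2_ip ?L (u n) w) \<longlonglongrightarrow> L2_ip ?L (\<lambda>x. fst (g x)) w"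
    by (rule L2_ip_tendsto[OF sobolev_pair_L2(1)[OF pu] Lp2_fst_comp[OF g(1)] w lim(2)])
  moreover have "L2_ip ?L (u n) w = 0" for n
  proof -
    have "L2_ip ?L (u n) w = (\<Sum>i<n. L2_ip ?L (\<lambda>x. c i * f (Suc i) x) w)"
      unfolding u_def by (rule L2_ip_sum_left[OF Lp2_cmult[OF f_L2] w]) simp
    also have "\<dots> = (\<Sum>i<n. c i * L2_ip ?L (f (Suc i)) w)"
      using L2_ip_scaleR_left[of ?L _ "f (Suc _)" w] by simp
    also have "\<dots> = 0" using orth L2_ip_commute[of ?L w] by (intro sum.neutral) simp
    finally show ?thesis .
  qed
  ultimately have "L2_ip ?L (\<lambda>x. fst (g x)) w = 0" by (simp add: LIMSEQ_const_iff)
  moreover have "L2_ip ?L \<phi> w = L2_ip ?L (\<lambda>x. fst (g x)) w"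
    by (rule L2_ip_cong_AE[OF ae]) (use Lp2_measurable[OF L\<phi>(1)] Lp2_measurable[OF w] Lp2_measurable[OF Lp2_fst_comp[OF g(1)]] in auto)
  ultimately show "(LINT x|?L. w x * \<phi> x) = 0" by (simp add: L2_ip_def mult.commute)
qed

text \<open>
  Completeness, applied on almost every slice. The second factor is arbitrary: it will be the other domain as well as its boundary.
\<close>

lemma L2_zero_if_avgs_zero:
  fixes D :: "'a \<times> 'y \<Rightarrow> real"
  assumes fp: "finite_pair (lebesgue_on A) N"
    and D: "D \<in> Lp 2 (lebesgue_on A \<Otimes>\<^sub>M N)"
    and zero: "\<And>j. 1 \<le> j \<Longrightarrow> AE y in N. finite_pair.avg (lebesgue_on A) (f j) D y = 0"
  shows "L2_norm (lebesgue_on A \<Otimes>\<^sub>M N) D = 0"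
proof -
  interpret finite_pair "lebesgue_on A" N by fact
  let ?L = "lebesgue_on A"
  have "AE y in N. \<forall>j\<in>{1..}. avg (f j) D y = 0"
    by (rule AE_ball_countable') (auto intro: zero)
  with Lp2_AE_slice[OF D] have ae: "AE y in N. (LINT x|?L. (D (x, y))\<^sup>2) = 0"
  proof eventually_elim
    case (elim y)
    have "AE x in ?L. D (x, y) = 0"
    proof (rule complete_L2[OF elim(1)])
      fix j :: nat assume "1 \<le> j"
      then have "avg (f j) D y = 0" using elim(2) by simp
      then show "L2_ip ?L (\<lambda>x. D (x, y)) (f j) = 0" by (simp add: avg_def L2_ip_def mult.commute)
    qed
    then show ?case by (intro integral_eq_zero_AE) (auto elim!: eventually_mono)
  qed
  have "integrable (?L \<Otimes>\<^sub>M N) (case_prod (\<lambda>x y. (D (x, y))\<^sup>2))"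
    using D by (simp add: Lp2_iff case_prod_unfold)
  from integral_snd[OF this]
  have "(L2_norm (?L \<Otimes>\<^sub>M N) D)\<^sup>2 = (LINT y|N. LINT x|?L. (D (x, y))\<^sup>2)"
    by (simp add: L2_norm_sq_integral case_prod_unfold)
  also have "\<dots> = 0" by (rule integral_eq_zero_AE[OF ae])
  finally show ?thesis by simp
qed

end

section \<open>Expansion of a Sobolev function on the product\<close>

locale neumann_pair = domain_pair A B + neumann_basis A lam f
  for A :: "'a::euclidean_space set" and B :: "'b::euclidean_space set" and lam f
begin

definition coeff :: "('a \<times> 'b \<Rightarrow> real) \<Rightarrow> nat \<Rightarrow> 'b \<Rightarrow> real" where
  "coeff h j = avg (f (Suc j)) h"

text \<open>
  The factor \<open>1 + \<lambda>\<close> is the inverse of the squared \<open>L\<^sup>2\<close> norm of the eigenfunction, which has norm \<open>1\<close> in \<open>H\<^sup>1\<close>. Thus \<open>mode h j\<close>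
  is the orthogonal projection of \<open>h\<close> onto the functions of the form \<open>f \<otimes> g\<close>, \<open>f\<close> being the eigenfunction. Indices are
  shifted, as eigenfunctions are numbered from \<open>1\<close>.
\<close>

definition mode :: "('a \<times> 'b \<Rightarrow> real) \<Rightarrow> nat \<Rightarrow> 'a \<times> 'b \<Rightarrow> real" where
  "mode h j z = f (Suc j) (fst z) * ((1 + lam (Suc j)) * coeff h j (snd z))"

text \<open>
  The inner product of \<open>H\<^sup>1(A \<times> B)\<close> with \<open>f \<otimes> g\<close> sees of \<open>h\<close> only its average against \<open>f\<close>. Orthogonality of different modes
  and the projection property both follow from this formula.
\<close>

lemma tensor_H1_inner:
  assumes q: "sobolev_pair B g G" and h: "sobolev_pair (A \<times> B) h H" and m: "h \<in> Lp 2 PAB" "H \<in> Lp 2 PAB"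
  shows "H1_inner (A \<times> B) (\<lambda>z. f (Suc j) (fst z) * g (snd z)) h
    = (1 + lam (Suc j)) * L2_inner B g (coeff h j) + dirichlet_form B g (coeff h j)"
  using tensor_neumann_identity[OF neumann[of "Suc j"] q h m] tensor_L2_inner(1)[OF f_L2[of "Suc j"] sobolev_pair_L2(1)[OF q] m(1)]
  by (simp add: H1_inner_def coeff_def algebra_simps)

context
  fixes h :: "'a \<times> 'b \<Rightarrow> real" and H :: "'a \<times> 'b \<Rightarrow> 'a \<times> 'b"
  assumes p: "sobolev_pair (A \<times> B) h H" and m: "h \<in> Lp 2 PAB" "H \<in> Lp 2 PAB"

begin

lemma pair_coeff: "sobolev_pair B (coeff h j) (avg (f (Suc j)) (\<lambda>z. snd (H z)))"
  unfolding coeff_def by (rule avg_sobolev_pair[OF p m f_L2]) simp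

lemma pair_scaled_coeff: "sobolev_pair B (\<lambda>y. (1 + lam (Suc j)) * coeff h j y)
    (\<lambda>y. (1 + lam (Suc j)) *\<^sub>R avg (f (Suc j)) (\<lambda>z. snd (H z)) y)"
  by (rule sobolev_pair_scale[OF opB bdB pair_coeff])

definition mode_grad :: "nat \<Rightarrow> 'a \<times> 'b \<Rightarrow> 'a \<times> 'b" where
  "mode_grad j z = (((1 + lam (Suc j)) * coeff h j (snd z)) *\<^sub>R wgrad A (f (Suc j)) (fst z),
     f (Suc j) (fst z) *\<^sub>R ((1 + lam (Suc j)) *\<^sub>R avg (f (Suc j)) (\<lambda>z. snd (H z)) (snd z)))"

lemma pair_mode: "sobolev_pair (A \<times> B) (mode h j) (mode_grad j)"
  unfolding mode_def[abs_def] mode_grad_def[abs_def]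
  by (rule sobolev_pair_tensor[OF pair_f pair_scaled_coeff]) simp

lemma mode_L2: "mode h j \<in> Lp 2 PAB" "mode_grad j \<in> Lp 2 PAB"
  unfolding mode_def[abs_def] mode_grad_def[abs_def]
  using tensor_sobolev_L2[OF pair_f pair_scaled_coeff, of "Suc j" j] by simp_all

text \<open>
  The common value of the squared \<open>H\<^sup>1\<close> norm of \<open>mode h j\<close> and its inner product with \<open>h\<close>.
\<close>

definition energy :: "nat \<Rightarrow> real" where
  "energy j = (1 + lam (Suc j)) * ((1 + lam (Suc j)) * L2_inner B (coeff h j) (coeff h j)
      + dirichlet_form B (coeff h j) (coeff h j))"

lemma mode_inner_h: "H1_inner (A \<times> B) (mode h j) h = energy j"
proof -
  let ?u = "\<lambda>y. (1 + lam (Suc j)) * coeff h j y"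
  have "H1_inner (A \<times> B) (mode h j) h
      = (1 + lam (Suc j)) * L2_inner B ?u (coeff h j) + dirichlet_form B ?u (coeff h j)"
    unfolding mode_def[abs_def] by (rule tensor_H1_inner[OF pair_scaled_coeff p m])
  then show ?thesis
    unfolding L2_inner_scale dirichlet_form_scale[OF opB bdB pair_coeff pair_coeff] energy_def
    by (simp only: distrib_left)
qed

lemma coeff_mode: "coeff (mode h i) j = (if i = j then coeff h i else (\<lambda>_. 0))"
proof -
  have "coeff (mode h i) j = (\<lambda>y. L2_ip LA (f (Suc j)) (f (Suc i)) *\<^sub>R ((1 + lam (Suc i)) * coeff h i y))"
    using avg_tensor[OF f_L2[of "Suc j"] f_L2[of "Suc i"], of "\<lambda>y. (1 + lam (Suc i)) * coeff h i y"]
    by (simp add: coeff_def mode_def[abs_def])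
  then show ?thesis
    using lam_nonneg[of "Suc i"] by (auto simp: orthogonal_L2)
qed

lemma mode_inner_mode: "H1_inner (A \<times> B) (mode h j) (mode h i) = (if i = j then energy j else 0)"
proof -
  let ?u = "\<lambda>y. (1 + lam (Suc j)) * coeff h j y"
  have *: "H1_inner (A \<times> B) (mode h j) (mode h i)
      = (1 + lam (Suc j)) * L2_inner B ?u (coeff (mode h i) j) + dirichlet_form B ?u (coeff (mode h i) j)"
  proof -
    have "mode h j = (\<lambda>z. f (Suc j) (fst z) * ?u (snd z))" by (simp add: fun_eq_iff mode_def)
    then show ?thesis using tensor_H1_inner[OF pair_scaled_coeff pair_mode mode_L2] by simp
  qed
  show ?thesis
  proof (cases "i = j")
    case True
    then show ?thesis
      unfolding * L2_inner_scale coeff_mode energy_def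
      by (simp only: dirichlet_form_scale[OF opB bdB pair_coeff pair_coeff] distrib_left simp_thms if_True)
  next
    case False
    then have "coeff (mode h i) j = (\<lambda>_. 0)" by (simp add: coeff_mode)
    then show ?thesis
      using False dirichlet_form_zero[OF opB bdB pair_scaled_coeff] by (simp add: * L2_inner_def)
  qed
qed

text \<open>
  The averages of \<open>h\<close> and of the limit \<open>u\<close> against every eigenfunction coincide:
  tested against \<open>f \<otimes> q\<close>, the partial sums are eventually constant. Completeness gives \<open>u = h\<close>.
\<close>

lemma remainder_zero:
  assumes u: "u \<in> Lp 2 PAB" and lim: "(\<lambda>n. L2_norm PAB (\<lambda>z. (\<Sum>j<n. mode h j z) - u z)) \<longlonglongrightarrow> 0"
  shows "L2_norm PAB (\<lambda>z. h z - u z) = 0"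
proof -
  define S where "S n = (\<lambda>z. \<Sum>j<n. mode h j z)" for n
  have S_L2: "S n \<in> Lp 2 PAB" for n unfolding S_def by (intro Lp2_sum mode_L2)
  have limu: "(\<lambda>n. L2_norm PAB (\<lambda>z. S n z - u z)) \<longlonglongrightarrow> 0" using lim by (simp only: S_def)
  have hu: "(\<lambda>z. h z - u z) \<in> Lp 2 PAB" by (rule Lp2_diff[OF m(1) u])
  \<comment> \<open>Pairing with \<open>f \<otimes> q\<close> singles out one mode of the partial sums.\<close>
  have zero: "L2_ip LB (avg (f j) (\<lambda>z. h z - u z)) q = 0" if "1 \<le> j" "q \<in> Lp 2 LB" for j q
  proof -
    obtain i where j: "j = Suc i" using \<open>1 \<le> j\<close> by (cases j) auto
    let ?t = "\<lambda>z. f j (fst z) * q (snd z)"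
    have t: "?t \<in> Lp 2 PAB" using Lp2_tensor[OF f_L2[OF that(1)] that(2)] by simp
    have "(\<lambda>n. L2_ip PAB (S n) ?t) \<longlonglongrightarrow> L2_ip PAB u ?t"
      by (rule L2_ip_tendsto[OF S_L2 u t limu])
    moreover have "L2_ip PAB (mode h k) ?t = (if k = i then L2_ip LB (coeff h i) q else 0)" for k
    proof -
      have "L2_ip PAB (mode h k) ?t = L2_ip LA (f (Suc k)) (f j) * L2_ip LB (\<lambda>y. (1 + lam (Suc k)) * coeff h k y) q"
        using L2_ip_tensor[OF f_L2[of "Suc k"] f_L2[OF that(1)] sobolev_pair_L2(1)[OF pair_scaled_coeff] that(2)]
        by (simp add: mode_def[abs_def])
      also have "L2_ip LB (\<lambda>y. (1 + lam (Suc k)) * coeff h k y) q = (1 + lam (Suc k)) * L2_ip LB (coeff h k) q"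
        using L2_ip_scaleR_left[of LB "1 + lam (Suc k)" "coeff h k" q] by simp
      finally show ?thesis
        using orthogonal_L2[of "Suc k" j] \<open>1 \<le> j\<close> lam_nonneg[of "Suc k"] by (auto simp: j)
    qed
    then have Sn: "L2_ip PAB (S n) ?t = (if i < n then L2_ip LB (coeff h i) q else 0)" for n
      unfolding S_def by (simp add: L2_ip_sum_left[OF mode_L2(1) t])
    have "\<forall>\<^sub>F n in sequentially. L2_ip PAB (S n) ?t = L2_ip LB (coeff h i) q"
      using eventually_gt_at_top[of i] by eventually_elim (simp add: Sn)
    then have "(\<lambda>n. L2_ip PAB (S n) ?t) \<longlonglongrightarrow> L2_ip LB (coeff h i) q"
      by (rule tendsto_eventually)
    ultimately have "L2_ip PAB u ?t = L2_ip LB (coeff h i) q" by (rule LIMSEQ_unique)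
    also have "\<dots> = L2_ip PAB h ?t"
      using avg_adjoint[OF f_L2[OF that(1)] m(1) that(2)] by (simp add: coeff_def j)
    finally have "L2_ip PAB (\<lambda>z. h z - u z) ?t = 0" by (simp add: L2_ip_diff_left[OF m(1) u t])
    then show ?thesis
      using avg_adjoint[OF f_L2[OF that(1)] hu that(2)] by simp
  qed
  show ?thesis
  proof (rule L2_zero_if_avgs_zero[OF finite_pair_axioms hu])
    fix j :: nat assume j: "1 \<le> j"
    have "L2_norm LB (avg (f j) (\<lambda>z. h z - u z)) = 0"
      using zero[OF j avg_bound(1)[OF f_L2[OF j] hu]] by (simp add: L2_norm_def)
    then show "AE y in LB. avg (f j) (\<lambda>z. h z - u z) y = 0"
      by (simp add: L2_norm_eq_0_iff[OF avg_bound(1)[OF f_L2[OF j] hu]])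
  qed
qed

text \<open>
  The modes are pairwise orthogonal projections of \<open>h\<close>, so by Bessel's inequality their series converges in \<open>H\<^sup>1\<close>; the limit
  is \<open>h\<close> since the remainder has vanishing averages. The summability of the weighted norms of the coefficients is what makes
  the series of the traces converge.
\<close>

lemma neumann_expansion:
  shows "summable (\<lambda>j. (1 + lam (Suc j)) * (H1_norm B (coeff h j))\<^sup>2)"
    and "(\<lambda>n. H1_norm (A \<times> B) (\<lambda>z. (\<Sum>j<n. mode h j z) - h z)) \<longlonglongrightarrow> 0"
proof -
  define F where "F = (\<lambda>z. (h z, H z))"
  define e where "e j = (\<lambda>z. (mode h j z, mode_grad j z))" for j
  note Lh = Lp2_LAB[OF m(1)] Lp2_LAB[OF m(2)] and Lm = Lp2_LAB[OF mode_L2(1)] Lp2_LAB[OF mode_L2(2)]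
  have F: "F \<in> Lp 2 LAB" unfolding F_def by (rule Lp2_Pair[OF Lh])
  have e: "e j \<in> Lp 2 LAB" for j unfolding e_def by (rule Lp2_Pair[OF Lm])
  have ee: "L2_ip LAB (e j) (e i) = (if i = j then energy j else 0)" for i j
    using H1_inner_eq[OF opAB bdAB pair_mode pair_mode, of j i] by (simp add: e_def mode_inner_mode)
  have eF: "L2_ip LAB F (e j) = energy j" for j
    using H1_inner_eq[OF opAB bdAB pair_mode p, of j] L2_ip_commute[of LAB F]
    by (simp add: e_def F_def mode_inner_h)
  have summ: "summable (\<lambda>j. (L2_norm LAB (e j))\<^sup>2)"
    by (rule L2_bessel[OF e F]) (simp_all add: ee eF)
  have energy: "(L2_norm LAB (e j))\<^sup>2 = energy j" for j by (simp add: L2_norm_sq ee)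
  have "(1 + lam (Suc j)) * (H1_norm B (coeff h j))\<^sup>2 \<le> energy j" for j
  proof -
    have l: "0 \<le> lam (Suc j)" by (rule lam_nonneg) simp
    have nn: "0 \<le> L2_inner B (coeff h j) (coeff h j)" "0 \<le> dirichlet_form B (coeff h j) (coeff h j)"
      by (simp_all add: L2_inner_def dirichlet_form_def)
    then have "(H1_norm B (coeff h j))\<^sup>2 = L2_inner B (coeff h j) (coeff h j) + dirichlet_form B (coeff h j) (coeff h j)"
      by (simp add: H1_norm_def H1_inner_def)
    also have "\<dots> \<le> (1 + lam (Suc j)) * L2_inner B (coeff h j) (coeff h j) + dirichlet_form B (coeff h j) (coeff h j)"
      using mult_nonneg_nonneg[OF l nn(1)] by (simp add: algebra_simps)
    finally show ?thesis unfolding energy_def using l by (intro mult_left_mono) auto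
  qed
  then show "summable (\<lambda>j. (1 + lam (Suc j)) * (H1_norm B (coeff h j))\<^sup>2)"
    by (intro summable_comparison_test'[OF summ[unfolded energy], of 0])
      (use lam_nonneg in \<open>auto simp: abs_mult\<close>)
  obtain g where g: "g \<in> Lp 2 LAB" "(\<lambda>n. L2_norm LAB (\<lambda>z. (\<Sum>i<n. e i z) - g z)) \<longlonglongrightarrow> 0"
    by (rule L2_orthogonal_series_converges[OF e _ summ]) (simp_all add: ee)
  define S where "S n = (\<lambda>z. \<Sum>j<n. mode h j z)" for n
  define SG where "SG n = (\<lambda>z. \<Sum>j<n. mode_grad j z)" for n
  have pS: "sobolev_pair (A \<times> B) (S n) (SG n)" for n
    unfolding S_def SG_def by (intro sobolev_pair_sum opAB bdAB pair_mode)
  have S_L2: "S n \<in> Lp 2 PAB" for n unfolding S_def by (intro Lp2_sum mode_L2)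
  have sum_eq: "(\<Sum>i<n. e i z) = (S n z, SG n z)" for n z
    by (simp add: e_def S_def SG_def sum_prod)
  note lim = sobolev_pair_limit[OF opAB bdAB pS g(1) g(2)[unfolded sum_eq]]
  \<comment> \<open>The limit is only Lebesgue measurable; \<open>u\<close> is a representative to which averages apply.\<close>
  obtain u where u: "u \<in> Lp 2 PAB" "AE z in LAB. fst (g z) = u z"
    by (rule LAB_representative[OF Lp2_fst_comp[OF g(1)]])
  have limu: "(\<lambda>n. L2_norm PAB (\<lambda>z. S n z - u z)) \<longlonglongrightarrow> 0"
  proof -
    have "L2_norm PAB (\<lambda>z. S n z - u z) = L2_norm LAB (\<lambda>z. S n z - fst (g z))" for n
    proof -
      note d = Lp2_diff[OF S_L2 u(1)]
      have "L2_norm LAB (\<lambda>z. S n z - fst (g z)) = L2_norm LAB (\<lambda>z. S n z - u z)"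
        by (rule L2_norm_cong_AE)
          (use u(2) in eventually_elim, simp,
            rule Lp2_measurable[OF Lp2_diff[OF Lp2_LAB[OF S_L2] Lp2_fst_comp[OF g(1)]]],
            rule Lp2_measurable[OF Lp2_LAB[OF d]])
      then show ?thesis using L2_norm_LAB[OF d] by simp
    qed
    then show ?thesis using lim(2) by simp
  qed
  have hu: "(\<lambda>z. h z - u z) \<in> Lp 2 PAB" by (rule Lp2_diff[OF m(1) u(1)])
  have "L2_norm PAB (\<lambda>z. h z - u z) = 0"
    by (rule remainder_zero[OF u(1)]) (use limu in \<open>simp only: S_def\<close>)
  then have "AE z in PAB. h z - u z = 0" by (simp add: L2_norm_eq_0_iff[OF hu])
  then have "AE z in LAB. h z - u z = 0" using AE_zero_LAB[OF hu] by blast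
  then have ae: "AE z in LAB. fst (g z) = h z" using u(2) by eventually_elim simp
  have aeG: "AE z in LAB. snd (g z) = H z"
    by (rule weak_gradient_unique_AE[OF opAB bdAB lim(1) p ae])
  have norm_eq: "H1_norm (A \<times> B) (\<lambda>z. S n z - h z) = L2_norm LAB (\<lambda>z. (S n z, SG n z) - g z)" for n
  proof -
    have "H1_norm (A \<times> B) (\<lambda>z. S n z - h z) = L2_norm LAB (\<lambda>z. (S n z - h z, SG n z - H z))"
      by (rule H1_norm_eq[OF opAB bdAB sobolev_pair_diff[OF opAB bdAB pS p]])
    also have "\<dots> = L2_norm LAB (\<lambda>z. (S n z, SG n z) - g z)"
    proof (rule L2_norm_cong_AE)
      show "AE z in LAB. (S n z - h z, SG n z - H z) = (S n z, SG n z) - g z"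
        using ae aeG by eventually_elim (simp add: prod_eq_iff)
      show "(\<lambda>z. (S n z - h z, SG n z - H z)) \<in> borel_measurable LAB"
        by (intro Lp2_measurable Lp2_Pair Lp2_diff Lh sobolev_pair_L2[OF pS])
      show "(\<lambda>z. (S n z, SG n z) - g z) \<in> borel_measurable LAB"
        by (intro Lp2_measurable Lp2_Pair Lp2_diff g(1) sobolev_pair_L2[OF pS])
    qed
    finally show ?thesis .
  qed
  show "(\<lambda>n. H1_norm (A \<times> B) (\<lambda>z. (\<Sum>j<n. mode h j z) - h z)) \<longlonglongrightarrow> 0"
    using g(2)[unfolded sum_eq] unfolding norm_eq[symmetric] by (simp only: S_def)
qed

end

end

section \<open>Traces\<close>

lemma sets_hausdorff_measure: "sets (hausdorff_measure k :: 'a::metric_space measure) = sets borel"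
  unfolding hausdorff_measure_def
  by (simp add: sets_measure_of sets.sigma_sets_eq[of borel, unfolded space_borel])

lemma space_hausdorff_measure: "space (hausdorff_measure k :: 'a::metric_space measure) = UNIV"
  using sets_eq_imp_space_eq[OF sets_hausdorff_measure] by simp

lemma space_surface_measure: "space (surface_measure S) = S"
  by (simp add: surface_measure_def space_restrict_space space_hausdorff_measure)

text \<open>
  The surfaces that make up the boundary are finitely many sets of finite measure. Fubini's theorem for the lateral measure
  rests on this.
\<close>

lemma finite_measure_surface_bdry:
  fixes \<Omega> :: "'a::euclidean_space set"
  assumes "open \<Omega>" "cond_B1 \<Omega>"
  shows "finite_measure (surface_measure (bdry \<Omega>))"
proof (rule finite_measureI)
  let ?H = "hausdorff_measure (DIM('a) - 1) :: 'a measure"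
  obtain \<S> where \<S>: "finite \<S>" "bdry \<Omega> = \<Union>\<S>"
    "\<And>S. S \<in> \<S> \<Longrightarrow> closed S" "\<And>S. S \<in> \<S> \<Longrightarrow> emeasure (surface_measure S) S < \<infinity>"
    using assms(2) by (auto simp: cond_B1_def)
  have em: "emeasure (surface_measure S) S = emeasure ?H S" if "closed S" for S :: "'a set"
    unfolding surface_measure_def
    by (rule emeasure_restrict_space) (use that in \<open>auto simp: sets_hausdorff_measure\<close>)
  have "(\<Union>S\<in>\<S>. S) \<in> fmeasurable ?H"
    by (rule fmeasurable.finite_UN[OF \<S>(1)])
      (use \<S>(3,4) em in \<open>auto intro!: fmeasurableI simp: sets_hausdorff_measure\<close>)
  then have "emeasure ?H (bdry \<Omega>) < \<infinity>"
    using \<S>(2) by (auto simp: fmeasurable_def)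
  moreover have "closed (bdry \<Omega>)" using assms(1) by (intro closed_Diff) auto
  ultimately show "emeasure (surface_measure (bdry \<Omega>)) (space (surface_measure (bdry \<Omega>))) \<noteq> \<infinity>"
    by (simp add: space_surface_measure em)
qed

text \<open>
  The approximating sequence of \<open>has_trace\<close>, with the \<open>L\<^sup>2\<close> norm in place of \<open>Lp_norm 2\<close>.
\<close>

definition trace_approx ::
  "'a::euclidean_space set \<Rightarrow> 'a measure \<Rightarrow> ('a \<Rightarrow> real) \<Rightarrow> ('a \<Rightarrow> real) \<Rightarrow> (nat \<Rightarrow> 'a \<Rightarrow> real) \<Rightarrow> bool" where
  "trace_approx \<Omega> M u g \<phi> \<longleftrightarrow>
     (\<forall>n. (\<exists>L. L-lipschitz_on (closure \<Omega>) (\<phi> n)) \<and> \<phi> n \<in> H1 \<Omega> \<and> \<phi> n \<in> Lp 2 M) \<and>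
     (\<lambda>n. H1_norm \<Omega> (\<lambda>x. \<phi> n x - u x)) \<longlonglongrightarrow> 0 \<and>
     (\<lambda>n. L2_norm M (\<lambda>x. \<phi> n x - g x)) \<longlonglongrightarrow> 0"

lemma has_trace_iff:
  "has_trace \<Omega> M u g \<longleftrightarrow> u \<in> H1 \<Omega> \<and> g \<in> Lp 2 M \<and> (\<exists>\<phi>. trace_approx \<Omega> M u g \<phi>)"
  unfolding has_trace_def trace_approx_def Lp_norm_2 by blast

lemma trace_approxD:
  assumes "trace_approx \<Omega> M u g \<phi>"
  shows "\<exists>L. L-lipschitz_on (closure \<Omega>) (\<phi> n)" "\<phi> n \<in> H1 \<Omega>" "\<phi> n \<in> Lp 2 M"
    "(\<lambda>n. H1_norm \<Omega> (\<lambda>x. \<phi> n x - u x)) \<longlonglongrightarrow> 0"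
    "(\<lambda>n. L2_norm M (\<lambda>x. \<phi> n x - g x)) \<longlonglongrightarrow> 0"
  using assms by (auto simp: trace_approx_def)

lemma has_traceD:
  assumes "has_trace \<Omega> M u g"
  shows "u \<in> H1 \<Omega>" "g \<in> Lp 2 M"
  using assms by (auto simp: has_trace_def)

lemma has_traceI:
  assumes "u \<in> H1 \<Omega>" "g \<in> Lp 2 M"
    "\<And>n. \<exists>L. L-lipschitz_on (closure \<Omega>) (\<phi> n)" "\<And>n. \<phi> n \<in> H1 \<Omega>" "\<And>n. \<phi> n \<in> Lp 2 M"
    "(\<lambda>n. H1_norm \<Omega> (\<lambda>x. \<phi> n x - u x)) \<longlonglongrightarrow> 0"
    "(\<lambda>n. L2_norm M (\<lambda>x. \<phi> n x - g x)) \<longlonglongrightarrow> 0"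
  shows "has_trace \<Omega> M u g"
  unfolding has_trace_iff trace_approx_def using assms by blast

context
  fixes \<Omega> :: "'a::euclidean_space set" and M :: "'a measure"
  assumes op: "open \<Omega>" and bd: "bounded \<Omega>"
begin

lemma has_trace_add:
  assumes "has_trace \<Omega> M u g" "has_trace \<Omega> M v k"
  shows "has_trace \<Omega> M (\<lambda>x. u x + v x) (\<lambda>x. g x + k x)"
proof -
  obtain \<phi> where \<phi>: "trace_approx \<Omega> M u g \<phi>" using assms(1) by (auto simp: has_trace_iff)
  obtain \<psi> where \<psi>: "trace_approx \<Omega> M v k \<psi>" using assms(2) by (auto simp: has_trace_iff)
  note d = has_traceD[OF assms(1)] has_traceD[OF assms(2)]
  note a = trace_approxD[OF \<phi>] and b = trace_approxD[OF \<psi>]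
  show ?thesis
  proof (rule has_traceI[where \<phi>="\<lambda>n x. \<phi> n x + \<psi> n x"])
    show "\<exists>L. L-lipschitz_on (closure \<Omega>) (\<lambda>x. \<phi> n x + \<psi> n x)" for n
      using a(1)[of n] b(1)[of n] by (blast intro: lipschitz_on_add)
    show "(\<lambda>n. H1_norm \<Omega> (\<lambda>x. \<phi> n x + \<psi> n x - (u x + v x))) \<longlonglongrightarrow> 0"
    proof (rule tendsto_zero_bound[OF tendsto_add_zero[OF a(4) b(4)]])
      show "H1_norm \<Omega> (\<lambda>x. \<phi> n x + \<psi> n x - (u x + v x))
         \<le> H1_norm \<Omega> (\<lambda>x. \<phi> n x - u x) + H1_norm \<Omega> (\<lambda>x. \<psi> n x - v x)" for n
        using H1_norm_triangle[OF op bd H1_diff[OF op bd a(2) d(1)] H1_diff[OF op bd b(2) d(3)], of n n]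
        by (simp add: add_diff_add)
    qed (rule H1_norm_nonneg)
    show "(\<lambda>n. L2_norm M (\<lambda>x. \<phi> n x + \<psi> n x - (g x + k x))) \<longlonglongrightarrow> 0"
    proof (rule tendsto_zero_bound[OF tendsto_add_zero[OF a(5) b(5)]])
      show "L2_norm M (\<lambda>x. \<phi> n x + \<psi> n x - (g x + k x))
         \<le> L2_norm M (\<lambda>x. \<phi> n x - g x) + L2_norm M (\<lambda>x. \<psi> n x - k x)" for n
        using L2_norm_triangle[OF Lp2_diff[OF a(3) d(2)] Lp2_diff[OF b(3) d(4)], of n n]
        by (simp add: add_diff_add)
    qed (rule L2_norm_nonneg)
  qed (use d a b in \<open>auto intro: H1_add[OF op bd] Lp2_add\<close>)
qed

lemma has_trace_cmult:
  assumes "has_trace \<Omega> M u g"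
  shows "has_trace \<Omega> M (\<lambda>x. c * u x) (\<lambda>x. c * g x)"
proof -
  obtain \<phi> where \<phi>: "trace_approx \<Omega> M u g \<phi>" using assms(1) by (auto simp: has_trace_iff)
  note d = has_traceD[OF assms(1)]
  note a = trace_approxD[OF \<phi>]
  show ?thesis
  proof (rule has_traceI[where \<phi>="\<lambda>n x. c * \<phi> n x"])
    show "\<exists>L. L-lipschitz_on (closure \<Omega>) (\<lambda>x. c * \<phi> n x)" for n
      using a(1)[of n] by (blast intro: lipschitz_on_cmult_real)
    have "H1_norm \<Omega> (\<lambda>x. c * \<phi> n x - c * u x) = \<bar>c\<bar> * H1_norm \<Omega> (\<lambda>x. \<phi> n x - u x)" for n
      using H1_norm_cmult[OF op bd H1_diff[OF op bd a(2) d(1)], of c n] by (simp add: right_diff_distrib)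
    then show "(\<lambda>n. H1_norm \<Omega> (\<lambda>x. c * \<phi> n x - c * u x)) \<longlonglongrightarrow> 0"
      using tendsto_mult_right_zero[OF a(4)] by simp
    have "L2_norm M (\<lambda>x. c * \<phi> n x - c * g x) = \<bar>c\<bar> * L2_norm M (\<lambda>x. \<phi> n x - g x)" for n
      using L2_norm_scaleR[of M c "\<lambda>x. \<phi> n x - g x"] by (simp add: right_diff_distrib)
    then show "(\<lambda>n. L2_norm M (\<lambda>x. c * \<phi> n x - c * g x)) \<longlonglongrightarrow> 0"
      using tendsto_mult_right_zero[OF a(5)] by simp
  qed (use d a in \<open>auto intro: H1_cmult[OF op bd] Lp2_cmult\<close>)
qed

lemma has_trace_diff:
  assumes "has_trace \<Omega> M u g" "has_trace \<Omega> M v k"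
  shows "has_trace \<Omega> M (\<lambda>x. u x - v x) (\<lambda>x. g x - k x)"
  using has_trace_add[OF assms(1) has_trace_cmult[OF assms(2), of "-1"]] by simp

lemma has_trace_zero: "has_trace \<Omega> M (\<lambda>_. 0) (\<lambda>_. 0)"
  by (rule has_traceI[where \<phi>="\<lambda>_ _. 0"])
    (use sobolev_pair_H1[OF sobolev_pair_zero[OF op bd]] H1_norm_zero[OF op bd]
      in \<open>auto simp: Lp2_zero L2_norm_def L2_ip_def intro!: exI[of _ 0] lipschitz_onI\<close>)

lemma has_trace_sum:
  assumes "\<And>j. j \<in> J \<Longrightarrow> has_trace \<Omega> M (u j) (g j)"
  shows "has_trace \<Omega> M (\<lambda>x. \<Sum>j\<in>J. u j x) (\<lambda>x. \<Sum>j\<in>J. g j x)"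
  using assms by (induction J rule: infinite_finite_induct) (auto intro: has_trace_add simp: has_trace_zero)

lemma has_trace_cong_AE:
  assumes t: "has_trace \<Omega> M u g" and v: "v \<in> H1 \<Omega>" and ae: "AE x in lebesgue_on \<Omega>. u x = v x"
  shows "has_trace \<Omega> M v g"
proof -
  obtain \<phi> where \<phi>: "trace_approx \<Omega> M u g \<phi>" using t by (auto simp: has_trace_iff)
  note a = trace_approxD[OF \<phi>]
  have "H1_norm \<Omega> (\<lambda>x. \<phi> n x - v x) = H1_norm \<Omega> (\<lambda>x. \<phi> n x - u x)" for n
    by (rule H1_norm_cong_AE[OF op bd H1_diff[OF op bd a(2) v] H1_diff[OF op bd a(2) has_traceD(1)[OF t]]])
      (use ae in eventually_elim, simp)
  then show ?thesis
    by (intro has_traceI[OF v has_traceD(2)[OF t] a(1-3) _ a(5)]) (use a(4) in simp)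
qed

text \<open>
  A diagonal argument: replace each \<open>u n\<close> by a Lipschitz function that is close to it, in the interior and in trace.
\<close>

lemma has_trace_closed:
  assumes t: "\<And>n. has_trace \<Omega> M (u n) (g n)" and v: "v \<in> H1 \<Omega>" and k: "k \<in> Lp 2 M"
    and lim: "(\<lambda>n. H1_norm \<Omega> (\<lambda>x. u n x - v x)) \<longlonglongrightarrow> 0" "(\<lambda>n. L2_norm M (\<lambda>x. g n x - k x)) \<longlonglongrightarrow> 0"
  shows "has_trace \<Omega> M v k"
proof -
  note d = has_traceD[OF t]
  have "\<forall>n. \<exists>\<xi>. (\<exists>L. L-lipschitz_on (closure \<Omega>) \<xi>) \<and> \<xi> \<in> H1 \<Omega> \<and> \<xi> \<in> Lp 2 M \<and>
      H1_norm \<Omega> (\<lambda>x. \<xi> x - u n x) < inverse (real (Suc n)) \<and> L2_norm M (\<lambda>x. \<xi> x - g n x) < inverse (real (Suc n))"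
  proof
    fix n
    obtain \<phi> where \<phi>: "trace_approx \<Omega> M (u n) (g n) \<phi>" using t[of n] by (auto simp: has_trace_iff)
    note a = trace_approxD[OF \<phi>]
    have "0 < inverse (real (Suc n))" by simp
    then have "\<forall>\<^sub>F m in sequentially. H1_norm \<Omega> (\<lambda>x. \<phi> m x - u n x) < inverse (real (Suc n)) \<and>
        L2_norm M (\<lambda>x. \<phi> m x - g n x) < inverse (real (Suc n))"
      using order_tendstoD(2)[OF a(4)] order_tendstoD(2)[OF a(5)] by (intro eventually_conj) blast+
    then obtain m where "H1_norm \<Omega> (\<lambda>x. \<phi> m x - u n x) < inverse (real (Suc n))"
        "L2_norm M (\<lambda>x. \<phi> m x - g n x) < inverse (real (Suc n))"
      using eventually_happens'[OF sequentially_bot] by blast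
    then show "\<exists>\<xi>. (\<exists>L. L-lipschitz_on (closure \<Omega>) \<xi>) \<and> \<xi> \<in> H1 \<Omega> \<and> \<xi> \<in> Lp 2 M \<and>
      H1_norm \<Omega> (\<lambda>x. \<xi> x - u n x) < inverse (real (Suc n)) \<and> L2_norm M (\<lambda>x. \<xi> x - g n x) < inverse (real (Suc n))"
      using a(1-3) by blast
  qed
  from choice[OF this] obtain \<xi> where
    "\<forall>n. (\<exists>L. L-lipschitz_on (closure \<Omega>) (\<xi> n)) \<and> \<xi> n \<in> H1 \<Omega> \<and> \<xi> n \<in> Lp 2 M \<and>
      H1_norm \<Omega> (\<lambda>x. \<xi> n x - u n x) < inverse (real (Suc n)) \<and> L2_norm M (\<lambda>x. \<xi> n x - g n x) < inverse (real (Suc n))"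
    by blast
  then have \<xi>: "\<exists>L. L-lipschitz_on (closure \<Omega>) (\<xi> n)" "\<xi> n \<in> H1 \<Omega>" "\<xi> n \<in> Lp 2 M"
      "H1_norm \<Omega> (\<lambda>x. \<xi> n x - u n x) < inverse (real (Suc n))"
      "L2_norm M (\<lambda>x. \<xi> n x - g n x) < inverse (real (Suc n))" for n by blast+
  show ?thesis
  proof (rule has_traceI[OF v k \<xi>(1-3)])
    show "(\<lambda>n. H1_norm \<Omega> (\<lambda>x. \<xi> n x - v x)) \<longlonglongrightarrow> 0"
    proof (rule tendsto_zero_bound[OF tendsto_add_zero[OF LIMSEQ_inverse_real_of_nat lim(1)]])
      show "H1_norm \<Omega> (\<lambda>x. \<xi> n x - v x) \<le> inverse (real (Suc n)) + H1_norm \<Omega> (\<lambda>x. u n x - v x)" for n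
        using H1_norm_diff_triangle[OF op bd \<xi>(2) d(1) v, of n n] \<xi>(4)[of n] by linarith
    qed (rule H1_norm_nonneg)
    show "(\<lambda>n. L2_norm M (\<lambda>x. \<xi> n x - k x)) \<longlonglongrightarrow> 0"
    proof (rule tendsto_zero_bound[OF tendsto_add_zero[OF LIMSEQ_inverse_real_of_nat lim(2)]])
      show "L2_norm M (\<lambda>x. \<xi> n x - k x) \<le> inverse (real (Suc n)) + L2_norm M (\<lambda>x. g n x - k x)" for n
        using L2_norm_triangle_diff[OF \<xi>(3) d(2) k, of n n] \<xi>(5)[of n] by linarith
    qed (rule L2_norm_nonneg)
  qed
qed

end

text \<open>
  A compact linear map is bounded. Otherwise one scales a sequence of counterexamples so that the functions stay bounded
  and the \<open>n\<close>-th trace has norm \<open>n\<close>; no subsequence of these traces converges. Applied to \<open>u = 0\<close>, the bound says that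
  traces are unique.
\<close>

lemma compact_trace_bounded:
  assumes op: "open \<Omega>" and bd: "bounded \<Omega>" and ct: "compact_trace \<Omega>"
  obtains C where "0 \<le> C" "\<And>u g. has_trace \<Omega> (surface_measure (bdry \<Omega>)) u g \<Longrightarrow>
    L2_norm (surface_measure (bdry \<Omega>)) g \<le> C * H1_norm \<Omega> u"
proof -
  let ?s = "surface_measure (bdry \<Omega>)"
  have "\<exists>n::nat. \<forall>u g. has_trace \<Omega> ?s u g \<longrightarrow> L2_norm ?s g \<le> real n * H1_norm \<Omega> u"
  proof (rule ccontr)
    assume "\<not> ?thesis"
    then have "\<forall>n::nat. \<exists>ug. has_trace \<Omega> ?s (fst ug) (snd ug) \<and> real n * H1_norm \<Omega> (fst ug) < L2_norm ?s (snd ug)"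
      by (metis fst_conv snd_conv not_le)
    from choice[OF this] obtain w where w:
      "\<And>n. has_trace \<Omega> ?s (fst (w n)) (snd (w n))" "\<And>n. real n * H1_norm \<Omega> (fst (w n)) < L2_norm ?s (snd (w n))"
      by blast
    \<comment> \<open>The scaling that gives the \<open>n\<close>-th trace the norm \<open>n\<close>.\<close>
    define c where "c n = real n / L2_norm ?s (snd (w n))" for n
    have pos: "0 < L2_norm ?s (snd (w n))" for n
      using w(2)[of n] mult_nonneg_nonneg[OF _ H1_norm_nonneg, of "real n" \<Omega> "fst (w n)"] by linarith
    have c0: "0 \<le> c n" for n using pos[of n] by (simp add: c_def)
    define u where "u n = (\<lambda>x. c n * fst (w n) x)" for n
    define g where "g n = (\<lambda>x. c n * snd (w n) x)" for n
    have t: "has_trace \<Omega> ?s (u n) (g n)" for n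
      unfolding u_def g_def by (rule has_trace_cmult[OF op bd w(1)])
    have "H1_norm \<Omega> (u n) \<le> 1" for n
    proof -
      have "H1_norm \<Omega> (u n) = c n * H1_norm \<Omega> (fst (w n))"
        unfolding u_def using H1_norm_cmult[OF op bd has_traceD(1)[OF w(1)]] c0 by simp
      also have "\<dots> \<le> 1" using w(2)[of n] pos[of n] by (simp add: c_def field_simps)
      finally show ?thesis .
    qed
    then have "\<forall>n. H1_norm \<Omega> (u n) \<le> 1 \<and> has_trace \<Omega> ?s (u n) (g n)" using t by blast
    then obtain r g0 where r: "strict_mono r" "g0 \<in> Lp 2 ?s"
        "(\<lambda>n. Lp_norm 2 ?s (\<lambda>x. g (r n) x - g0 x)) \<longlonglongrightarrow> 0"
      using ct unfolding compact_trace_def Let_def by blast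
    have gn: "L2_norm ?s (g n) = real n" for n
      unfolding g_def using L2_norm_scaleR[of ?s "c n" "snd (w n)"] c0[of n] pos[of n]
      by (simp add: c_def)
    have "\<forall>\<^sub>F n in sequentially. L2_norm ?s (\<lambda>x. g (r n) x - g0 x) < 1"
      using order_tendstoD(2)[OF r(3), of 1] by (simp add: Lp_norm_2)
    moreover have "\<forall>\<^sub>F n in sequentially. real n > L2_norm ?s g0 + 1"
      using filterlim_real_sequentially by (simp add: filterlim_at_top_dense)
    ultimately have "\<forall>\<^sub>F n::nat in sequentially. False"
    proof eventually_elim
      case (elim n)
      have "real (r n) \<le> L2_norm ?s (\<lambda>x. g (r n) x - g0 x) + L2_norm ?s g0"
        using L2_norm_triangle[OF Lp2_diff[OF has_traceD(2)[OF t] r(2)] r(2), of "r n"] by (simp add: gn)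
      moreover have "real n \<le> real (r n)" using seq_suble[OF r(1), of n] by simp
      ultimately show ?case using elim by linarith
    qed
    then show False by simp
  qed
  then show thesis using that by (metis of_nat_0_le_iff)
qed

lemma trace_unique_AE:
  assumes op: "open \<Omega>" and bd: "bounded \<Omega>" and ct: "compact_trace \<Omega>"
    and t: "has_trace \<Omega> (surface_measure (bdry \<Omega>)) u g" "has_trace \<Omega> (surface_measure (bdry \<Omega>)) u k"
  shows "AE x in surface_measure (bdry \<Omega>). g x = k x"
proof -
  let ?s = "surface_measure (bdry \<Omega>)"
  obtain C where "0 \<le> C" and C: "\<And>u g. has_trace \<Omega> ?s u g \<Longrightarrow> L2_norm ?s g \<le> C * H1_norm \<Omega> u"
    by (rule compact_trace_bounded[OF op bd ct]) blast
  have "has_trace \<Omega> ?s (\<lambda>_. 0) (\<lambda>x. g x - k x)" using has_trace_diff[OF op bd t] by simp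
  from C[OF this] have "L2_norm ?s (\<lambda>x. g x - k x) = 0"
    using L2_norm_nonneg[of ?s "\<lambda>x. g x - k x"] by (simp add: H1_norm_zero[OF op bd])
  then show ?thesis
    using L2_norm_eq_0_iff[OF Lp2_diff[OF has_traceD(2)[OF t(1)] has_traceD(2)[OF t(2)]]] by simp
qed

lemma has_trace_bd_trace:
  assumes "compact_trace \<Omega>" "u \<in> H1 \<Omega>"
  shows "has_trace \<Omega> (surface_measure (bdry \<Omega>)) u (bd_trace \<Omega> u)"
proof -
  have "\<exists>g. has_trace \<Omega> (surface_measure (bdry \<Omega>)) u g"
    using assms unfolding compact_trace_def Let_def by blast
  then show ?thesis unfolding trace_on_def by (rule someI_ex)
qed

lemma lipschitz_bounded:
  fixes \<phi> :: "'a::euclidean_space \<Rightarrow> real"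
  assumes "L-lipschitz_on (closure \<Omega>) \<phi>" "bounded \<Omega>"
  obtains C where "0 \<le> C" "\<And>x. x \<in> closure \<Omega> \<Longrightarrow> \<bar>\<phi> x\<bar> \<le> C"
proof -
  have "compact (\<phi> ` closure \<Omega>)"
    using assms by (intro compact_continuous_image lipschitz_on_continuous_on) (auto simp: compact_closure)
  then obtain C where "\<And>x. x \<in> closure \<Omega> \<Longrightarrow> \<bar>\<phi> x\<bar> \<le> C"
    using compact_imp_bounded bounded_iff by (metis imageI real_norm_def)
  then show thesis using that[of "max C 0"] by fastforce
qed

text \<open>
  Here boundedness of the domains is essential: products of unbounded Lipschitz functions need not be Lipschitz.
\<close>

lemma lipschitz_tensor:
  fixes \<phi> :: "'a::euclidean_space \<Rightarrow> real" and \<psi> :: "'b::euclidean_space \<Rightarrow> real"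
  assumes \<phi>: "L-lipschitz_on (closure A) \<phi>" and \<psi>: "K-lipschitz_on (closure B) \<psi>"
    and bd: "bounded A" "bounded B"
  shows "\<exists>L. L-lipschitz_on (closure (A \<times> B)) (\<lambda>z. \<phi> (fst z) * \<psi> (snd z))"
proof -
  obtain C where C: "0 \<le> C" "\<And>x. x \<in> closure A \<Longrightarrow> \<bar>\<phi> x\<bar> \<le> C" by (rule lipschitz_bounded[OF \<phi> bd(1)]) blast
  obtain D where D: "0 \<le> D" "\<And>x. x \<in> closure B \<Longrightarrow> \<bar>\<psi> x\<bar> \<le> D" by (rule lipschitz_bounded[OF \<psi> bd(2)]) blast
  have L: "0 \<le> L" and K: "0 \<le> K" using \<phi> \<psi> by (auto dest: lipschitz_on_nonneg)
  have "(C * K + L * D)-lipschitz_on (closure (A \<times> B)) (\<lambda>z. \<phi> (fst z) * \<psi> (snd z))"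
  proof (rule lipschitz_onI)
    fix z w assume "z \<in> closure (A \<times> B)" "w \<in> closure (A \<times> B)"
    then have m: "fst z \<in> closure A" "snd z \<in> closure B" "fst w \<in> closure A" "snd w \<in> closure B"
      by (auto simp: closure_Times)
    have "\<phi> (fst z) * \<psi> (snd z) - \<phi> (fst w) * \<psi> (snd w)
       = \<phi> (fst z) * (\<psi> (snd z) - \<psi> (snd w)) + (\<phi> (fst z) - \<phi> (fst w)) * \<psi> (snd w)"
      by (simp add: algebra_simps)
    also have "\<bar>\<dots>\<bar> \<le> \<bar>\<phi> (fst z)\<bar> * \<bar>\<psi> (snd z) - \<psi> (snd w)\<bar> + \<bar>\<phi> (fst z) - \<phi> (fst w)\<bar> * \<bar>\<psi> (snd w)\<bar>"
      by (metis abs_triangle_ineq abs_mult)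
    also have "\<dots> \<le> C * (K * dist z w) + (L * dist z w) * D"
    proof (intro add_mono mult_mono)
      have "\<bar>\<psi> (snd z) - \<psi> (snd w)\<bar> \<le> K * dist (snd z) (snd w)"
        using lipschitz_onD[OF \<psi> m(2,4)] by (simp add: dist_real_def)
      also have "\<dots> \<le> K * dist z w" by (intro mult_left_mono dist_snd_le K)
      finally show "\<bar>\<psi> (snd z) - \<psi> (snd w)\<bar> \<le> K * dist z w" .
      have "\<bar>\<phi> (fst z) - \<phi> (fst w)\<bar> \<le> L * dist (fst z) (fst w)"
        using lipschitz_onD[OF \<phi> m(1,3)] by (simp add: dist_real_def)
      also have "\<dots> \<le> L * dist z w" by (intro mult_left_mono dist_fst_le L)
      finally show "\<bar>\<phi> (fst z) - \<phi> (fst w)\<bar> \<le> L * dist z w" .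
    qed (use C D m L K in auto)
    finally show "dist (\<phi> (fst z) * \<psi> (snd z)) (\<phi> (fst w) * \<psi> (snd w)) \<le> (C * K + L * D) * dist z w"
      by (simp add: dist_real_def algebra_simps)
  qed (use C D L K in auto)
  then show ?thesis by blast
qed

context domain_pair
begin

lemma lipschitz_slice_L2:
  fixes \<phi> :: "'a \<times> 'b \<Rightarrow> real"
  assumes \<phi>: "L-lipschitz_on (closure (A \<times> B)) \<phi>" and y: "y \<in> closure B"
  shows "(\<lambda>x. \<phi> (x, y)) \<in> Lp 2 LA"
proof -
  obtain C where C: "0 \<le> C" "\<And>z. z \<in> closure (A \<times> B) \<Longrightarrow> \<bar>\<phi> z\<bar> \<le> C"
    by (rule lipschitz_bounded[OF \<phi> bdAB]) blast
  have mem: "(x, y) \<in> closure (A \<times> B)" if "x \<in> A" for x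
    using that y closure_subset[of A] by (auto simp: closure_Times)
  have "continuous_on A (\<lambda>x. \<phi> (x, y))"
    by (rule continuous_on_compose2[OF lipschitz_on_continuous_on[OF \<phi>]])
      (use mem in \<open>auto intro!: continuous_intros\<close>)
  then have "(\<lambda>x. \<phi> (x, y)) \<in> borel_measurable LA"
    by (rule continuous_imp_measurable_on_sets_lebesgue) (rule open_in_sets_lebesgue[OF opA])
  then show ?thesis
    by (rule Lp2_bounded[OF M1.finite_measure_axioms, where B=C]) (use C mem in auto)
qed

lemma lipschitz_avg:
  fixes \<phi> :: "'a \<times> 'b \<Rightarrow> real"
  assumes \<phi>: "L-lipschitz_on (closure (A \<times> B)) \<phi>" and f: "f \<in> Lp 2 LA"
  shows "\<exists>K. K-lipschitz_on (closure B) (avg f \<phi>)"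
proof (intro exI lipschitz_onI)
  let ?I = "LINT x|LA. \<bar>f x\<bar>"
  have L: "0 \<le> L" using \<phi> by (rule lipschitz_on_nonneg)
  then show "0 \<le> L * ?I" by simp
  have intf: "integrable LA f" by (rule Lp2_integrable[OF M1.finite_measure_axioms f])
  fix y y' assume y: "y \<in> closure B" "y' \<in> closure B"
  note int = Lp2_times_integrable[OF f lipschitz_slice_L2[OF \<phi> y(1)]]
    Lp2_times_integrable[OF f lipschitz_slice_L2[OF \<phi> y(2)]]
  have "avg f \<phi> y - avg f \<phi> y' = (LINT x|LA. f x * (\<phi> (x, y) - \<phi> (x, y')))"
    unfolding avg_def using int by (simp add: right_diff_distrib)
  also have "\<bar>\<dots>\<bar> \<le> (LINT x|LA. \<bar>f x * (\<phi> (x, y) - \<phi> (x, y'))\<bar>)" by (rule integral_abs_bound)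
  also have "\<dots> \<le> (LINT x|LA. \<bar>f x\<bar> * (L * dist y y'))"
  proof (rule integral_mono)
    show "integrable LA (\<lambda>x. \<bar>f x * (\<phi> (x, y) - \<phi> (x, y'))\<bar>)"
      using int by (simp add: right_diff_distrib)
    show "integrable LA (\<lambda>x. \<bar>f x\<bar> * (L * dist y y'))" using intf by simp
    fix x assume "x \<in> space LA"
    then have "(x, y) \<in> closure (A \<times> B)" "(x, y') \<in> closure (A \<times> B)"
      using y closure_subset[of A] by (auto simp: closure_Times)
    then have "\<bar>\<phi> (x, y) - \<phi> (x, y')\<bar> \<le> L * dist y y'"
      using lipschitz_onD[OF \<phi>] by (fastforce simp: dist_real_def dist_Pair_Pair)
    then show "\<bar>f x * (\<phi> (x, y) - \<phi> (x, y'))\<bar> \<le> \<bar>f x\<bar> * (L * dist y y')"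
      by (simp add: abs_mult mult_left_mono)
  qed
  also have "\<dots> = L * ?I * dist y y'" by simp
  finally show "dist (avg f \<phi> y) (avg f \<phi> y') \<le> L * ?I * dist y y'" by (simp add: dist_real_def)
qed

lemma lipschitz_measurable:
  fixes \<phi> :: "'a \<times> 'b \<Rightarrow> real"
  assumes \<phi>: "L-lipschitz_on (closure (A \<times> B)) \<phi>"
  shows "\<phi> \<in> borel_measurable PAB"
proof -
  have "(\<lambda>z. indicator (closure (A \<times> B)) z *\<^sub>R \<phi> z) \<in> borel_measurable borel"
    by (rule borel_measurable_continuous_on_indicator[OF _ lipschitz_on_continuous_on[OF \<phi>]]) simp
  from borel_measurable_pair[OF this]
  show ?thesis
  proof (rule measurable_cong[THEN iffD1, rotated])
    fix z assume "z \<in> space PAB"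
    then have "z \<in> closure (A \<times> B)" using closure_subset[of "A \<times> B"] by (auto simp: space_pair_measure)
    then show "indicator (closure (A \<times> B)) z *\<^sub>R \<phi> z = \<phi> z" by simp
  qed
qed

end

section \<open>Lateral traces\<close>

locale trace_pair = neumann_pair A B lam f
  for A :: "'a::euclidean_space set" and B :: "'b::euclidean_space set" and lam f +
  assumes finite_surface: "finite_measure (surface_measure (bdry B))"
    and ctA: "compact_trace A" and ctB: "compact_trace B"
begin

abbreviation "SB \<equiv> surface_measure (bdry B)"

abbreviation "Lat \<equiv> LA \<Otimes>\<^sub>M SB"

lemma lateral_pair: "finite_pair LA SB"
  by (intro finite_pair.intro M1.finite_measure_axioms finite_surface)

interpretation lat: finite_pair LA SB by (rule lateral_pair)

lemma bilinear_bound_tendsto: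
  fixes a b c :: "nat \<Rightarrow> real"
  assumes "a \<longlonglongrightarrow> 0" "b \<longlonglongrightarrow> 0"
    and "\<And>n. 0 \<le> c n" "\<And>n. c n \<le> a n * (b n + \<beta>) + \<alpha> * b n"
  shows "c \<longlonglongrightarrow> 0"
proof (rule tendsto_zero_bound[OF _ assms(3,4)])
  show "(\<lambda>n. a n * (b n + \<beta>) + \<alpha> * b n) \<longlonglongrightarrow> 0"
    using tendsto_add[OF tendsto_mult[OF assms(1) tendsto_add[OF assms(2) tendsto_const]]
      tendsto_mult[OF tendsto_const assms(2)]] by simp
qed

text \<open>
  The Lipschitz approximations of \<open>u\<close> are those that define its trace on the boundary of \<open>A\<close>; their products with
  approximations of \<open>v\<close> converge on \<open>A \<times> B\<close> and on the lateral boundary.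
\<close>

lemma has_trace_tensor:
  assumes u: "u \<in> H1 A" and t: "has_trace B SB v t"
  shows "has_trace (A \<times> B) Lat (\<lambda>z. u (fst z) * v (snd z)) (\<lambda>z. u (fst z) * t (snd z))"
proof -
  obtain \<phi> where \<phi>: "trace_approx A (surface_measure (bdry A)) u (bd_trace A u) \<phi>"
    using has_trace_bd_trace[OF ctA u] by (auto simp: has_trace_iff)
  obtain \<psi> where \<psi>: "trace_approx B SB v t \<psi>" using t by (auto simp: has_trace_iff)
  note a = trace_approxD[OF \<phi>] and b = trace_approxD[OF \<psi>]
  note v = has_traceD(1)[OF t] and tL = has_traceD(2)[OF t]
  have pu: "sobolev_pair A u (wgrad A u)" and pv: "sobolev_pair B v (wgrad B v)"
    using u v by (auto intro: sobolev_pair_wgrad)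
  have p\<phi>: "sobolev_pair A (\<phi> n) (wgrad A (\<phi> n))" and p\<psi>: "sobolev_pair B (\<psi> n) (wgrad B (\<psi> n))" for n
    using a(2) b(2) by (auto intro: sobolev_pair_wgrad)
  note uL = sobolev_pair_L2(1)[OF pu] and \<phi>L = sobolev_pair_L2(1)[OF p\<phi>]
  have tens: "(\<lambda>z. p (fst z) * q (snd z)) \<in> H1 (A \<times> B)" if "p \<in> H1 A" "q \<in> H1 B" for p q
    using sobolev_pair_H1[OF sobolev_pair_tensor[OF sobolev_pair_wgrad[OF that(1)] sobolev_pair_wgrad[OF that(2)]]] .
  have tens_norm: "H1_norm (A \<times> B) (\<lambda>z. p (fst z) * q (snd z)) \<le> H1_norm A p * H1_norm B q"
    if "p \<in> H1 A" "q \<in> H1 B" for p q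
    using tensor_H1_norm_le[OF sobolev_pair_wgrad[OF that(1)] sobolev_pair_wgrad[OF that(2)]] .
  have ltens: "(\<lambda>z. p (fst z) * q (snd z)) \<in> Lp 2 Lat" if "p \<in> Lp 2 LA" "q \<in> Lp 2 SB"
    for p and q :: "'b \<Rightarrow> real"
    using lat.Lp2_tensor[OF that] by simp
  have ltens_norm: "L2_norm Lat (\<lambda>z. p (fst z) * q (snd z)) = L2_norm LA p * L2_norm SB q"
    if "p \<in> Lp 2 LA" "q \<in> Lp 2 SB" for p and q :: "'b \<Rightarrow> real"
    using lat.L2_norm_tensor[OF that] by simp
  \<comment> \<open>The telescoping that reduces products to their factors; used for both norms.\<close>
  have split: "\<phi> n (fst z) * r (snd z) - u (fst z) * s (snd z)
      = (\<phi> n (fst z) - u (fst z)) * r (snd z) + u (fst z) * (r (snd z) - s (snd z))"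
    for n r s and z :: "'a \<times> 'b" by (simp add: algebra_simps)
  have L\<phi>lim: "(\<lambda>n. L2_norm LA (\<lambda>x. \<phi> n x - u x)) \<longlonglongrightarrow> 0"
  proof (rule tendsto_zero_bound[OF a(4)])
    fix n
    note pd = sobolev_pair_diff[OF opA bdA p\<phi> pu, of n]
    have "(L2_norm LA (\<lambda>x. \<phi> n x - u x))\<^sup>2 \<le> (H1_norm A (\<lambda>x. \<phi> n x - u x))\<^sup>2"
      unfolding H1_norm_sq[OF opA bdA pd] by simp
    then show "L2_norm LA (\<lambda>x. \<phi> n x - u x) \<le> H1_norm A (\<lambda>x. \<phi> n x - u x)"
      by (rule power2_le_imp_le) (rule H1_norm_nonneg)
  qed (rule L2_norm_nonneg)
  show ?thesis
  proof (rule has_traceI[where \<phi>="\<lambda>n z. \<phi> n (fst z) * \<psi> n (snd z)"])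
    show "\<exists>L. L-lipschitz_on (closure (A \<times> B)) (\<lambda>z. \<phi> n (fst z) * \<psi> n (snd z))" for n
      using a(1)[of n] b(1)[of n] lipschitz_tensor[OF _ _ bdA bdB] by blast
    show "(\<lambda>n. H1_norm (A \<times> B) (\<lambda>z. \<phi> n (fst z) * \<psi> n (snd z) - u (fst z) * v (snd z))) \<longlonglongrightarrow> 0"
    proof (rule bilinear_bound_tendsto[OF a(4) b(4)])
      fix n
      note d1 = H1_diff[OF opA bdA a(2) u, of n] and d2 = H1_diff[OF opB bdB b(2) v, of n]
      have n\<psi>: "H1_norm B (\<psi> n) \<le> H1_norm B (\<lambda>x. \<psi> n x - v x) + H1_norm B v"
        using H1_norm_triangle[OF opB bdB d2 v] by simp
      have "H1_norm (A \<times> B) (\<lambda>z. \<phi> n (fst z) * \<psi> n (snd z) - u (fst z) * v (snd z))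
          \<le> H1_norm A (\<lambda>x. \<phi> n x - u x) * H1_norm B (\<psi> n) + H1_norm A u * H1_norm B (\<lambda>x. \<psi> n x - v x)"
        unfolding split
        using H1_norm_triangle[OF opAB bdAB tens[OF d1 b(2)] tens[OF u d2], of n] tens_norm[OF d1 b(2), of n] tens_norm[OF u d2]
        by linarith
      also have "\<dots> \<le> H1_norm A (\<lambda>x. \<phi> n x - u x) * (H1_norm B (\<lambda>x. \<psi> n x - v x) + H1_norm B v)
          + H1_norm A u * H1_norm B (\<lambda>x. \<psi> n x - v x)"
        by (intro add_mono mult_left_mono n\<psi> H1_norm_nonneg order_refl)
      finally show "H1_norm (A \<times> B) (\<lambda>z. \<phi> n (fst z) * \<psi> n (snd z) - u (fst z) * v (snd z)) \<le> \<dots>" .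
    qed (rule H1_norm_nonneg)
    show "(\<lambda>n. L2_norm Lat (\<lambda>z. \<phi> n (fst z) * \<psi> n (snd z) - u (fst z) * t (snd z))) \<longlonglongrightarrow> 0"
    proof (rule bilinear_bound_tendsto[OF L\<phi>lim b(5)])
      fix n
      note d1 = Lp2_diff[OF \<phi>L uL, of n] and d2 = Lp2_diff[OF b(3) tL, of n]
      have n\<psi>: "L2_norm SB (\<psi> n) \<le> L2_norm SB (\<lambda>x. \<psi> n x - t x) + L2_norm SB t"
        using L2_norm_triangle[OF d2 tL] by simp
      have "L2_norm Lat (\<lambda>z. \<phi> n (fst z) * \<psi> n (snd z) - u (fst z) * t (snd z))
          \<le> L2_norm LA (\<lambda>x. \<phi> n x - u x) * L2_norm SB (\<psi> n) + L2_norm LA u * L2_norm SB (\<lambda>x. \<psi> n x - t x)"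
        unfolding split
        using L2_norm_triangle[OF ltens[OF d1 b(3)] ltens[OF uL d2], of n]
        by (simp add: ltens_norm[OF d1 b(3)] ltens_norm[OF uL d2])
      also have "\<dots> \<le> L2_norm LA (\<lambda>x. \<phi> n x - u x) * (L2_norm SB (\<lambda>x. \<psi> n x - t x) + L2_norm SB t)
          + L2_norm LA u * L2_norm SB (\<lambda>x. \<psi> n x - t x)"
        by (intro add_mono mult_left_mono n\<psi> L2_norm_nonneg order_refl)
      finally show "L2_norm Lat (\<lambda>z. \<phi> n (fst z) * \<psi> n (snd z) - u (fst z) * t (snd z)) \<le> \<dots>" .
    qed (rule L2_norm_nonneg)
  qed (use tens[OF u v] tens[OF a(2) b(2)] ltens[OF uL tL] ltens[OF \<phi>L b(3)] in auto)
qed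

text \<open>
  Averaging commutes with taking traces: it preserves Lipschitz functions and is continuous for both norms involved.
\<close>

lemma has_trace_avg:
  assumes p: "sobolev_pair (A \<times> B) h H" and m: "h \<in> Lp 2 PAB" "H \<in> Lp 2 PAB"
    and t: "has_trace (A \<times> B) Lat h t" and q: "q \<in> Lp 2 LA"
  shows "has_trace B SB (avg q h) (avg q t)"
proof -
  obtain \<phi> where \<phi>: "trace_approx (A \<times> B) Lat h t \<phi>" using t by (auto simp: has_trace_iff)
  note a = trace_approxD[OF \<phi>] and tL = has_traceD(2)[OF t]
  have mm: "\<phi> n \<in> Lp 2 PAB" for n
  proof (rule Lp2_PAB)
    show "\<phi> n \<in> Lp 2 LAB" using a(2)[of n] by (simp add: H1_def)
    show "\<phi> n \<in> borel_measurable PAB" using a(1)[of n] lipschitz_measurable by blast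
  qed
  have "\<forall>n. \<exists>G. sobolev_pair (A \<times> B) (\<phi> n) G \<and> G \<in> Lp 2 PAB"
    by (rule allI, rule sobolev_representative[OF a(2)]) blast
  from choice[OF this] obtain G
    where G: "\<And>n. sobolev_pair (A \<times> B) (\<phi> n) (G n)" "\<And>n. G n \<in> Lp 2 PAB" by blast
  show ?thesis
  proof (rule has_traceI[where \<phi>="\<lambda>n. avg q (\<phi> n)"])
    show "avg q h \<in> H1 B" by (rule sobolev_pair_H1[OF avg_sobolev_pair[OF p m q]])
    show "avg q t \<in> Lp 2 SB" by (rule lat.avg_bound(1)[OF q tL])
    show "\<exists>L. L-lipschitz_on (closure B) (avg q (\<phi> n))" for n
      using a(1)[of n] lipschitz_avg[OF _ q] by blast
    show "avg q (\<phi> n) \<in> H1 B" for n by (rule sobolev_pair_H1[OF avg_sobolev_pair[OF G(1) mm G(2) q]])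
    show "avg q (\<phi> n) \<in> Lp 2 SB" for n by (rule lat.avg_bound(1)[OF q a(3)])
    show "(\<lambda>n. H1_norm B (\<lambda>x. avg q (\<phi> n) x - avg q h x)) \<longlonglongrightarrow> 0"
      by (rule tendsto_zero_bound[OF tendsto_mult_right_zero[OF a(4)]
           H1_norm_nonneg avg_diff_H1_norm_le[OF G(1) mm G(2) p m q]])
    show "(\<lambda>n. L2_norm SB (\<lambda>x. avg q (\<phi> n) x - avg q t x)) \<longlonglongrightarrow> 0"
    proof (rule tendsto_zero_bound[OF tendsto_mult_right_zero[OF a(5)] L2_norm_nonneg])
      fix n
      have "L2_norm SB (\<lambda>x. avg q (\<phi> n) x - avg q t x) = L2_norm SB (avg q (\<lambda>z. \<phi> n z - t z))"
      proof (rule L2_norm_cong_AE)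
        show "AE y in SB. avg q (\<phi> n) y - avg q t y = avg q (\<lambda>z. \<phi> n z - t z) y"
          using lat.avg_diff_AE[OF q a(3)[of n] tL] by eventually_elim simp
      qed (intro Lp2_measurable Lp2_diff lat.avg_bound(1) q a(3) tL)+
      also have "\<dots> \<le> L2_norm LA q * L2_norm Lat (\<lambda>z. \<phi> n z - t z)"
        by (rule lat.avg_bound(2)[OF q Lp2_diff[OF a(3) tL]])
      finally show "L2_norm SB (\<lambda>x. avg q (\<phi> n) x - avg q t x) \<le> L2_norm LA q * L2_norm Lat (\<lambda>z. \<phi> n z - t z)" .
    qed
  qed
qed

text \<open>
  The traces of the modes form an orthogonal series in \<open>L\<^sup>2\<close> of the lateral boundary, because the eigenfunctions are
  orthogonal on \<open>A\<close>. It converges since the trace map of \<open>B\<close> is bounded and the weighted norms of the coefficients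
  are square-summable.
\<close>

lemma lateral_trace_exists_rep:
  assumes p: "sobolev_pair (A \<times> B) h H" and m: "h \<in> Lp 2 PAB" "H \<in> Lp 2 PAB"
  shows "\<exists>t. has_trace (A \<times> B) Lat h t"
proof -
  note pc = pair_coeff[OF p m]
  define t where "t j = bd_trace B (coeff h j)" for j
  have t: "has_trace B SB (coeff h j) (t j)" for j
    unfolding t_def by (rule has_trace_bd_trace[OF ctB sobolev_pair_H1[OF pc]])
  note tL = has_traceD(2)[OF t]
  define e where "e j = (\<lambda>z. f (Suc j) (fst z) * ((1 + lam (Suc j)) * t j (snd z)))" for j
  have he: "has_trace (A \<times> B) Lat (mode h j) (e j)" for j
    unfolding mode_def[abs_def] e_def
    by (rule has_trace_tensor[OF sobolev_pair_H1[OF pair_f] has_trace_cmult[OF opB bdB t]]) simp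
  note eL = has_traceD(2)[OF he]
  have ip: "L2_ip Lat (e i) (e j) = L2_ip LA (f (Suc i)) (f (Suc j)) *
      ((1 + lam (Suc i)) * ((1 + lam (Suc j)) * L2_ip SB (t i) (t j)))" for i j
  proof -
    have "L2_ip Lat (e i) (e j) = L2_ip LA (f (Suc i)) (f (Suc j)) *
        L2_ip SB (\<lambda>y. (1 + lam (Suc i)) * t i y) (\<lambda>y. (1 + lam (Suc j)) * t j y)"
      using lat.L2_ip_tensor[OF f_L2[of "Suc i"] f_L2[of "Suc j"] Lp2_cmult[OF tL] Lp2_cmult[OF tL]]
      by (simp add: e_def)
    also have "L2_ip SB (\<lambda>y. (1 + lam (Suc i)) * t i y) (\<lambda>y. (1 + lam (Suc j)) * t j y)
        = (1 + lam (Suc i)) * L2_ip SB (t i) (\<lambda>y. (1 + lam (Suc j)) * t j y)"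
      using L2_ip_scaleR_left[of SB _ "t i"] by simp
    also have "L2_ip SB (t i) (\<lambda>y. (1 + lam (Suc j)) * t j y) = (1 + lam (Suc j)) * L2_ip SB (t i) (t j)"
      using L2_ip_scaleR_left[of SB _ "t j" "t i"] by (simp add: L2_ip_commute[of SB "t i"])
    finally show ?thesis .
  qed
  obtain C where C: "0 \<le> C" "\<And>u g. has_trace B SB u g \<Longrightarrow> L2_norm SB g \<le> C * H1_norm B u"
    by (rule compact_trace_bounded[OF opB bdB ctB]) blast
  have orth: "L2_ip Lat (e i) (e j) = 0" if "i \<noteq> j" for i j
    using that orthogonal_L2[of "Suc i" "Suc j"] by (simp add: ip)
  have norm: "(L2_norm Lat (e j))\<^sup>2 = (1 + lam (Suc j)) * (L2_norm SB (t j))\<^sup>2" for j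
    using orthogonal_L2[of "Suc j" "Suc j"] lam_nonneg[of "Suc j"] by (simp add: L2_norm_sq ip)
  have le: "(L2_norm Lat (e j))\<^sup>2 \<le> C\<^sup>2 * ((1 + lam (Suc j)) * (H1_norm B (coeff h j))\<^sup>2)" for j
  proof -
    have "(L2_norm SB (t j))\<^sup>2 \<le> (C * H1_norm B (coeff h j))\<^sup>2"
      by (intro power_mono C(2)[OF t] L2_norm_nonneg)
    then have "(1 + lam (Suc j)) * (L2_norm SB (t j))\<^sup>2 \<le> (1 + lam (Suc j)) * (C * H1_norm B (coeff h j))\<^sup>2"
      using lam_nonneg[of "Suc j"] by (intro mult_left_mono) auto
    then show ?thesis by (simp add: norm power_mult_distrib mult_ac)
  qed
  have summ: "summable (\<lambda>j. (L2_norm Lat (e j))\<^sup>2)"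
    by (rule summable_comparison_test'[OF summable_mult[OF neumann_expansion(1)[OF p m], of "C\<^sup>2"], of 0])
      (use le in auto)
  obtain g where g: "g \<in> Lp 2 Lat" "(\<lambda>n. L2_norm Lat (\<lambda>z. (\<Sum>j<n. e j z) - g z)) \<longlonglongrightarrow> 0"
    by (rule L2_orthogonal_series_converges[OF eL orth summ])
  have "has_trace (A \<times> B) Lat h g"
    by (rule has_trace_closed[OF opAB bdAB has_trace_sum[OF opAB bdAB he] sobolev_pair_H1[OF p] g(1)
          neumann_expansion(2)[OF p m] g(2)])
  then show ?thesis by (rule exI[where x=g])
qed

lemma has_lateral_trace:
  assumes "h \<in> H1 (A \<times> B)"
  shows "has_trace (A \<times> B) Lat h (trace_on (A \<times> B) Lat h)"
proof -
  obtain h' H where r: "sobolev_pair (A \<times> B) h' H" "sobolev_pair (A \<times> B) h H"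
    "h' \<in> Lp 2 PAB" "H \<in> Lp 2 PAB" "AE z in LAB. h z = h' z"
    by (rule sobolev_representative[OF assms])
  obtain t where "has_trace (A \<times> B) Lat h' t" using lateral_trace_exists_rep[OF r(1,3,4)] ..
  then have "has_trace (A \<times> B) Lat h t"
    by (rule has_trace_cong_AE[OF opAB bdAB _ assms]) (use r(5) in eventually_elim, simp)
  then have "\<exists>t. has_trace (A \<times> B) Lat h t" by (rule exI[where x=t])
  then show ?thesis unfolding trace_on_def by (rule someI_ex)
qed

text \<open>
  By averaging, uniqueness of lateral traces is reduced to uniqueness of traces on \<open>B\<close> and completeness of the
  eigenfunctions on \<open>A\<close>.
\<close>

lemma lateral_trace_unique:
  assumes p: "sobolev_pair (A \<times> B) h H" and m: "h \<in> Lp 2 PAB" "H \<in> Lp 2 PAB"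
    and t: "has_trace (A \<times> B) Lat h t" "has_trace (A \<times> B) Lat h t'"
  shows "AE z in Lat. t z = t' z"
proof -
  note tL = has_traceD(2)[OF t(1)] has_traceD(2)[OF t(2)]
  note d = Lp2_diff[OF tL]
  have "L2_norm Lat (\<lambda>z. t z - t' z) = 0"
  proof (rule L2_zero_if_avgs_zero[OF lateral_pair d])
    fix j :: nat assume j: "1 \<le> j"
    note fj = f_L2[OF j]
    show "AE y in SB. avg (f j) (\<lambda>z. t z - t' z) y = 0"
      using trace_unique_AE[OF opB bdB ctB has_trace_avg[OF p m t(1) fj] has_trace_avg[OF p m t(2) fj]]
        lat.avg_diff_AE[OF fj tL]
      by eventually_elim simp
  qed
  then show ?thesis by (simp add: L2_norm_eq_0_iff[OF d])
qed

end

section \<open>Tensor products of eigenfunctions\<close>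

context trace_pair
begin

interpretation lat: finite_pair LA SB by (rule lateral_pair)

text \<open>
  For fixed \<open>h\<close>, the term on \<open>B\<close> in the identity for \<open>f \<otimes> s\<close> is the Dirichlet form of \<open>s\<close> and the average of \<open>h\<close>. The Steklov
  equation turns it into an integral over the boundary of \<open>B\<close>, which is unfolded to the lateral boundary because averaging
  commutes with traces.
\<close>

lemma NSL_tensor:
  assumes j: "1 \<le> j" and stek: "steklov_eigenpair B b \<delta> s" and b: "b \<in> borel_measurable SB" "AE y in SB. \<bar>b y\<bar> \<le> Cb"
  shows "NSL_eigenfunction A B b (lam j, \<delta>) (f j \<otimes>\<^sub>f s)"
proof -
  let ?u = "\<lambda>z. f j (fst z) * s (snd z)"
  have u_eq: "f j \<otimes>\<^sub>f s = ?u" by (simp add: tensor_def case_prod_unfold)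
  have Lat_eq: "lateral_measure A B = Lat" by (simp add: lateral_measure_def)
  have sH: "s \<in> H1 B" and s0: "\<not> ae_zero B s"
    and sdir: "\<And>h. h \<in> H1 B \<Longrightarrow> dirichlet_form B s h = \<delta> * bd_form B b s h"
    using stek by (auto simp: steklov_eigenpair_def)
  note pf = pair_f[OF j] and ps = sobolev_pair_wgrad[OF sH]
  note pu = sobolev_pair_tensor[OF pf ps] and mu = tensor_sobolev_L2[OF pf ps]
  note fL = f_L2[OF j] and sL = sobolev_pair_L2(1)[OF ps]
  have uH: "?u \<in> H1 (A \<times> B)" by (rule sobolev_pair_H1[OF pu])
  define ts where "ts = bd_trace B s"
  have ts: "has_trace B SB s ts" unfolding ts_def by (rule has_trace_bd_trace[OF ctB sH])
  note tsL = has_traceD(2)[OF ts]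
  have "\<not> ae_zero (A \<times> B) ?u"
  proof
    assume "ae_zero (A \<times> B) ?u"
    then have "AE z in PAB. ?u z = 0" unfolding ae_zero_def using AE_zero_LAB[OF mu(1)] by simp
    then have "L2_norm PAB ?u = 0" by (simp add: L2_norm_eq_0_iff[OF mu(1)])
    then have "L2_norm LA (f j) = 0 \<or> L2_norm LB s = 0" using L2_norm_tensor[OF fL sL] by simp
    moreover have "L2_norm LB s \<noteq> 0" using s0 by (simp add: L2_norm_eq_0_iff[OF sL] ae_zero_def)
    moreover have "(L2_norm LA (f j))\<^sup>2 \<noteq> 0" using orthogonal_L2[OF j j] lam_nonneg[OF j] by (simp add: L2_norm_sq)
    ultimately show False by simp
  qed
  moreover have "dirichlet_form (A \<times> B) ?u h = lam j * L2_inner (A \<times> B) ?u h +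
     \<delta> * (LINT x|LA. LINT y|SB. b y * trace_on (A \<times> B) Lat ?u (x, y) * trace_on (A \<times> B) Lat h (x, y))"
    if hH: "h \<in> H1 (A \<times> B)" for h
  proof -
    obtain h' H where r: "sobolev_pair (A \<times> B) h' H" "sobolev_pair (A \<times> B) h H"
      "h' \<in> Lp 2 PAB" "H \<in> Lp 2 PAB" "AE z in LAB. h z = h' z"
      by (rule sobolev_representative[OF hH])
    define tu where "tu = trace_on (A \<times> B) Lat ?u"
    define th where "th = trace_on (A \<times> B) Lat h"
    have tu: "has_trace (A \<times> B) Lat ?u tu" unfolding tu_def by (rule has_lateral_trace[OF uH])
    have "has_trace (A \<times> B) Lat h th" unfolding th_def by (rule has_lateral_trace[OF hH])
    then have th: "has_trace (A \<times> B) Lat h' th"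
      by (rule has_trace_cong_AE[OF opAB bdAB _ sobolev_pair_H1[OF r(1)] r(5)])
    note tuL = has_traceD(2)[OF tu] and thL = has_traceD(2)[OF th]
    have tu_ae: "AE z in Lat. tu z = f j (fst z) * ts (snd z)"
      by (rule lateral_trace_unique[OF pu mu tu has_trace_tensor[OF sobolev_pair_H1[OF pf] ts]])
    have bts: "(\<lambda>y. b y * ts y) \<in> Lp 2 SB"
    proof (rule Lp2_bound[OF tsL])
      show "(\<lambda>y. b y * ts y) \<in> borel_measurable SB" using b(1) Lp2_measurable[OF tsL] by measurable
      show "AE y in SB. norm (b y * ts y) \<le> Cb * norm (ts y)"
        using b(2) by eventually_elim (simp add: abs_mult mult_right_mono)
    qed
    \<comment> \<open>The integrand on the lateral boundary, with the trace of \<open>u\<close> replaced by \<open>f \<otimes> ts\<close>.\<close>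
    let ?q = "\<lambda>z. th z * (f j (fst z) * (b (snd z) * ts (snd z)))"
    have qint: "integrable Lat ?q"
      using Lp2_times_integrable[OF thL, of "\<lambda>z. f j (fst z) * (b (snd z) * ts (snd z))"] lat.Lp2_tensor[OF fL bts]
      by simp
    have mq: "(\<lambda>z. b (snd z) * tu z * th z) \<in> borel_measurable Lat"
      using Lp2_measurable[OF tuL] Lp2_measurable[OF thL] b(1) by measurable
    have q_ae: "AE z in Lat. ?q z = b (snd z) * tu z * th z"
      using tu_ae by eventually_elim (simp only: mult_ac)
    have int: "integrable Lat (\<lambda>z. b (snd z) * tu z * th z)"
      by (rule Bochner_Integration.integrable_cong_AE_imp[OF qint mq q_ae])
    have "(LINT x|LA. LINT y|SB. b y * tu (x, y) * th (x, y)) = (LINT z|Lat. b (snd z) * tu z * th z)"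
      using lat.integral_fst'[OF int] by simp
    also have "\<dots> = (LINT z|Lat. ?q z)"
      by (rule integral_cong_AE[OF borel_measurable_integrable[OF qint] mq q_ae, symmetric])
    also have "\<dots> = L2_ip SB (avg (f j) th) (\<lambda>y. b y * ts y)"
      using lat.avg_adjoint[OF fL thL bts] by (simp add: L2_ip_def)
    also have "\<dots> = bd_form B b s (avg (f j) h')"
    proof -
      note tt = has_trace_avg[OF r(1,3,4) th fL]
      note hb = has_trace_bd_trace[OF ctB has_traceD(1)[OF tt]]
      have "AE y in SB. avg (f j) th y = bd_trace B (avg (f j) h') y"
        by (rule trace_unique_AE[OF opB bdB ctB tt hb])
      then have "L2_ip SB (avg (f j) th) (\<lambda>y. b y * ts y)
         = L2_ip SB (bd_trace B (avg (f j) h')) (\<lambda>y. b y * ts y)"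
        by (rule L2_ip_cong_AE)
          (use Lp2_measurable[OF has_traceD(2)[OF tt]] Lp2_measurable[OF has_traceD(2)[OF hb]] Lp2_measurable[OF bts] in auto)
      then show ?thesis by (simp add: bd_form_def L2_ip_def ts_def mult_ac)
    qed
    finally have bdry_eq: "(LINT x|LA. LINT y|SB. b y * tu (x, y) * th (x, y)) = bd_form B b s (avg (f j) h')" .
    have "dirichlet_form (A \<times> B) ?u h = dirichlet_form (A \<times> B) ?u h'"
      by (simp add: dirichlet_form_eq[OF opAB bdAB pu r(1)] dirichlet_form_eq[OF opAB bdAB pu r(2)])
    also have "\<dots> = lam j * L2_inner (A \<times> B) ?u h' + dirichlet_form B s (avg (f j) h')"
      by (rule tensor_neumann_identity[OF neumann[OF j] ps r(1,3,4)])
    also have "dirichlet_form B s (avg (f j) h') = \<delta> * bd_form B b s (avg (f j) h')"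
      by (rule sdir[OF sobolev_pair_H1[OF avg_sobolev_pair[OF r(1,3,4) fL]]])
    also have "L2_inner (A \<times> B) ?u h' = L2_inner (A \<times> B) ?u h"
      unfolding L2_inner_eq[OF opAB bdAB]
    proof (rule L2_ip_cong_AE)
      show "AE z in LAB. h' z = h z" using r(5) by eventually_elim simp
    qed (intro AE_I2 refl Lp2_measurable Lp2_LAB[OF mu(1)] Lp2_LAB[OF r(3)] sobolev_pair_L2(1)[OF r(2)])+
    finally show ?thesis unfolding bdry_eq[symmetric] tu_def th_def .
  qed
  ultimately show ?thesis
    unfolding NSL_eigenfunction_def u_eq Lat_eq using uH by simp
qed

end

theorem theorem10p3:
  fixes \<Omega>\<^sub>1 :: "'a::euclidean_space set" and \<Omega>\<^sub>2 :: "'b::euclidean_space set"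
    and b\<^sub>2 :: "'b \<Rightarrow> real"
    and lam\<^sub>1 :: "nat \<Rightarrow> real" and f\<^sub>1 :: "nat \<Rightarrow> 'a \<Rightarrow> real"
    and \<delta>\<^sub>2 :: "nat \<Rightarrow> real" and s\<^sub>2 :: "nat \<Rightarrow> 'b \<Rightarrow> real"
  assumes "region \<Omega>\<^sub>1" and "region \<Omega>\<^sub>2"
    and "cond_B1 \<Omega>\<^sub>1" and "cond_B2 \<Omega>\<^sub>1"
    and "cond_B1 \<Omega>\<^sub>2" and "cond_B2 \<Omega>\<^sub>2"
    and "cond_B3 \<Omega>\<^sub>2 b\<^sub>2"
    and "neumann_eigendata \<Omega>\<^sub>1 lam\<^sub>1 f\<^sub>1"
    and "steklov_eigendata \<Omega>\<^sub>2 b\<^sub>2 \<delta>\<^sub>2 s\<^sub>2"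
  shows "\<forall>j\<ge>1. \<forall>k. NSL_eigenfunction \<Omega>\<^sub>1 \<Omega>\<^sub>2 b\<^sub>2 (lam\<^sub>1 j, \<delta>\<^sub>2 k) (f\<^sub>1 j \<otimes>\<^sub>f s\<^sub>2 k)"
proof (intro allI impI)
  fix j k :: nat assume j: "1 \<le> j"
  have op: "open \<Omega>\<^sub>1" "open \<Omega>\<^sub>2" using assms(1,2) by (auto simp: region_def)
  have bd: "bounded \<Omega>\<^sub>1" "bounded \<Omega>\<^sub>2" using assms(3,5) by (auto simp: cond_B1_def)
  have ct: "compact_trace \<Omega>\<^sub>1" "compact_trace \<Omega>\<^sub>2" using assms(4,6) by (auto simp: cond_B2_def)
  interpret trace_pair \<Omega>\<^sub>1 \<Omega>\<^sub>2 lam\<^sub>1 f\<^sub>1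
    by (intro trace_pair.intro trace_pair_axioms.intro neumann_pair.intro domain_pair.intro neumann_basis.intro
        op bd ct assms(8) finite_measure_surface_bdry[OF op(2) assms(5)])
  have "b\<^sub>2 \<in> borel_measurable SB" "\<exists>C. AE y in SB. \<bar>b\<^sub>2 y\<bar> \<le> C"
    using assms(7) by (auto simp: cond_B3_def Let_def)
  moreover have "steklov_eigenpair \<Omega>\<^sub>2 b\<^sub>2 (\<delta>\<^sub>2 k) (s\<^sub>2 k)"
    using assms(9) by (simp add: steklov_eigendata_def)
  ultimately show "NSL_eigenfunction \<Omega>\<^sub>1 \<Omega>\<^sub>2 b\<^sub>2 (lam\<^sub>1 j, \<delta>\<^sub>2 k) (f\<^sub>1 j \<otimes>\<^sub>f s\<^sub>2 k)"
    using NSL_tensor[OF j] by blast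
qed

end
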